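(* Let $F=x_0^{11}+x_1^5x_2^6\in\mathbb{C}[x_0,x_1,x_2]_{11}$ (so that $\underline{\mathbf{rk}}(F)=7$) and let $J=(y_0y_1,y_0y_2,y_1^6)\subset\mathrm{Ann}(F)\subset S=\mathbb{C}[y_0,y_1,y_2]$. Then $\underline{\mathrm{VSP}}(F,7)=\phi_{7,\mathbb{P}^2}^{-1}(\mathrm{Proj}(S/J))$ and it is reducible.
   Context: $X=\mathbb{P}^2$; $S=\mathbb{C}[y_0,y_1,y_2]$ and $T=\mathbb{C}[x_0,x_1,x_2]$ are standard graded, $S$ acting on $T$ by differentiation ($y_i\circ x_j=\delta_{ij}$); $\mathrm{Ann}(F)=\{\psi\in S:\psi\circ F=0\}$. $\underline{\mathbf{rk}}(F)$ is the least $r$ such that $[F]$ lies in the $r$-th secant variety of the Veronese variety $\nu_{11}(\mathbb{P}^2)\subset\mathbb{P}(T_{11})$. $h_{r,\mathbb{P}^2}(k)=\min\{r,\dim_{\mathbb C}S_k\}$; $\mathrm{Slip}_{r,\mathbb{P}^2}$ is the irreducible component of the multigraded (Haiman–Sturmfels) Hilbert scheme $\mathrm{Hilb}_S^{h_{r,\mathbb{P}^2}}$ (of homogeneous ideals whose quotient has Hilbert function $h_{r,\mathbb{P}^2}$) that is the closure of the locus of saturated ideals of $r$ distinct points with Hilbert function $h_{r,\mathbb{P}^2}$. $\underline{\mathrm{VSP}}(F,r)=\{I\in\mathrm{Slip}_{r,\mathbb{P}^2}:I\subset\mathrm{Ann}(F)\}$. $\phi_{r,\mathbb{P}^2}\colon\mathrm{Slip}_{r,\mathbb{P}^2}\to\mathrm{Hilb}^r(\mathbb{P}^2)$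 sends $I$ to $\mathrm{Proj}(S/I)$. Equality is as closed subsets. *)

theory Defs
  imports "HOL-Analysis.Analysis" "HOL-Library.Poly_Mapping" "HOL-Library.Numeral_Type"
begin

section \<open>Polynomials with complex coefficients\<close>

text \<open>
  A polynomial over the complex numbers in variables indexed by \<open>'v\<close> is a finitely supported
  family of coefficients indexed by exponent vectors.  The ring \<open>poly3\<close> plays both the role of
  \<open>S\<close> (variables \<open>y\<^sub>0, y\<^sub>1, y\<^sub>2\<close>) and of \<open>T\<close> (variables \<open>x\<^sub>0, x\<^sub>1, x\<^sub>2\<close>).
\<close>

type_synonym 'v cpoly = "('v \<Rightarrow>\<^sub>0 nat) \<Rightarrow>\<^sub>0 complex"
type_synonym poly3 = "3 cpoly"

definition Var :: "'v \<Rightarrow> 'v cpoly" where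
  "Var i = Poly_Mapping.single (Poly_Mapping.single i 1) 1"

definition cscale :: "complex \<Rightarrow> 'v cpoly \<Rightarrow> 'v cpoly" where
  "cscale c p = Poly_Mapping.single 0 c * p"

definition mdegree :: "('v \<Rightarrow>\<^sub>0 nat) \<Rightarrow> nat" where
  "mdegree m = (\<Sum>i\<in>Poly_Mapping.keys m. Poly_Mapping.lookup m i)"

definition hom_part :: "nat \<Rightarrow> 'v cpoly set" where
  "hom_part k = {p. \<forall>m\<in>Poly_Mapping.keys p. mdegree m = k}"

definition peval :: "('v \<Rightarrow> complex) \<Rightarrow> 'v cpoly \<Rightarrow> complex" where
  "peval v p = (\<Sum>m\<in>Poly_Mapping.keys p. Poly_Mapping.lookup p m *
                  (\<Prod>i\<in>Poly_Mapping.keys m. v i ^ Poly_Mapping.lookup m i))"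

global_interpretation cvs: vector_space "cscale :: complex \<Rightarrow> 'v cpoly \<Rightarrow> 'v cpoly"
  by unfold_locales
     (simp_all add: cscale_def distrib_left distrib_right single_add mult_single flip: mult.assoc)

text \<open>Ideals are the submodules of the ring over itself: \<open>ideal.subspace I\<close> says that \<open>I\<close> is an
  ideal, and \<open>ideal.span A\<close> is the ideal generated by \<open>A\<close>.\<close>

global_interpretation ideal: module "(*) :: 'v cpoly \<Rightarrow> 'v cpoly \<Rightarrow> 'v cpoly"
  by unfold_locales (simp_all add: algebra_simps)

definition homogeneous_ideal :: "poly3 set \<Rightarrow> bool" where
  "homogeneous_ideal I \<longleftrightarrow> ideal.subspace I \<and> I = ideal.span (\<Union>k. I \<inter> hom_part k)"

text \<open>Hilbert function of \<open>S/I\<close>.\<close>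

definition hilbert_function :: "poly3 set \<Rightarrow> nat \<Rightarrow> nat" where
  "hilbert_function I k = cvs.dim (hom_part k :: poly3 set) - cvs.dim (I \<inter> hom_part k)"


section \<open>Apolarity\<close>

definition partial_deriv :: "'v \<Rightarrow> 'v cpoly \<Rightarrow> 'v cpoly" where
  "partial_deriv i F = (\<Sum>m\<in>Poly_Mapping.keys F.
     Poly_Mapping.single (m - Poly_Mapping.single i 1)
       (of_nat (Poly_Mapping.lookup m i) * Poly_Mapping.lookup F m))"

definition apolar :: "poly3 \<Rightarrow> poly3 \<Rightarrow> poly3" where
  "apolar \<psi> F = (\<Sum>a\<in>Poly_Mapping.keys \<psi>. cscale (Poly_Mapping.lookup \<psi> a)
     ((partial_deriv 0 ^^ Poly_Mapping.lookup a 0)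
       ((partial_deriv 1 ^^ Poly_Mapping.lookup a 1)
         ((partial_deriv 2 ^^ Poly_Mapping.lookup a 2) F))))"

definition Ann :: "poly3 \<Rightarrow> poly3 set" where
  "Ann F = {\<psi>. apolar \<psi> F = 0}"


section \<open>Secant varieties of Veronese varieties and border rank\<close>

text \<open>Representatives of the points in the span of \<open>r\<close> points \<open>[L\<^sub>i\<^sup>d]\<close> of the Veronese variety
  \<open>\<nu>\<^sub>d(\<P>\<^sup>2) \<subseteq> \<P>(T\<^sub>d)\<close>.\<close>

definition veronese_spans :: "nat \<Rightarrow> nat \<Rightarrow> poly3 set" where
  "veronese_spans d r = {G. \<exists>(c :: nat \<Rightarrow> complex) (L :: nat \<Rightarrow> poly3).
     (\<forall>i<r. L i \<in> hom_part 1 \<and> L i \<noteq> 0) \<and> G = (\<Sum>i<r. cscale (c i) (L i ^ d))}"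

text \<open>The closure in \<open>\<P>(T\<^sub>d)\<close>, again through representatives: a homogeneous polynomial function on
  \<open>T\<^sub>d\<close> is a homogeneous \<open>p\<close> whose variables are the coefficients of a form.\<close>

definition secant_variety :: "nat \<Rightarrow> nat \<Rightarrow> poly3 set" where
  "secant_variety d r = {G \<in> hom_part d. G \<noteq> 0 \<and>
     (\<forall>e. \<forall>p \<in> hom_part e. (\<forall>H\<in>veronese_spans d r. peval (Poly_Mapping.lookup H) p = 0) \<longrightarrow>
          peval (Poly_Mapping.lookup G) p = 0)}"

definition border_rank :: "nat \<Rightarrow> poly3 \<Rightarrow> nat" where
  "border_rank d F = (LEAST r. F \<in> secant_variety d r)"


section \<open>The multigraded Hilbert scheme, through its closed points\<close>

definition hilb :: "(nat \<Rightarrow> nat) \<Rightarrow> poly3 set set" where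
  "hilb h = {I. homogeneous_ideal I \<and> (\<forall>k. hilbert_function I k = h k)}"

text \<open>
  The Zariski topology is induced from the embedding \<open>I \<mapsto> (I\<^sub>k)\<^sub>k\<close> into products of Grassmannians
  of subspaces of \<open>S\<^sub>k\<close>.  A Grassmannian is the quotient of the variety of bases (frames) by the
  general linear group, so a set of subspaces is closed iff the set of all bases of its members is
  cut out by polynomial equations in the coordinates of the basis vectors.  Each equation involves
  only finitely many degrees \<open>k\<close>.  The entries \<open>b k j\<close> beyond the length of the basis are
  required to vanish, so that they do not contribute additional coordinates.
\<close>

definition is_frame :: "poly3 set \<Rightarrow> (nat \<Rightarrow> nat \<Rightarrow> poly3) \<Rightarrow> bool" where
  "is_frame I b \<longleftrightarrow> (\<forall>k. let n = cvs.dim (I \<inter> hom_part k) in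
     inj_on (b k) {..<n} \<and> cvs.independent (b k ` {..<n}) \<and>
     cvs.span (b k ` {..<n}) = I \<inter> hom_part k \<and> (\<forall>j\<ge>n. b k j = 0))"

definition frame_coords :: "(nat \<Rightarrow> nat \<Rightarrow> poly3) \<Rightarrow> nat \<times> nat \<times> (3 \<Rightarrow>\<^sub>0 nat) \<Rightarrow> complex" where
  "frame_coords b = (\<lambda>(k, j, m). Poly_Mapping.lookup (b k j) m)"

definition hilb_closed :: "(nat \<Rightarrow> nat) \<Rightarrow> poly3 set set \<Rightarrow> bool" where
  "hilb_closed h Z \<longleftrightarrow> Z \<subseteq> hilb h \<and>
     (\<exists>P :: (nat \<times> nat \<times> (3 \<Rightarrow>\<^sub>0 nat)) cpoly set.
        \<forall>I\<in>hilb h. \<forall>b. is_frame I b \<longrightarrow> (I \<in> Z \<longleftrightarrow> (\<forall>p\<in>P. peval (frame_coords b) p = 0)))"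

definition hilb_topology :: "(nat \<Rightarrow> nat) \<Rightarrow> poly3 set topology" where
  "hilb_topology h = topology (\<lambda>U. U \<subseteq> hilb h \<and> hilb_closed h (hilb h - U))"

subsection \<open>These sets form a topology\<close>

lemma peval_superset:
  assumes "finite A" "Poly_Mapping.keys p \<subseteq> A"
  shows "peval v p = (\<Sum>m\<in>A. Poly_Mapping.lookup p m *
                  (\<Prod>i\<in>Poly_Mapping.keys m. v i ^ Poly_Mapping.lookup m i))"
  unfolding peval_def using assms
  by (intro sum.mono_neutral_left) (auto simp: in_keys_iff)

lemma peval_zero [simp]: "peval v 0 = 0"
  by (simp add: peval_def)

lemma peval_one [simp]: "peval v 1 = 1"
  by (simp add: peval_def)

lemma peval_add: "peval v (p + q) = peval v p + peval v q"
proof -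
  let ?A = "Poly_Mapping.keys p \<union> Poly_Mapping.keys q"
  have "peval v (p + q) = (\<Sum>m\<in>?A. Poly_Mapping.lookup (p + q) m *
                  (\<Prod>i\<in>Poly_Mapping.keys m. v i ^ Poly_Mapping.lookup m i))"
    by (rule peval_superset) (auto dest: Poly_Mapping.keys_add[THEN subsetD])
  moreover have "peval v p = (\<Sum>m\<in>?A. Poly_Mapping.lookup p m *
                  (\<Prod>i\<in>Poly_Mapping.keys m. v i ^ Poly_Mapping.lookup m i))"
    by (rule peval_superset) auto
  moreover have "peval v q = (\<Sum>m\<in>?A. Poly_Mapping.lookup q m *
                  (\<Prod>i\<in>Poly_Mapping.keys m. v i ^ Poly_Mapping.lookup m i))"
    by (rule peval_superset) auto
  ultimately show ?thesis
    by (simp add: lookup_add algebra_simps sum.distrib)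
qed

lemma peval_sum: "peval v (sum f A) = (\<Sum>a\<in>A. peval v (f a))"
  by (induction A rule: infinite_finite_induct) (auto simp: peval_add)

lemma peval_single:
  "peval v (Poly_Mapping.single m c) =
     c * (\<Prod>i\<in>Poly_Mapping.keys m. v i ^ Poly_Mapping.lookup m i)"
  by (subst peval_superset[where A = "{m}"]) auto

lemma cpoly_eq_sum_single:
  fixes p :: "'v cpoly"
  shows "p = (\<Sum>m\<in>Poly_Mapping.keys p. Poly_Mapping.single m (Poly_Mapping.lookup p m))"
proof (rule poly_mapping_eqI)
  fix k
  show "Poly_Mapping.lookup p k = Poly_Mapping.lookup
          (\<Sum>m\<in>Poly_Mapping.keys p. Poly_Mapping.single m (Poly_Mapping.lookup p m)) k"
    by (auto simp: lookup_sum lookup_single when_def sum.delta in_keys_iff)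
qed

lemma monomial_value_add:
  fixes v :: "'v \<Rightarrow> complex"
  shows "(\<Prod>i\<in>Poly_Mapping.keys (m + n). v i ^ Poly_Mapping.lookup (m + n) i) =
     (\<Prod>i\<in>Poly_Mapping.keys m. v i ^ Poly_Mapping.lookup m i) *
     (\<Prod>i\<in>Poly_Mapping.keys n. v i ^ Poly_Mapping.lookup n i)"
proof -
  let ?A = "Poly_Mapping.keys m \<union> Poly_Mapping.keys n"
  have *: "(\<Prod>i\<in>Poly_Mapping.keys k. v i ^ Poly_Mapping.lookup k i) =
        (\<Prod>i\<in>?A. v i ^ Poly_Mapping.lookup k i)" if "Poly_Mapping.keys k \<subseteq> ?A" for k
    using that by (intro prod.mono_neutral_left) (auto simp: in_keys_iff)
  show ?thesis
    by (subst (1 2 3) *) (auto simp: lookup_add power_add prod.distrib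
          dest: Poly_Mapping.keys_add[THEN subsetD])
qed

lemma peval_mult: "peval v (p * q) = peval v p * peval v q"
proof -
  have "p * q = (\<Sum>m\<in>Poly_Mapping.keys p. \<Sum>n\<in>Poly_Mapping.keys q.
      Poly_Mapping.single (m + n) (Poly_Mapping.lookup p m * Poly_Mapping.lookup q n))"
    by (subst cpoly_eq_sum_single[of p], subst cpoly_eq_sum_single[of q])
       (simp only: sum_product mult_single)
  then have "peval v (p * q) = (\<Sum>m\<in>Poly_Mapping.keys p. \<Sum>n\<in>Poly_Mapping.keys q.
      (Poly_Mapping.lookup p m * Poly_Mapping.lookup q n) *
      (\<Prod>i\<in>Poly_Mapping.keys (m + n). v i ^ Poly_Mapping.lookup (m + n) i))"
    by (simp only: peval_sum peval_single)
  also have "\<dots> = peval v p * peval v q"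
    unfolding peval_def sum_product monomial_value_add by (simp add: mult_ac)
  finally show ?thesis .
qed

lemma hilb_closed_empty: "hilb_closed h {}"
  unfolding hilb_closed_def by (auto intro!: exI[of _ "{1}"])

lemma hilb_closed_hilb: "hilb_closed h (hilb h)"
  unfolding hilb_closed_def by (auto intro!: exI[of _ "{}"])

lemma hilb_closed_Un:
  assumes "hilb_closed h Y" "hilb_closed h Z"
  shows "hilb_closed h (Y \<union> Z)"
proof -
  obtain P where P: "\<And>I b. I \<in> hilb h \<Longrightarrow> is_frame I b \<Longrightarrow>
      I \<in> Y \<longleftrightarrow> (\<forall>p\<in>P. peval (frame_coords b) p = 0)"
    using assms(1) unfolding hilb_closed_def by metis
  obtain Q where Q: "\<And>I b. I \<in> hilb h \<Longrightarrow> is_frame I b \<Longrightarrow>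
      I \<in> Z \<longleftrightarrow> (\<forall>p\<in>Q. peval (frame_coords b) p = 0)"
    using assms(2) unfolding hilb_closed_def by metis
  let ?R = "(\<lambda>(p, q). p * q) ` (P \<times> Q)"
  have "I \<in> Y \<union> Z \<longleftrightarrow> (\<forall>p\<in>?R. peval (frame_coords b) p = 0)"
    if "I \<in> hilb h" "is_frame I b" for I b
    using P[OF that] Q[OF that] by (auto simp: peval_mult)
  moreover have "Y \<union> Z \<subseteq> hilb h"
    using assms unfolding hilb_closed_def by blast
  ultimately show ?thesis
    unfolding hilb_closed_def by (intro conjI exI[of _ ?R] ballI allI impI)
qed

lemma hilb_closed_Inter:
  assumes "\<And>Z. Z \<in> K \<Longrightarrow> hilb_closed h Z" "K \<noteq> {}"
  shows "hilb_closed h (\<Inter>K)"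
proof -
  have "\<exists>P. \<forall>I\<in>hilb h. \<forall>b. is_frame I b \<longrightarrow>
      (I \<in> Z \<longleftrightarrow> (\<forall>p\<in>P. peval (frame_coords b) p = 0))" if "Z \<in> K" for Z
    using assms(1)[OF that] unfolding hilb_closed_def by blast
  then obtain P where P: "\<And>Z I b. Z \<in> K \<Longrightarrow> I \<in> hilb h \<Longrightarrow> is_frame I b \<Longrightarrow>
      I \<in> Z \<longleftrightarrow> (\<forall>p\<in>P Z. peval (frame_coords b) p = 0)"
    by metis
  have "I \<in> \<Inter>K \<longleftrightarrow> (\<forall>p\<in>(\<Union>Z\<in>K. P Z). peval (frame_coords b) p = 0)"
    if "I \<in> hilb h" "is_frame I b" for I b
    using P[OF _ that] by blast
  moreover have "\<Inter>K \<subseteq> hilb h"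
    using assms unfolding hilb_closed_def by blast
  ultimately show ?thesis
    unfolding hilb_closed_def by blast
qed

lemma istopology_hilb: "istopology (\<lambda>U. U \<subseteq> hilb h \<and> hilb_closed h (hilb h - U))"
  unfolding istopology_def
proof (intro conjI allI impI)
  fix S T assume S: "S \<subseteq> hilb h \<and> hilb_closed h (hilb h - S)"
    and T: "T \<subseteq> hilb h \<and> hilb_closed h (hilb h - T)"
  show "S \<inter> T \<subseteq> hilb h" using S by blast
  show "hilb_closed h (hilb h - S \<inter> T)"
    using hilb_closed_Un S T by (metis Diff_Int)
next
  fix K assume K: "\<forall>U\<in>K. U \<subseteq> hilb h \<and> hilb_closed h (hilb h - U)"
  show "\<Union>K \<subseteq> hilb h" using K by blast
  show "hilb_closed h (hilb h - \<Union>K)"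
  proof (cases "K = {}")
    case True
    then show ?thesis by (simp add: hilb_closed_hilb)
  next
    case False
    then have eq: "hilb h - \<Union>K = \<Inter>((\<lambda>U. hilb h - U) ` K)" by blast
    show ?thesis
      unfolding eq using K False by (intro hilb_closed_Inter) blast+
  qed
qed

lemma openin_hilb_topology:
  "openin (hilb_topology h) U \<longleftrightarrow> U \<subseteq> hilb h \<and> hilb_closed h (hilb h - U)"
  by (simp add: hilb_topology_def istopology_hilb)

lemma topspace_hilb_topology: "topspace (hilb_topology h) = hilb h"
proof -
  have "openin (hilb_topology h) (hilb h)"
    by (simp add: openin_hilb_topology hilb_closed_empty)
  moreover have "topspace (hilb_topology h) \<subseteq> hilb h"
    using openin_topspace[of "hilb_topology h"] by (simp only: openin_hilb_topology)
  ultimately show ?thesis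
    by (simp add: openin_subset subset_antisym)
qed

lemma closedin_hilb_topology: "closedin (hilb_topology h) Z \<longleftrightarrow> hilb_closed h Z"
proof -
  have "hilb h - (hilb h - Z) = Z" if "Z \<subseteq> hilb h" using that by blast
  moreover have "Z \<subseteq> hilb h" if "hilb_closed h Z"
    using that by (simp add: hilb_closed_def)
  ultimately show ?thesis
    by (metis Diff_subset closedin_def openin_hilb_topology topspace_hilb_topology)
qed


section \<open>Slip, border varieties of sums of powers, and the map to the Hilbert scheme of points\<close>

definition generic_hf :: "nat \<Rightarrow> nat \<Rightarrow> nat" where
  "generic_hf r k = min r (cvs.dim (hom_part k :: poly3 set))"

definition points_ideal :: "(complex ^ 3) set \<Rightarrow> poly3 set" where
  "points_ideal V = ideal.span {f. (\<exists>k. f \<in> hom_part k) \<and> (\<forall>v\<in>V. peval (\<lambda>i. v $ i) f = 0)}"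

text \<open>\<open>r\<close> distinct points of the projective plane are given by \<open>r\<close> nonzero vectors, no two of them
  proportional.\<close>

definition point_ideals :: "nat \<Rightarrow> poly3 set set" where
  "point_ideals r = {I \<in> hilb (generic_hf r). \<exists>V :: (complex ^ 3) set.
     finite V \<and> card V = r \<and> 0 \<notin> V \<and>
     (\<forall>v\<in>V. \<forall>w\<in>V. v \<noteq> w \<longrightarrow> (\<forall>c. v \<noteq> c *s w)) \<and> I = points_ideal V}"

definition slip :: "nat \<Rightarrow> poly3 set set" where
  "slip r = hilb_topology (generic_hf r) closure_of point_ideals r"

definition border_vsp :: "poly3 \<Rightarrow> nat \<Rightarrow> poly3 set set" where
  "border_vsp F r = {I \<in> slip r. I \<subseteq> Ann F}"

text \<open>Substitution \<open>y\<^sub>i := 1\<close>.\<close>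

definition dehomogenize :: "3 \<Rightarrow> poly3 \<Rightarrow> poly3" where
  "dehomogenize i f = (\<Sum>m\<in>Poly_Mapping.keys f.
     Poly_Mapping.single (Poly_Mapping.update i 0 m) (Poly_Mapping.lookup f m))"

text \<open>
  A closed subscheme of the projective plane is given by its ideal sheaf, i.e. by one ideal on each
  of the charts \<open>D\<^sub>+(y\<^sub>i)\<close>.  For a homogeneous ideal \<open>I\<close>, the ideal of \<open>Proj (S/I)\<close> on this chart
  is the degree-zero part of the localisation of \<open>I\<close> at \<open>y\<^sub>i\<close>; identifying the coordinate ring of
  the chart with the polynomials in the other two variables, it is the set of all \<open>f(y\<^sub>i := 1)\<close>
  with \<open>f \<in> I\<close>.
\<close>

definition proj_subscheme :: "poly3 set \<Rightarrow> 3 \<Rightarrow> poly3 set" where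
  "proj_subscheme I i = dehomogenize i ` I"

definition phi :: "nat \<Rightarrow> poly3 set \<Rightarrow> 3 \<Rightarrow> poly3 set" where
  "phi r = restrict proj_subscheme (slip r)"

definition reducible_space :: "'a topology \<Rightarrow> bool" where
  "reducible_space X \<longleftrightarrow> (\<exists>A B. closedin X A \<and> closedin X B \<and>
     A \<noteq> topspace X \<and> B \<noteq> topspace X \<and> A \<union> B = topspace X)"

end

theory Submission
  imports Defs
begin

text \<open>
  The border rank is bounded below by a 7-minor of the catalecticant matrix and above by writing
  \<open>x\<^sub>1\<^sup>5x\<^sub>2\<^sup>6\<close> as a limit of sums of six powers of \<open>x\<^sub>2 + t\<zeta>\<^sup>jx\<^sub>1\<close>, with \<open>\<zeta>\<close> a sixth root of unity.
  An ideal \<open>I \<subseteq> Ann(F)\<close> with the generic Hilbert function agrees with \<open>J\<close> in degrees 5 and 6 by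
  dimension, hence in all higher degrees, because \<open>J\<close> is generated in degrees up to 6; conversely
  \<open>J\<close> is saturated.

  So \<open>I\<close> is determined by \<open>I\<^sub>3 = y\<^sub>0V\<close> and \<open>I\<^sub>4 = y\<^sub>0W\<close>, where \<open>V\<close> is a net of quadrics through
  \<open>[1:0:0]\<close> and \<open>W\<close> is the kernel of a functional \<open>G\<close> on the cubics through \<open>[1:0:0]\<close> with
  \<open>S\<^sub>1V \<subseteq> W\<close>. The catalecticant of \<open>G\<close> has rank at most 2. If the rank is 2, then \<open>V\<close> is its kernel
  and consists of the quadrics through three points. Hence every point of the fibre satisfies one of
  two closed conditions, one on \<open>V\<close> and one on \<open>G\<close>. Neither holds on the whole fibre: let the six
  points \<open>[s(\<tau>):\<tau>:1]\<close>, \<open>\<tau>\<^sup>6 = t\<close>, collide along the curves \<open>s = t\<tau>\<^sup>2 + t\<^sup>d\<tau>\<^sup>5\<close>. For \<open>d = 1\<close> the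
  limit has \<open>G = x\<^sub>1\<^sup>3 + x\<^sub>2\<^sup>3\<close>, and for \<open>d = 2\<close> it has \<open>G = x\<^sub>1\<^sup>3\<close> and
  \<open>V = \<langle>y\<^sub>0y\<^sub>2, y\<^sub>1y\<^sub>2, y\<^sub>0y\<^sub>1 - y\<^sub>2\<^sup>2\<rangle>\<close>.
\<close>

abbreviation coef :: "('a \<Rightarrow>\<^sub>0 'b::zero) \<Rightarrow> 'a \<Rightarrow> 'b" where
  "coef \<equiv> Poly_Mapping.lookup"

abbreviation supp :: "('a \<Rightarrow>\<^sub>0 'b::zero) \<Rightarrow> 'a set" where
  "supp \<equiv> Poly_Mapping.keys"

abbreviation single :: "'a \<Rightarrow> 'b \<Rightarrow> 'a \<Rightarrow>\<^sub>0 'b::zero" where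
  "single \<equiv> Poly_Mapping.single"

section \<open>Coefficients and degrees\<close>

text \<open>Subtraction of exponent vectors is truncated, so \<open>m - n\<close> stands for
  division only when \<open>n\<close> divides \<open>m\<close>; the condition tests this.\<close>

lemma coef_single_times:
  fixes p :: "'v cpoly"
  shows "coef (single n c * p) m = (if \<forall>i. coef n i \<le> coef m i then c * coef p (m - n) else 0)"
proof -
  have eq: "single n c * p = (\<Sum>k\<in>supp p. single (n + k) (c * coef p k))"
    by (subst cpoly_eq_sum_single[of p]) (simp only: sum_distrib_left mult_single)
  have "coef (single n c * p) m = (\<Sum>k\<in>supp p. if n + k = m then c * coef p k else 0)"
    unfolding eq lookup_sum by (simp add: lookup_single when_def)
  also have "\<dots> = (if \<forall>i. coef n i \<le> coef m i then c * coef p (m - n) else 0)"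
  proof (cases "\<forall>i. coef n i \<le> coef m i")
    case True
    have "n + k = m \<longleftrightarrow> k = m - n" for k
    proof
      assume "n + k = m" then show "k = m - n" by (metis add_diff_cancel_left')
    next
      assume "k = m - n"
      then show "n + k = m" using True
        by (intro poly_mapping_eqI) (simp add: lookup_add lookup_minus)
    qed
    then have "(\<Sum>k\<in>supp p. if n + k = m then c * coef p k else 0) =
        (\<Sum>k\<in>supp p. if k = m - n then c * coef p k else 0)" by simp
    also have "\<dots> = c * coef p (m - n)"
      by (auto simp: sum.delta in_keys_iff)
    finally show ?thesis using True by simp
  next
    case False
    then have "n + k \<noteq> m" for k by (auto simp: lookup_add)
    then show ?thesis using False by (simp only: if_False sum.neutral_const)
  qed
  finally show ?thesis .
qed

lemma coef_cscale [simp]: "coef (cscale c p) m = c * coef p m"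
  by (simp add: cscale_def coef_single_times)

lemma peval_cscale [simp]: "peval v (cscale c p) = c * peval v p"
  by (simp add: cscale_def peval_mult peval_single)

lemma peval_diff: "peval v (p - q) = peval v p - peval v q"
  using peval_add[of v "p - q" q] by simp

lemma mdegree_superset:
  assumes "finite A" "supp m \<subseteq> A"
  shows "mdegree m = (\<Sum>i\<in>A. coef m i)"
  unfolding mdegree_def using assms by (intro sum.mono_neutral_left) (auto simp: in_keys_iff)

lemma mdegree_zero [simp]: "mdegree 0 = 0"
  by (simp add: mdegree_def)

lemma mdegree_add: "mdegree (m + n) = mdegree m + mdegree n"
proof -
  let ?A = "supp m \<union> supp n"
  have "mdegree (m + n) = (\<Sum>i\<in>?A. coef (m + n) i)"
    by (rule mdegree_superset) (auto dest: Poly_Mapping.keys_add[THEN subsetD])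
  moreover have "mdegree m = (\<Sum>i\<in>?A. coef m i)" "mdegree n = (\<Sum>i\<in>?A. coef n i)"
    by (rule mdegree_superset; auto)+
  ultimately show ?thesis by (simp add: lookup_add sum.distrib)
qed

lemma mdegree_single [simp]: "mdegree (single i n) = n"
  by (simp add: mdegree_def)

lemma in_hom_part_iff: "p \<in> hom_part k \<longleftrightarrow> (\<forall>m. coef p m \<noteq> 0 \<longrightarrow> mdegree m = k)"
  by (auto simp: hom_part_def in_keys_iff)

lemma subspace_hom_part: "cvs.subspace (hom_part k)"
proof -
  have "mdegree m = k" if "\<forall>m. coef p m \<noteq> 0 \<longrightarrow> mdegree m = k" "\<forall>m. coef q m \<noteq> 0 \<longrightarrow> mdegree m = k"
    "coef p m + coef q m \<noteq> 0" for p q :: "'v cpoly" and m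
    using that by (cases "coef p m = 0") auto
  then show ?thesis
    unfolding cvs.subspace_def Ball_def in_hom_part_iff
    by (simp add: lookup_add) blast
qed

lemma single_in_hom_part [simp]: "mdegree m = k \<Longrightarrow> single m c \<in> hom_part k"
  by (auto simp: hom_part_def)

lemma Var_in_hom_part [simp]: "Var i \<in> hom_part 1"
  by (simp add: Var_def)

lemma one_in_hom_part [simp]: "1 \<in> hom_part 0"
  using single_in_hom_part[of 0 0 "1::complex"] by simp

lemma mult_in_hom_part:
  assumes "p \<in> hom_part i" "q \<in> hom_part j"
  shows "p * q \<in> hom_part (i + j)"
proof -
  have "supp (p * q) \<subseteq> {a + b |a b. a \<in> supp p \<and> b \<in> supp q}" by (rule keys_mult)
  then show ?thesis using assms by (fastforce simp: hom_part_def mdegree_add)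
qed

lemma prod_in_hom_part:
  assumes "finite A" "\<And>x. x \<in> A \<Longrightarrow> f x \<in> hom_part 1"
  shows "prod f A \<in> hom_part (card A)"
  using assms
proof (induction A)
  case (insert x A)
  then show ?case using mult_in_hom_part[of "f x" 1 "prod f A" "card A"] by simp
qed simp

subsection \<open>Monomials in three variables\<close>

text \<open>Every exponent vector has this form, so identities between monomials become arithmetic
  of three natural numbers.\<close>

definition expo :: "nat \<Rightarrow> nat \<Rightarrow> nat \<Rightarrow> (3 \<Rightarrow>\<^sub>0 nat)" where
  "expo a b c = single 0 a + single 1 b + single 2 c"

lemma UNIV3: "(UNIV :: 3 set) = {0, 1, 2}"
  using UNIV_3 by auto

lemma all3: "(\<forall>i::3. P i) \<longleftrightarrow> P 0 \<and> P 1 \<and> P 2"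
  by (metis UNIV3 UNIV_I insertE singletonD)

lemma coef_expo [simp]: "coef (expo a b c) 0 = a" "coef (expo a b c) 1 = b" "coef (expo a b c) 2 = c"
  by (simp_all add: expo_def lookup_add lookup_single)

lemma expo_coef: "expo (coef m 0) (coef m 1) (coef m 2) = m"
proof (rule poly_mapping_eqI)
  show "coef (expo (coef m 0) (coef m 1) (coef m 2)) i = coef m i" for i
    using all3[of "\<lambda>i. coef (expo (coef m 0) (coef m 1) (coef m 2)) i = coef m i"] by simp
qed

lemma expo_cases: obtains a b c where "m = expo a b c"
  using expo_coef by metis

lemma expo_eq_iff [simp]: "expo a b c = expo a' b' c' \<longleftrightarrow> a = a' \<and> b = b' \<and> c = c'"
  by (metis coef_expo)

lemma expo_zero: "expo 0 0 0 = 0"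
  by (simp add: expo_def)

lemma expo_add [simp]: "expo a b c + expo a' b' c' = expo (a + a') (b + b') (c + c')"
  by (simp add: expo_def single_add algebra_simps)

lemma expo_diff [simp]: "expo a b c - expo a' b' c' = expo (a - a') (b - b') (c - c')"
  by (rule poly_mapping_eqI, rule all3[THEN iffD2, rule_format]) (simp add: lookup_minus)

lemma mdegree_expo [simp]: "mdegree (expo a b c) = a + b + c"
  by (simp add: expo_def mdegree_add)

lemma single_eq_expo: "single 0 n = expo n 0 0" "single 1 n = expo 0 n 0" "single 2 n = expo 0 0 n"
  by (simp_all add: expo_def)

lemma Var_eq_expo: "Var 0 = single (expo 1 0 0) 1" "Var 1 = single (expo 0 1 0) 1"
  "Var 2 = single (expo 0 0 1) 1"
  by (simp_all add: Var_def single_eq_expo)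

lemma coef_single_expo_times:
  fixes p :: poly3
  shows "coef (single (expo a b c) d * p) (expo a' b' c') =
     (if a \<le> a' \<and> b \<le> b' \<and> c \<le> c' then d * coef p (expo (a' - a) (b' - b) (c' - c)) else 0)"
  unfolding coef_single_times all3 by simp

lemma peval_single_expo: "peval v (single (expo a b c) d) = d * (v 0 ^ a * v 1 ^ b * v 2 ^ c)"
proof -
  have "(\<Prod>i\<in>supp (expo a b c). v i ^ coef (expo a b c) i) = (\<Prod>i\<in>UNIV. v i ^ coef (expo a b c) i)"
    by (intro prod.mono_neutral_left) (auto simp: in_keys_iff)
  also have "\<dots> = v 0 ^ a * v 1 ^ b * v 2 ^ c"
    unfolding UNIV3 by simp
  finally show ?thesis by (simp only: peval_single)
qed

lemma Var_power: "Var i ^ n = single (single i n) (1 :: complex)"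
proof (induction n)
  case (Suc n)
  have "single i 1 + single i n = single i (Suc n)"
    by (simp add: single_add[symmetric])
  then show ?case using Suc by (simp add: Var_def mult_single)
qed simp

definition mons :: "nat \<Rightarrow> (3 \<Rightarrow>\<^sub>0 nat) set" where
  "mons k = {m. mdegree m = k}"

lemma expo_in_mons [simp]: "expo a b c \<in> mons k \<longleftrightarrow> a + b + c = k"
  by (simp add: mons_def)

lemma mons_eq_image: "mons k = (\<lambda>(a, b). expo a b (k - a - b)) ` (SIGMA a:{..k}. {..k - a})"
proof (intro set_eqI iffI)
  fix m assume "m \<in> mons k"
  then show "m \<in> (\<lambda>(a, b). expo a b (k - a - b)) ` (SIGMA a:{..k}. {..k - a})"
    by (cases m rule: expo_cases) (force intro!: image_eqI)
qed auto

lemma finite_mons [simp]: "finite (mons k)"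
  by (simp add: mons_eq_image)

lemma card_mons: "card (mons k) = (\<Sum>a\<le>k. Suc (k - a))"
proof -
  have "inj_on (\<lambda>(a, b). expo a b (k - a - b)) (SIGMA a:{..k}. {..k - a})"
    by (auto simp: inj_on_def)
  then show ?thesis
    by (simp add: mons_eq_image card_image card_SigmaI)
qed

lemma in_hom_part_mons: "p \<in> hom_part k \<longleftrightarrow> supp p \<subseteq> mons k"
  by (auto simp: hom_part_def mons_def)

lemma hom_part_coef_eq_0: "p \<in> hom_part k \<Longrightarrow> m \<notin> mons k \<Longrightarrow> coef p m = 0"
  by (auto simp: in_hom_part_mons in_keys_iff subset_iff)

section \<open>Bases in reduced form\<close>

text \<open>A set \<open>N\<close> of standard monomials: every other monomial \<open>m\<close> is the leading term of exactly one
  basis element \<open>g m\<close>, whose remaining terms lie in \<open>N\<close>.\<close>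

locale reduced_basis =
  fixes W :: "poly3 set" and k :: nat and N :: "(3 \<Rightarrow>\<^sub>0 nat) set" and g :: "(3 \<Rightarrow>\<^sub>0 nat) \<Rightarrow> poly3"
  assumes subspace: "cvs.subspace W" and sub_hom: "W \<subseteq> hom_part k" and N: "N \<subseteq> mons k"
    and g_in: "\<And>m. m \<in> mons k - N \<Longrightarrow> g m \<in> W"
    and coef_g: "\<And>m m'. m \<in> mons k - N \<Longrightarrow> m' \<in> mons k - N \<Longrightarrow>
                   coef (g m) m' = (if m = m' then 1 else 0)"
    and zero: "\<And>f. f \<in> W \<Longrightarrow> supp f \<subseteq> N \<Longrightarrow> f = 0"
begin

lemma inj: "inj_on g (mons k - N)"
  by (rule inj_onI) (metis coef_g zero_neq_one)

text \<open>Subtracting the combination leaves an element of \<open>W\<close> supported on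
  \<open>N\<close>, which is zero.\<close>

lemma expansion:
  assumes "f \<in> W"
  shows "f = (\<Sum>m\<in>mons k - N. cscale (coef f m) (g m))" (is "f = ?s")
proof -
  have "?s \<in> W"
    using g_in by (intro cvs.subspace_sum cvs.subspace_scale subspace) auto
  then have d: "f - ?s \<in> W"
    using assms subspace by (intro cvs.subspace_diff) auto
  have "coef (f - ?s) m' = 0" if "m' \<notin> N" for m'
  proof (cases "m' \<in> mons k")
    case True
    then have "coef ?s m' = (\<Sum>m\<in>mons k - N. if m = m' then coef f m else 0)"
      unfolding lookup_sum by (intro sum.cong) (auto simp: coef_g that)
    then show ?thesis using True that by (simp add: lookup_minus)
  next
    case False
    then show ?thesis using d sub_hom hom_part_coef_eq_0 by blast
  qed
  then have "supp (f - ?s) \<subseteq> N" by (auto simp: in_keys_iff)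
  then show ?thesis using zero[OF d] by simp
qed

lemma independent: "cvs.independent (g ` (mons k - N))"
proof (rule cvs.independent_if_scalars_zero)
  fix u x assume *: "(\<Sum>x\<in>g ` (mons k - N). cscale (u x) x) = 0" and "x \<in> g ` (mons k - N)"
  then obtain m' where m': "m' \<in> mons k - N" "x = g m'" by auto
  have "0 = coef (\<Sum>m\<in>mons k - N. cscale (u (g m)) (g m)) m'"
    using * by (simp add: sum.reindex[OF inj])
  also have "\<dots> = (\<Sum>m\<in>mons k - N. if m = m' then u (g m) else 0)"
    unfolding lookup_sum using m' by (intro sum.cong) (auto simp: coef_g)
  also have "\<dots> = u x" using m' by simp
  finally show "u x = 0" by simp
qed simp

lemma span: "cvs.span (g ` (mons k - N)) = W"
proof
  show "cvs.span (g ` (mons k - N)) \<subseteq> W"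
    using g_in subspace by (intro cvs.span_minimal) auto
  show "W \<subseteq> cvs.span (g ` (mons k - N))"
  proof
    fix f assume "f \<in> W"
    show "f \<in> cvs.span (g ` (mons k - N))"
      by (subst expansion[OF \<open>f \<in> W\<close>], intro cvs.span_sum cvs.span_scale cvs.span_base imageI)
  qed
qed

lemma dim: "cvs.dim W = card (mons k - N)"
  using independent span inj by (metis card_image cvs.dim_span_eq_card_independent)

lemma codim: "card (mons k) - cvs.dim W = card N"
  using N by (simp add: dim card_Diff_subset finite_subset[OF N] card_mono)

end

text \<open>The monomials outside \<open>N\<close> form a reduced basis.\<close>

lemma dim_monomial_space:
  assumes "N \<subseteq> mons k"
  shows "cvs.dim {f \<in> hom_part k. \<forall>m\<in>N. coef f m = 0} = card (mons k) - card N"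
proof -
  interpret reduced_basis "{f \<in> hom_part k. \<forall>m\<in>N. coef f m = 0}" k N "\<lambda>m. single m 1"
  proof
    show "cvs.subspace {f \<in> hom_part k. \<forall>m\<in>N. coef f m = 0}"
      using subspace_hom_part[of k]
      by (auto simp: cvs.subspace_def lookup_add)
    show "f = 0" if "f \<in> {f \<in> hom_part k. \<forall>m\<in>N. coef f m = 0}" "supp f \<subseteq> N" for f
      using that by (intro poly_mapping_eqI) (auto simp: in_keys_iff subset_iff)
  qed (use assms in \<open>auto simp: lookup_single when_def mons_def\<close>)
  show ?thesis using dim N by (simp add: card_Diff_subset finite_subset[OF N])
qed

lemma dim_hom_part: "cvs.dim (hom_part k :: poly3 set) = card (mons k)"
  using dim_monomial_space[of "{}" k] by simp

lemma hilbert_function_reduced: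
  assumes "reduced_basis (I \<inter> hom_part k) k N g"
  shows "hilbert_function I k = card N"
  using reduced_basis.codim[OF assms] by (simp add: hilbert_function_def dim_hom_part)

text \<open>The ring has infinite dimension, but the finitely many monomials of degree
  \<open>k\<close> bound every independent set in \<open>hom_part k\<close>. A basis of
  \<open>U\<close> extended to one of \<open>W\<close> therefore cannot grow.\<close>

lemma subspace_eq_if_dim_eq:
  assumes "cvs.subspace U" "cvs.subspace W" "U \<subseteq> W" "W \<subseteq> hom_part k" "cvs.dim U = cvs.dim W"
  shows "U = (W :: poly3 set)"
proof -
  interpret hp: reduced_basis "hom_part k" k "{}" "\<lambda>m. single m 1"
    by unfold_locales (auto simp: lookup_single when_def mons_def subspace_hom_part)
  obtain B where B: "B \<subseteq> U" "cvs.independent B" "U = cvs.span B" "card B = cvs.dim U"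
    using cvs.basis_exists[of U] assms(1) by (metis cvs.span_minimal subset_antisym)
  obtain C where C: "B \<subseteq> C" "C \<subseteq> W" "cvs.independent C" "W \<subseteq> cvs.span C"
    using cvs.maximal_independent_subset_extend[of B W] B assms by blast
  have "C \<subseteq> cvs.span ((\<lambda>m. single m 1) ` (mons k - {}))"
    unfolding hp.span using C(2) assms(4) by (rule subset_trans)
  then have "finite C"
    by (rule cvs.independent_span_bound[OF _ C(3), THEN conjunct1, rotated]) simp
  moreover have "card C = cvs.dim W"
    using C(2-4) cvs.basis_card_eq_dim by blast
  ultimately have "B = C"
    using B C assms(5) by (metis card_subset_eq)
  then show ?thesis using B C assms by (metis subset_antisym)
qed

section \<open>Graded ideals\<close>

definition hom_comp :: "nat \<Rightarrow> 'v cpoly \<Rightarrow> 'v cpoly" where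
  "hom_comp k f = (\<Sum>m\<in>{m \<in> supp f. mdegree m = k}. single m (coef f m))"

lemma coef_hom_comp: "coef (hom_comp k f) m = (if mdegree m = k then coef f m else 0)"
  unfolding hom_comp_def lookup_sum by (auto simp: lookup_single when_def sum.delta in_keys_iff)

lemma hom_comp_add: "hom_comp k (f + g) = hom_comp k f + hom_comp k g"
  by (rule poly_mapping_eqI) (simp add: coef_hom_comp lookup_add)

lemma hom_comp_zero [simp]: "hom_comp k 0 = 0"
  by (rule poly_mapping_eqI) (simp add: coef_hom_comp)

lemma hom_comp_sum: "hom_comp k (sum f A) = (\<Sum>a\<in>A. hom_comp k (f a))"
  by (induction A rule: infinite_finite_induct) (auto simp: hom_comp_add)

lemma hom_comp_hom: "f \<in> hom_part j \<Longrightarrow> hom_comp k f = (if j = k then f else 0)"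
  by (rule poly_mapping_eqI) (auto simp: coef_hom_comp in_hom_part_iff)

lemma sum_hom_comp: "f = (\<Sum>k\<in>mdegree ` supp f. hom_comp k f)"
  by (rule poly_mapping_eqI) (auto simp: lookup_sum coef_hom_comp sum.delta in_keys_iff)

text \<open>The degree pieces of a homogeneous ideal; closure under the variables suffices because
  they generate the ring.\<close>

definition graded_family :: "(nat \<Rightarrow> 'v cpoly set) \<Rightarrow> bool" where
  "graded_family W \<longleftrightarrow> (\<forall>k. cvs.subspace (W k) \<and> W k \<subseteq> hom_part k \<and>
     (\<forall>f\<in>W k. \<forall>i. Var i * f \<in> W (Suc k)))"

lemma graded_family_single_times:
  assumes "graded_family W" "f \<in> W k"
  shows "single m c * f \<in> W (k + mdegree m)"
proof (induction "mdegree m" arbitrary: m)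
  case 0
  then have "m = 0"
    by (auto simp: mdegree_def in_keys_iff intro!: poly_mapping_eqI)
  then show ?case
    using assms by (auto simp: graded_family_def cvs.subspace_def simp flip: cscale_def)
next
  case (Suc n)
  then have "mdegree m \<noteq> 0" by simp
  then obtain i where i: "coef m i \<noteq> 0" unfolding mdegree_def by (meson sum.not_neutral_contains_not_neutral)
  have m: "m = single i 1 + (m - single i 1)"
    using i by (intro poly_mapping_eqI) (auto simp: lookup_add lookup_minus lookup_single when_def)
  then have "Suc n = Suc (mdegree (m - single i 1))"
    using Suc(2) by (metis mdegree_add mdegree_single plus_1_eq_Suc)
  then have n: "n = mdegree (m - single i 1)" by simp
  have "Var i * (single (m - single i 1) c * f) \<in> W (Suc (k + n))"
    using Suc(1)[OF n] assms(1) unfolding graded_family_def n[symmetric] by blast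
  also have "Var i * (single (m - single i 1) c * f) = single m c * f"
    by (subst (2) m) (simp add: Var_def mult_single flip: mult.assoc)
  finally show ?case by (simp add: Suc(2)[symmetric])
qed

text \<open>A multiple \<open>r * x\<close> is a sum of monomial multiples of \<open>x\<close>, each
  homogeneous and in the family, so taking a component never leaves it.\<close>

lemma graded_family_hom_comp:
  assumes "graded_family W" "f \<in> ideal.span (\<Union>k. W k)"
  shows "hom_comp k f \<in> W k"
  using assms(2)
proof (induction f rule: ideal.span_induct_alt)
  case base
  show ?case using assms(1) by (simp add: graded_family_def cvs.subspace_0)
next
  case (step r x y)
  then obtain j where j: "x \<in> W j" by auto
  have "hom_comp k (single m c * x) \<in> W k" for m c
  proof -
    have "single m c * x \<in> W (j + mdegree m)" using graded_family_single_times[OF assms(1) j] .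
    moreover have "single m c * x \<in> hom_part (j + mdegree m)"
      using calculation assms(1) by (auto simp: graded_family_def)
    ultimately show ?thesis
      using assms(1) by (auto simp: hom_comp_hom graded_family_def cvs.subspace_0)
  qed
  then have "hom_comp k (r * x) \<in> W k"
    using assms(1) unfolding graded_family_def
    by (subst cpoly_eq_sum_single[of r])
       (auto simp: sum_distrib_right hom_comp_sum intro!: cvs.subspace_sum)
  then show ?case
    using step assms(1) by (auto simp: hom_comp_add graded_family_def cvs.subspace_add)
qed

text \<open>Generating an ideal adds nothing in any degree, so an ideal may be prescribed degree by
  degree. This serves \<open>J\<close>, the ideals of points and the limit ideals.\<close>

lemma graded_family_Int:
  assumes "graded_family W"
  shows "ideal.span (\<Union>k. W k) \<inter> hom_part k = W k"
proof
  show "W k \<subseteq> ideal.span (\<Union>k. W k) \<inter> hom_part k"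
    using assms by (auto simp: graded_family_def intro: ideal.span_base)
  show "ideal.span (\<Union>k. W k) \<inter> hom_part k \<subseteq> W k"
  proof
    fix f assume f: "f \<in> ideal.span (\<Union>k. W k) \<inter> hom_part k"
    then have "hom_comp k f = f" using hom_comp_hom[of f k k] by simp
    then show "f \<in> W k" using graded_family_hom_comp[OF assms, of f k] f by simp
  qed
qed

lemma homogeneous_ideal_span:
  assumes "graded_family W"
  shows "homogeneous_ideal (ideal.span (\<Union>k. W k))"
  unfolding homogeneous_ideal_def graded_family_Int[OF assms] by (simp add: ideal.subspace_span)

lemma homogeneous_ideal_graded:
  assumes "homogeneous_ideal I"
  shows "graded_family (\<lambda>k. I \<inter> hom_part k)"
proof -
  have I: "ideal.subspace I" using assms by (simp add: homogeneous_ideal_def)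
  have "Var i * f \<in> hom_part (Suc k)" if "f \<in> hom_part k" for i :: 3 and f k
    using mult_in_hom_part[OF Var_in_hom_part that, of i] by simp
  moreover have "cvs.subspace I"
    using I by (auto simp: cvs.subspace_def ideal.subspace_def cscale_def)
  ultimately show ?thesis
    using I subspace_hom_part
    by (auto simp: graded_family_def ideal.subspace_def intro!: cvs.subspace_inter)
qed

lemma homogeneous_ideal_hom_comp:
  assumes "homogeneous_ideal I" "f \<in> I"
  shows "hom_comp k f \<in> I \<inter> hom_part k"
  using graded_family_hom_comp[OF homogeneous_ideal_graded[OF assms(1)]] assms
  by (auto simp: homogeneous_ideal_def)

section \<open>Apolarity for a sum of two monomials\<close>

lemma partial_deriv_superset:
  assumes "finite A" "supp F \<subseteq> A"
  shows "partial_deriv i F =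
    (\<Sum>m\<in>A. single (m - single i 1) (of_nat (coef m i) * coef F m))"
  unfolding partial_deriv_def using assms
  by (intro sum.mono_neutral_left) (auto simp: in_keys_iff)

lemma partial_deriv_add: "partial_deriv i (F + G) = partial_deriv i F + partial_deriv i G"
proof -
  let ?A = "supp F \<union> supp G"
  have "partial_deriv i (F + G) =
      (\<Sum>m\<in>?A. single (m - single i 1) (of_nat (coef m i) * coef (F + G) m))"
    by (rule partial_deriv_superset) (auto dest: Poly_Mapping.keys_add[THEN subsetD])
  moreover have "partial_deriv i F = (\<Sum>m\<in>?A. single (m - single i 1) (of_nat (coef m i) * coef F m))"
    "partial_deriv i G = (\<Sum>m\<in>?A. single (m - single i 1) (of_nat (coef m i) * coef G m))"
    by (rule partial_deriv_superset; auto)+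
  ultimately show ?thesis
    by (simp add: lookup_add distrib_left single_add sum.distrib)
qed

lemma partial_deriv_single:
  "partial_deriv i (single m c) = single (m - single i 1) (of_nat (coef m i) * c)"
  by (subst partial_deriv_superset[of "{m}"]) auto

lemma partial_deriv_funpow_add:
  "(partial_deriv i ^^ n) (F + G) = (partial_deriv i ^^ n) F + (partial_deriv i ^^ n) G"
  by (induction n) (simp_all add: partial_deriv_add)

text \<open>The falling factorial. Truncation is harmless: for \<open>p < n\<close> the factor with
  \<open>j = p\<close> is zero.\<close>

definition falling :: "nat \<Rightarrow> nat \<Rightarrow> complex" where
  "falling p n = of_nat (\<Prod>j<n. p - j)"

lemma falling_eq_0_iff: "falling p n = 0 \<longleftrightarrow> p < n"
  by (auto simp: falling_def)

lemma partial_deriv_funpow_single: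
  "(partial_deriv i ^^ n) (single m c) = single (m - single i n) (c * falling (coef m i) n)"
proof (induction n)
  case (Suc n)
  have "m - single i n - single i 1 = m - single i (Suc n)"
    by (rule poly_mapping_eqI) (simp add: lookup_minus lookup_single when_def)
  then show ?case
    using Suc by (simp add: partial_deriv_single falling_def lookup_minus mult_ac)
qed (simp add: falling_def)

definition deriv_coef :: "(3 \<Rightarrow>\<^sub>0 nat) \<Rightarrow> (3 \<Rightarrow>\<^sub>0 nat) \<Rightarrow> complex" where
  "deriv_coef a m = falling (coef m 0) (coef a 0) * falling (coef m 1) (coef a 1) *
     falling (coef m 2) (coef a 2)"

text \<open>Where the truncated exponent \<open>e - a\<close> or \<open>f - a\<close> is not the
  true difference, the factor \<open>deriv_coef\<close> vanishes.\<close>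

lemma apolar_two_monomials:
  "apolar \<psi> (single e 1 + single f 1) = (\<Sum>a\<in>supp \<psi>.
     single (e - a) (coef \<psi> a * deriv_coef a e) + single (f - a) (coef \<psi> a * deriv_coef a f))"
proof -
  have *: "(partial_deriv 0 ^^ coef a 0) ((partial_deriv 1 ^^ coef a 1)
      ((partial_deriv 2 ^^ coef a 2) (single m 1))) = single (m - a) (deriv_coef a m)" for a m
  proof -
    obtain a0 a1 a2 m0 m1 m2 where "a = expo a0 a1 a2" "m = expo m0 m1 m2"
      by (metis expo_cases)
    then show ?thesis
      by (simp add: partial_deriv_funpow_single single_eq_expo deriv_coef_def mult_ac)
  qed
  show ?thesis
    unfolding apolar_def partial_deriv_funpow_add *
    by (simp add: cscale_def distrib_left mult_single)
qed

definition F_form :: poly3 where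
  "F_form = single (expo 11 0 0) 1 + single (expo 0 5 6) 1"

lemma F_form_eq: "Var 0 ^ 11 + Var 1 ^ 5 * Var 2 ^ 6 = F_form"
  by (simp add: F_form_def Var_power mult_single single_eq_expo)

text \<open>The monomials divisible by one of the generators of \<open>J\<close>.\<close>

definition J_mons :: "(3 \<Rightarrow>\<^sub>0 nat) set" where
  "J_mons = {m. (coef m 0 > 0 \<and> (coef m 1 > 0 \<or> coef m 2 > 0)) \<or> coef m 1 \<ge> 6}"

lemma expo_in_J_mons: "expo a b c \<in> J_mons \<longleftrightarrow> (a > 0 \<and> (b > 0 \<or> c > 0)) \<or> b \<ge> 6"
  by (simp add: J_mons_def)

lemma J_mons_imp_Ann:
  assumes "supp \<psi> \<subseteq> J_mons"
  shows "\<psi> \<in> Ann F_form"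
proof -
  have "deriv_coef a (expo 11 0 0) = 0 \<and> deriv_coef a (expo 0 5 6) = 0" if "a \<in> J_mons" for a
    using that by (auto simp: J_mons_def deriv_coef_def falling_eq_0_iff)
  then have "apolar \<psi> F_form = 0"
    unfolding F_form_def apolar_two_monomials using assms by (intro sum.neutral) auto
  then show ?thesis by (simp add: Ann_def)
qed

text \<open>Up to degree 6 the monomials outside \<open>J\<close> send \<open>F_form\<close> to
  nonzero multiples of distinct monomials, so no combination of them annihilates it. In degree 7
  this fails: \<open>y2^7\<close> annihilates \<open>F_form\<close> but is not in
  \<open>J\<close>.\<close>

lemma Ann_imp_J_mons:
  assumes "\<psi> \<in> Ann F_form" "\<psi> \<in> hom_part k" "k \<le> 6"
  shows "supp \<psi> \<subseteq> J_mons"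
proof
  fix a assume a: "a \<in> supp \<psi>"
  let ?e = "expo 11 0 0" and ?f = "expo 0 5 6"
  have deg: "mdegree b = k" if "b \<in> supp \<psi>" for b
    using that assms(2) by (auto simp: hom_part_def)
  have zero: "(\<Sum>b\<in>supp \<psi>. (if ?e - b = n then coef \<psi> b * deriv_coef b ?e else 0) +
      (if ?f - b = n then coef \<psi> b * deriv_coef b ?f else 0)) = 0" for n
  proof -
    have "coef (apolar \<psi> F_form) n = 0" using assms(1) by (simp add: Ann_def)
    then show ?thesis
      unfolding F_form_def apolar_two_monomials lookup_sum lookup_add lookup_single when_def .
  qed
  show "a \<in> J_mons"
  proof (rule ccontr)
    assume "a \<notin> J_mons"
    obtain a0 a1 a2 where a_def: "a = expo a0 a1 a2" by (rule expo_cases)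
    have k: "a0 + a1 + a2 = k" using deg[OF a] a_def by simp
    have "(a1 = 0 \<and> a2 = 0) \<or> (a0 = 0 \<and> a1 \<le> 5 \<and> a2 \<le> 6)"
      using \<open>a \<notin> J_mons\<close> k assms(3) by (auto simp: a_def expo_in_J_mons)
    then show False
    proof
      assume a12: "a1 = 0 \<and> a2 = 0"
      have "(\<Sum>b\<in>supp \<psi>. (if ?e - b = ?e - a then coef \<psi> b * deriv_coef b ?e else 0) +
        (if ?f - b = ?e - a then coef \<psi> b * deriv_coef b ?f else 0)) =
        (\<Sum>b\<in>supp \<psi>. if b = a then coef \<psi> a * deriv_coef a ?e else 0)"
      proof (rule sum.cong[OF refl])
        fix b assume b: "b \<in> supp \<psi>"
        obtain b0 b1 b2 where b_def: "b = expo b0 b1 b2" by (rule expo_cases)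
        have "b0 + b1 + b2 = k" using deg[OF b] b_def by simp
        then show "(if ?e - b = ?e - a then coef \<psi> b * deriv_coef b ?e else 0) +
          (if ?f - b = ?e - a then coef \<psi> b * deriv_coef b ?f else 0) =
          (if b = a then coef \<psi> a * deriv_coef a ?e else 0)"
          using a12 k assms(3)
          by (auto simp: a_def b_def deriv_coef_def falling_eq_0_iff)
      qed
      then have "coef \<psi> a * deriv_coef a ?e = 0" using zero[of "?e - a"] a by simp
      then show False using a a12 k assms(3)
        by (auto simp: in_keys_iff a_def deriv_coef_def falling_eq_0_iff)
    next
      assume a0: "a0 = 0 \<and> a1 \<le> 5 \<and> a2 \<le> 6"
      have "(\<Sum>b\<in>supp \<psi>. (if ?e - b = ?f - a then coef \<psi> b * deriv_coef b ?e else 0) +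
        (if ?f - b = ?f - a then coef \<psi> b * deriv_coef b ?f else 0)) =
        (\<Sum>b\<in>supp \<psi>. if b = a then coef \<psi> a * deriv_coef a ?f else 0)"
      proof (rule sum.cong[OF refl])
        fix b assume b: "b \<in> supp \<psi>"
        obtain b0 b1 b2 where b_def: "b = expo b0 b1 b2" by (rule expo_cases)
        have "b0 + b1 + b2 = k" using deg[OF b] b_def by simp
        then show "(if ?e - b = ?f - a then coef \<psi> b * deriv_coef b ?e else 0) +
          (if ?f - b = ?f - a then coef \<psi> b * deriv_coef b ?f else 0) =
          (if b = a then coef \<psi> a * deriv_coef a ?f else 0)"
          using a0 k assms(3)
          by (auto simp: a_def b_def deriv_coef_def falling_eq_0_iff)
      qed
      then have "coef \<psi> a * deriv_coef a ?f = 0" using zero[of "?f - a"] a by simp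
      then show False using a a0 k assms(3)
        by (auto simp: in_keys_iff a_def deriv_coef_def falling_eq_0_iff)
    qed
  qed
qed

section \<open>The ideal \<open>J\<close>\<close>

definition J_part :: "nat \<Rightarrow> poly3 set" where
  "J_part k = {f \<in> hom_part k. supp f \<subseteq> J_mons}"

definition J_ideal :: "poly3 set" where
  "J_ideal = ideal.span {Var 0 * Var 1, Var 0 * Var 2, Var 1 ^ 6}"

lemma graded_family_J_part: "graded_family J_part"
  unfolding graded_family_def
proof (intro allI conjI ballI)
  show "cvs.subspace (J_part k)" for k
    using subspace_hom_part[of k]
    unfolding cvs.subspace_def J_part_def
    by (auto simp: subset_iff in_keys_iff lookup_add) (metis add_0)
  show "J_part k \<subseteq> hom_part k" for k by (auto simp: J_part_def)
  show "Var i * f \<in> J_part (Suc k)" if f: "f \<in> J_part k" for f i k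
  proof -
    have "Var i * f \<in> hom_part (Suc k)"
      using f mult_in_hom_part[OF Var_in_hom_part, of f k i] by (simp add: J_part_def)
    moreover have "m \<in> J_mons" if "coef (Var i * f) m \<noteq> 0" for m
    proof -
      have "m - single i 1 \<in> J_mons"
        using that f by (auto simp: Var_def coef_single_times J_part_def subset_iff in_keys_iff
            split: if_splits)
      then show ?thesis
        by (auto simp: J_mons_def lookup_minus)
    qed
    ultimately show ?thesis by (auto simp: J_part_def in_keys_iff)
  qed
qed

text \<open>Every monomial of \<open>J_mons\<close> is a multiple of a generator, so membership in
  \<open>J\<close> depends on the support alone.\<close>

lemma J_ideal_eq: "J_ideal = ideal.span (\<Union>k. J_part k)"
proof (rule subset_antisym; unfold J_ideal_def; rule ideal.span_minimal)
  have "Var 0 * Var 1 \<in> J_part 2" "Var 0 * Var 2 \<in> J_part 2" "Var 1 ^ 6 \<in> J_part 6"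
    unfolding Var_power by (auto simp: Var_eq_expo mult_single J_part_def J_mons_def single_eq_expo)
  then show "{Var 0 * Var 1, Var 0 * Var 2, Var 1 ^ 6} \<subseteq> ideal.span (\<Union>k. J_part k)"
    by (auto intro!: ideal.span_base)
next
  let ?J = "ideal.span {Var 0 * Var 1, Var 0 * Var 2, Var 1 ^ 6} :: poly3 set"
  have gen: "single (expo 1 1 0) 1 \<in> ?J" "single (expo 1 0 1) 1 \<in> ?J" "single (expo 0 6 0) 1 \<in> ?J"
  proof -
    have "single (expo 1 1 0) 1 = (Var 0 * Var 1 :: poly3)"
      "single (expo 1 0 1) 1 = (Var 0 * Var 2 :: poly3)" "single (expo 0 6 0) 1 = (Var 1 ^ 6 :: poly3)"
      by (simp_all only: Var_power) (simp_all add: Var_eq_expo single_eq_expo mult_single)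
    then show "single (expo 1 1 0) 1 \<in> ?J" "single (expo 1 0 1) 1 \<in> ?J" "single (expo 0 6 0) 1 \<in> ?J"
      by (simp_all add: ideal.span_base)
  qed
  have mono: "single m c \<in> ?J" if mJ: "m \<in> J_mons" for m c
  proof -
    obtain a0 a1 a2 where m: "m = expo a0 a1 a2" by (rule expo_cases)
    have mult: "single (n' + n) c \<in> ?J" if "single n 1 \<in> ?J" for n n'
      using ideal.span_scale[OF that, of "single n' c"] by (simp add: mult_single)
    consider "a0 > 0" "a1 > 0" | "a0 > 0" "a2 > 0" | "a1 \<ge> 6"
      using mJ by (auto simp: m expo_in_J_mons)
    then show ?thesis
    proof cases
      case 1
      then show ?thesis using mult[OF gen(1), of "expo (a0 - 1) (a1 - 1) a2"] by (simp add: m)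
    next
      case 2
      then show ?thesis using mult[OF gen(2), of "expo (a0 - 1) a1 (a2 - 1)"] by (simp add: m)
    next
      case 3
      then show ?thesis using mult[OF gen(3), of "expo a0 (a1 - 6) a2"] by (simp add: m)
    qed
  qed
  show "(\<Union>k. J_part k) \<subseteq> ?J"
  proof
    fix f assume "f \<in> (\<Union>k. J_part k)"
    then have "supp f \<subseteq> J_mons" by (auto simp: J_part_def)
    then have "(\<Sum>m\<in>supp f. single m (coef f m)) \<in> ?J"
      by (intro ideal.span_sum mono) auto
    then show "f \<in> ?J" by (subst cpoly_eq_sum_single)
  qed
qed (rule ideal.subspace_span)+

lemma homogeneous_J_ideal: "homogeneous_ideal J_ideal"
  unfolding J_ideal_eq by (rule homogeneous_ideal_span[OF graded_family_J_part])

lemma J_ideal_part: "J_ideal \<inter> hom_part k = J_part k"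
  unfolding J_ideal_eq by (rule graded_family_Int[OF graded_family_J_part])

lemma J_ideal_supp: "f \<in> J_ideal \<Longrightarrow> supp f \<subseteq> J_mons"
proof
  fix m assume f: "f \<in> J_ideal" and m: "m \<in> supp f"
  have "hom_comp (mdegree m) f \<in> J_part (mdegree m)"
    using homogeneous_ideal_hom_comp[OF homogeneous_J_ideal f] J_ideal_part by blast
  moreover have "m \<in> supp (hom_comp (mdegree m) f)"
    using m by (simp add: in_keys_iff coef_hom_comp)
  ultimately show "m \<in> J_mons" by (auto simp: J_part_def)
qed

lemma J_ideal_subset_Ann: "J_ideal \<subseteq> Ann F_form"
  using J_mons_imp_Ann J_ideal_supp by blast

text \<open>The monomials of degree \<open>k\<close> outside \<open>J\<close>. From degree 5 on
  there are 7 of them, the length of the scheme.\<close>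

definition J_std :: "nat \<Rightarrow> (3 \<Rightarrow>\<^sub>0 nat) set" where
  "J_std k = insert (expo k 0 0) ((\<lambda>i. expo 0 i (k - i)) ` {..min 5 k})"

lemma J_std_subset: "J_std k \<subseteq> mons k"
  by (auto simp: J_std_def)

lemma finite_J_std [simp]: "finite (J_std k)"
  by (simp add: J_std_def)

lemma card_J_std: "k \<ge> 1 \<Longrightarrow> card (J_std k) = Suc (Suc (min 5 k))"
proof -
  assume k: "k \<ge> 1"
  have "inj_on (\<lambda>i. expo 0 i (k - i)) {..min 5 k}" by (auto simp: inj_on_def)
  moreover have "expo k 0 0 \<notin> (\<lambda>i. expo 0 i (k - i)) ` {..min 5 k}" using k by auto
  ultimately show ?thesis by (simp add: J_std_def card_image)
qed

lemma J_std_iff: "m \<in> mons k \<Longrightarrow> m \<in> J_std k \<longleftrightarrow> m \<notin> J_mons"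
  by (cases m rule: expo_cases) (auto simp: J_std_def expo_in_J_mons image_iff)

lemma J_part_eq: "J_part k = {f \<in> hom_part k. \<forall>m\<in>J_std k. coef f m = 0}"
proof -
  have "supp f \<subseteq> J_mons \<longleftrightarrow> (\<forall>m\<in>J_std k. coef f m = 0)" if "f \<in> hom_part k" for f
  proof -
    have "m \<in> mons k" if "coef f m \<noteq> 0" for m
      using \<open>f \<in> hom_part k\<close> that hom_part_coef_eq_0 by blast
    then show ?thesis
      using J_std_iff[of _ k] J_std_subset[of k] unfolding subset_iff in_keys_iff by blast
  qed
  then show ?thesis unfolding J_part_def by blast
qed

lemma dim_J_part: "k \<ge> 5 \<Longrightarrow> cvs.dim (J_part k) = card (mons k) - 7"
  by (simp add: J_part_eq dim_monomial_space[OF J_std_subset] card_J_std)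

section \<open>The fibre over \<open>Proj (S/J)\<close>\<close>

lemma card_mons_ge:
  assumes "k \<ge> 3"
  shows "card (mons k) \<ge> 10"
proof -
  have "(\<Sum>a\<le>3. Suc (3 - a)) \<le> (\<Sum>a\<le>3. Suc (k - a))"
    using assms by (intro sum_mono) auto
  also have "\<dots> \<le> (\<Sum>a\<le>k. Suc (k - a))"
    using assms by (intro sum_mono2) auto
  finally show ?thesis by (simp add: card_mons numeral_eq_Suc)
qed

lemma dim_hilb:
  assumes "I \<in> hilb (generic_hf 7)" "k \<ge> 3"
  shows "cvs.dim (I \<inter> hom_part k) = card (mons k) - 7"
proof -
  \<comment> \<open>The value 7 is positive, so the truncated difference in
    \<open>hilbert_function\<close> is the true one.\<close>
  have "card (mons k) - cvs.dim (I \<inter> hom_part k) = 7"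
    using assms card_mons_ge[of k]
    by (auto simp: hilb_def hilbert_function_def generic_hf_def dim_hom_part)
  then show ?thesis by simp
qed

lemma hilb_graded: "I \<in> hilb h \<Longrightarrow> graded_family (\<lambda>k. I \<inter> hom_part k)"
  by (simp add: hilb_def homogeneous_ideal_graded)

text \<open>The generators of \<open>J\<close> have degree at most 6, so a monomial of
  \<open>J\<close> of degree at least 7 is a generator times at least one variable.\<close>

lemma J_mons_pred:
  assumes "m \<in> J_mons" "mdegree m \<ge> 7"
  obtains i m' where "m' \<in> J_mons" "m = single i 1 + m'"
proof -
  obtain a b c where m: "m = expo a b c" by (rule expo_cases)
  have "(a > 0 \<and> expo (a - 1) b c \<in> J_mons) \<or> (b > 0 \<and> expo a (b - 1) c \<in> J_mons) \<or>
      (c > 0 \<and> expo a b (c - 1) \<in> J_mons)"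
    using assms by (auto simp: m expo_in_J_mons)
  then show thesis
    using that[of "expo (a - 1) b c" 0] that[of "expo a (b - 1) c" 1] that[of "expo a b (c - 1)" 2]
    by (auto simp: m single_eq_expo)
qed

text \<open>The inclusion changes direction: in degrees 5 and 6 apolarity puts \<open>I\<close> into
  \<open>J\<close>, while from degree 7 on the previous degree and the variables generate
  \<open>J\<close> inside \<open>I\<close>. Equality of dimensions closes both cases.\<close>

lemma Ann_part_eq_J_part:
  assumes I: "I \<in> hilb (generic_hf 7)" "I \<subseteq> Ann F_form" and "k \<ge> 5"
  shows "I \<inter> hom_part k = J_part k"
  using \<open>k \<ge> 5\<close>
proof (induction k rule: less_induct)
  case (less k)
  have sub: "cvs.subspace (I \<inter> hom_part k)" "cvs.subspace (J_part k)"
    using hilb_graded[OF I(1)] graded_family_J_part by (auto simp: graded_family_def)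
  have dim: "cvs.dim (I \<inter> hom_part k) = cvs.dim (J_part k)"
    using dim_hilb[OF I(1)] dim_J_part less.prems by simp
  show ?case
  proof (cases "k \<le> 6")
    case True
    then have "I \<inter> hom_part k \<subseteq> J_part k"
      using I(2) Ann_imp_J_mons[of _ k] by (auto simp: J_part_def)
    then show ?thesis
      using sub dim by (intro subspace_eq_if_dim_eq[where k = k]) (auto simp: J_part_def)
  next
    case False
    then obtain k' where k': "k = Suc k'" "k' \<ge> 6" by (cases k) auto
    have IH: "I \<inter> hom_part k' = J_part k'" using less k' by simp
    have "single m c \<in> I \<inter> hom_part k" if mJ: "m \<in> J_mons" and "mdegree m = k" for m c
    proof -
      have "mdegree m \<ge> 7" using that(2) False by simp
      then obtain i m' where m': "m' \<in> J_mons" "m = single i 1 + m'"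
        using J_mons_pred[OF mJ] by blast
      then have "mdegree m' = k'" using that(2) k' by (simp add: mdegree_add)
      then have "single m' c \<in> J_part k'" using m' by (simp add: J_part_def)
      then have "Var i * single m' c \<in> I \<inter> hom_part k"
        using IH hilb_graded[OF I(1)] k' unfolding graded_family_def by blast
      then show ?thesis using m' by (simp add: Var_def mult_single)
    qed
    then have "J_part k \<subseteq> I \<inter> hom_part k"
    proof -
      assume *: "\<And>m c. m \<in> J_mons \<Longrightarrow> mdegree m = k \<Longrightarrow> single m c \<in> I \<inter> hom_part k"
      show ?thesis
      proof
        fix f assume "f \<in> J_part k"
        then have "\<forall>m\<in>supp f. m \<in> J_mons \<and> mdegree m = k" by (auto simp: J_part_def hom_part_def)
        then have "(\<Sum>m\<in>supp f. single m (coef f m)) \<in> I \<inter> hom_part k"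
          using * by (intro cvs.subspace_sum sub) auto
        then show "f \<in> I \<inter> hom_part k" by (subst cpoly_eq_sum_single)
      qed
    qed
    then show ?thesis
      using sub dim by (intro subspace_eq_if_dim_eq[where k = k, symmetric]) auto
  qed
qed

section \<open>Dehomogenisation, and saturation of \<open>J\<close>\<close>

lemma dehomogenize_superset:
  assumes "finite A" "supp f \<subseteq> A"
  shows "dehomogenize i f = (\<Sum>m\<in>A. single (Poly_Mapping.update i 0 m) (coef f m))"
  unfolding dehomogenize_def using assms
  by (intro sum.mono_neutral_left) (auto simp: in_keys_iff)

lemma dehomogenize_add: "dehomogenize i (f + g) = dehomogenize i f + dehomogenize i g"
proof -
  let ?A = "supp f \<union> supp g"
  have "dehomogenize i (f + g) = (\<Sum>m\<in>?A. single (Poly_Mapping.update i 0 m) (coef (f + g) m))"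
    by (rule dehomogenize_superset) (auto dest: Poly_Mapping.keys_add[THEN subsetD])
  moreover have "dehomogenize i f = (\<Sum>m\<in>?A. single (Poly_Mapping.update i 0 m) (coef f m))"
    "dehomogenize i g = (\<Sum>m\<in>?A. single (Poly_Mapping.update i 0 m) (coef g m))"
    by (rule dehomogenize_superset; auto)+
  ultimately show ?thesis
    by (simp add: lookup_add single_add sum.distrib)
qed

lemma dehomogenize_sum: "dehomogenize i (sum f A) = (\<Sum>a\<in>A. dehomogenize i (f a))"
  by (induction A rule: infinite_finite_induct)
    (auto simp: dehomogenize_add, auto simp: dehomogenize_def)

lemma dehomogenize_single: "dehomogenize i (single m c) = single (Poly_Mapping.update i 0 m) c"
  by (subst dehomogenize_superset[of "{m}"]) auto

lemma dehomogenize_Var_power: "dehomogenize i (Var i ^ n * f) = dehomogenize i f"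
proof -
  have upd: "Poly_Mapping.update i 0 (single i n + m) = Poly_Mapping.update i 0 m" for m
    by (rule poly_mapping_eqI) (auto simp: lookup_update lookup_add lookup_single when_def)
  have "Var i ^ n * f = (\<Sum>m\<in>supp f. single (single i n + m) (coef f m))"
    by (subst cpoly_eq_sum_single[of f])
      (simp add: Var_power sum_distrib_left mult_single)
  then have "dehomogenize i (Var i ^ n * f) = (\<Sum>m\<in>supp f. single (Poly_Mapping.update i 0 m) (coef f m))"
    by (simp add: dehomogenize_sum dehomogenize_single upd)
  then show ?thesis by (simp add: dehomogenize_def)
qed

text \<open>Replacing \<open>f\<close> by \<open>Var i ^ n * f\<close> keeps its image in the chart
  and moves all components into degrees at least \<open>n\<close>, where the inclusion is
  assumed.\<close>

lemma proj_subscheme_mono: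
  assumes hom: "homogeneous_ideal I" "homogeneous_ideal J"
    and eq: "\<And>k. k \<ge> n \<Longrightarrow> I \<inter> hom_part k \<subseteq> J"
  shows "proj_subscheme I i \<subseteq> proj_subscheme J i"
proof
  fix h assume "h \<in> proj_subscheme I i"
  then obtain f where f: "f \<in> I" "h = dehomogenize i f" by (auto simp: proj_subscheme_def)
  let ?g = "Var i ^ n * f"
  have "?g \<in> I"
    using f hom(1) by (auto simp: homogeneous_ideal_def ideal.subspace_def)
  have "hom_comp k ?g \<in> J" if k: "k \<in> mdegree ` supp ?g" for k
  proof -
    obtain m where m: "k = mdegree m" "coef ?g m \<noteq> 0" using k by (auto simp: in_keys_iff)
    then have "n \<le> coef m i"
      by (auto simp: Var_power coef_single_times lookup_single when_def split: if_splits)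
    then have "m = single i n + (m - single i n)"
      by (intro poly_mapping_eqI) (auto simp: lookup_add lookup_minus lookup_single when_def)
    then have "n \<le> k" using m by (metis mdegree_add mdegree_single le_add1)
    then show ?thesis
      using eq homogeneous_ideal_hom_comp[OF hom(1) \<open>?g \<in> I\<close>] by blast
  qed
  then have "(\<Sum>k\<in>mdegree ` supp ?g. hom_comp k ?g) \<in> J"
    using hom(2) by (auto simp: homogeneous_ideal_def intro!: ideal.subspace_sum)
  then have "?g \<in> J" by (subst sum_hom_comp)
  then show "h \<in> proj_subscheme J i"
    unfolding proj_subscheme_def using f dehomogenize_Var_power by (metis imageI)
qed

text \<open>On forms of a fixed degree the passage to a chart is injective on monomials, so the
  coefficient at \<open>m\<close> survives there. No monomial of \<open>J\<close> lies over the same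
  chart monomial, so the coefficient is zero.\<close>

lemma dehomogenize_J_coef:
  assumes f: "f \<in> hom_part k" "dehomogenize i f \<in> dehomogenize i ` J_ideal" and m: "m \<in> mons k"
    and no: "\<And>n. Poly_Mapping.update i 0 n = Poly_Mapping.update i 0 m \<Longrightarrow> n \<notin> J_mons"
  shows "coef f m = 0"
proof -
  let ?m = "Poly_Mapping.update i 0 m"
  obtain g where g: "g \<in> J_ideal" "dehomogenize i f = dehomogenize i g" using f(2) by auto
  have c: "coef (dehomogenize i h) ?m =
      (\<Sum>n\<in>supp h. if Poly_Mapping.update i 0 n = ?m then coef h n else 0)" for h
    unfolding dehomogenize_def lookup_sum by (simp add: lookup_single when_def)
  have "coef (dehomogenize i g) ?m = 0"
    unfolding c using no J_ideal_supp[OF g(1)] by (intro sum.neutral) auto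
  moreover have "n = m" if "n \<in> supp f" "Poly_Mapping.update i 0 n = ?m" for n
  proof -
    have *: "coef n j = coef m j" if "j \<noteq> i" for j
      using that \<open>Poly_Mapping.update i 0 n = ?m\<close> lookup_update by metis
    have "mdegree n = (\<Sum>j\<in>UNIV. coef n j)" "mdegree m = (\<Sum>j\<in>UNIV. coef m j)"
      by (rule mdegree_superset; simp)+
    moreover have "mdegree n = mdegree m"
      using that f(1) m by (auto simp: hom_part_def mons_def)
    ultimately have "coef n i + (\<Sum>j\<in>UNIV - {i}. coef n j) = coef m i + (\<Sum>j\<in>UNIV - {i}. coef m j)"
      by (metis finite_class.finite_UNIV UNIV_I sum.remove)
    then have "coef n i = coef m i" using * by simp
    then show "n = m" using * by (intro poly_mapping_eqI) metis
  qed
  then have "coef (dehomogenize i f) ?m = (\<Sum>n\<in>supp f. if n = m then coef f m else 0)"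
    unfolding c by (intro sum.cong) auto
  then have "coef (dehomogenize i f) ?m = coef f m"
    by (auto simp: in_keys_iff)
  ultimately show ?thesis using g by simp
qed

text \<open>Saturation of \<open>J\<close>: no power of \<open>y0\<close> moves \<open>y0^k\<close>
  into \<open>J\<close>, and no power of \<open>y2\<close> moves \<open>y1^j y2^(k-j)\<close> with
  \<open>j <= 5\<close> into \<open>J\<close>. So each standard monomial is excluded on one of these
  two charts.\<close>

lemma subset_J_if_proj_eq:
  assumes I: "homogeneous_ideal I" and proj: "proj_subscheme I = proj_subscheme J_ideal"
  shows "I \<subseteq> J_ideal"
proof -
  have "f \<in> J_ideal" if f: "f \<in> I \<inter> hom_part k" for f k
  proof -
    have d: "dehomogenize i f \<in> dehomogenize i ` J_ideal" for i
      using f fun_cong[OF proj, of i] by (auto simp: proj_subscheme_def)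
    have upd: "Poly_Mapping.update 0 0 (expo a b c) = expo 0 b c"
      "Poly_Mapping.update 2 0 (expo a b c) = expo a b 0" for a b c
      by (rule poly_mapping_eqI, rule all3[THEN iffD2, rule_format], simp add: lookup_update)+
    have 0: "coef f (expo k 0 0) = 0"
    proof (rule dehomogenize_J_coef[OF _ d])
      show "n \<notin> J_mons" if "Poly_Mapping.update 0 0 n = Poly_Mapping.update 0 0 (expo k 0 0)" for n
        using that by (cases n rule: expo_cases) (simp add: upd expo_in_J_mons)
    qed (use f in auto)
    have 1: "coef f (expo 0 j (k - j)) = 0" if "j \<le> min 5 k" for j
    proof (rule dehomogenize_J_coef[OF _ d])
      show "n \<notin> J_mons" if "Poly_Mapping.update 2 0 n = Poly_Mapping.update 2 0 (expo 0 j (k - j))" for n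
        using that \<open>j \<le> min 5 k\<close> by (cases n rule: expo_cases) (simp add: upd expo_in_J_mons)
    qed (use f that in auto)
    have "f \<in> J_part k" using 0 1 f by (auto simp: J_part_eq J_std_def)
    then show ?thesis using J_ideal_part by blast
  qed
  then have "ideal.span (\<Union>k. I \<inter> hom_part k) \<subseteq> J_ideal"
    using homogeneous_J_ideal by (intro ideal.span_minimal) (auto simp: homogeneous_ideal_def)
  then show ?thesis using I by (simp add: homogeneous_ideal_def)
qed

lemma slip_subset_hilb: "slip r \<subseteq> hilb (generic_hf r)"
  unfolding slip_def using closure_of_subset_topspace topspace_hilb_topology by metis

text \<open>Apolar ideals agree with \<open>J\<close> from degree 5 on, hence define the same
  scheme. Conversely, saturation puts the ideal inside \<open>J\<close>, which is apolar.\<close>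

theorem border_vsp_eq_fibre: "border_vsp F_form 7 = {I \<in> slip 7. phi 7 I = proj_subscheme J_ideal}"
proof (intro set_eqI iffI)
  fix I assume "I \<in> border_vsp F_form 7"
  then have I: "I \<in> slip 7" "I \<in> hilb (generic_hf 7)" "I \<subseteq> Ann F_form"
    using slip_subset_hilb by (auto simp: border_vsp_def)
  have hom: "homogeneous_ideal I" using I by (simp add: hilb_def)
  have eq: "I \<inter> hom_part k = J_ideal \<inter> hom_part k" if "k \<ge> 5" for k
    using Ann_part_eq_J_part[OF I(2,3) that] by (simp add: J_ideal_part)
  have "proj_subscheme I i = proj_subscheme J_ideal i" for i
    using proj_subscheme_mono[OF hom homogeneous_J_ideal, of 5 i]
      proj_subscheme_mono[OF homogeneous_J_ideal hom, of 5 i] eq by blast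
  then show "I \<in> {I \<in> slip 7. phi 7 I = proj_subscheme J_ideal}"
    using I by (auto simp: phi_def)
next
  fix I assume "I \<in> {I \<in> slip 7. phi 7 I = proj_subscheme J_ideal}"
  then have I: "I \<in> slip 7" "proj_subscheme I = proj_subscheme J_ideal" by (auto simp: phi_def)
  then have "homogeneous_ideal I" using slip_subset_hilb by (auto simp: hilb_def)
  then have "I \<subseteq> J_ideal" using subset_J_if_proj_eq I by blast
  then show "I \<in> border_vsp F_form 7"
    using I J_ideal_subset_Ann by (auto simp: border_vsp_def)
qed

section \<open>Polynomial functions and determinants\<close>

lemma tendsto_peval:
  assumes "\<And>i. ((\<lambda>t. v t i) \<longlongrightarrow> u i) \<F>"
  shows "((\<lambda>t. peval (v t) p) \<longlongrightarrow> peval u p) \<F>"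
  unfolding peval_def by (intro tendsto_intros assms)

lemma peval_prod: "peval v (prod f A) = (\<Prod>a\<in>A. peval v (f a))"
  by (induction A rule: infinite_finite_induct) (auto simp: peval_mult)

lemma peval_of_int: "peval v (of_int k) = of_int k"
  using peval_single[of v 0 "of_int k"] by simp

lemma peval_Var [simp]: "peval v (Var i) = v i"
  by (simp add: Var_def peval_single)

lemma peval_det: "peval v (det A) = det (\<chi> i j. peval v (A $ i $ j))"
  by (simp add: det_def peval_sum peval_mult peval_prod peval_of_int)

text \<open>\<open>secant_variety\<close> admits only homogeneous equations, so a minor has to be
  recognised as a form.\<close>

lemma det_in_hom_part:
  fixes A :: "'v cpoly ^ 'n ^ 'n"
  assumes "\<And>i j. A $ i $ j \<in> hom_part 1"
  shows "det A \<in> hom_part CARD('n)"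
  unfolding det_def
proof (rule cvs.subspace_sum[OF subspace_hom_part])
  fix p :: "'n \<Rightarrow> 'n"
  have "(\<Prod>i\<in>UNIV. A $ i $ p i) \<in> hom_part CARD('n)"
    using assms by (intro prod_in_hom_part) auto
  then have "cscale (of_int (sign p)) (\<Prod>i\<in>UNIV. A $ i $ p i) \<in> hom_part CARD('n)"
    by (rule cvs.subspace_scale[OF subspace_hom_part])
  then show "of_int (sign p) * (\<Prod>i\<in>UNIV. A $ i $ p i) \<in> hom_part CARD('n)"
    by (simp add: cscale_def)
qed

section \<open>Powers of linear forms\<close>

definition fact_expo :: "(3 \<Rightarrow>\<^sub>0 nat) \<Rightarrow> complex" where
  "fact_expo m = fact (coef m 0) * fact (coef m 1) * fact (coef m 2)"

definition lin_eval :: "poly3 \<Rightarrow> (3 \<Rightarrow>\<^sub>0 nat) \<Rightarrow> complex" where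
  "lin_eval L m = coef L (expo 1 0 0) ^ coef m 0 * coef L (expo 0 1 0) ^ coef m 1 *
     coef L (expo 0 0 1) ^ coef m 2"

lemma fact_expo_nonzero [simp]: "fact_expo m \<noteq> 0"
  by (simp add: fact_expo_def)

lemma lin_eval_add: "lin_eval L (m + n) = lin_eval L m * lin_eval L n"
  by (simp add: lin_eval_def lookup_add power_add)

lemma linear_form_eq:
  fixes L :: poly3
  assumes "L \<in> hom_part 1"
  shows "L = single (expo 1 0 0) (coef L (expo 1 0 0)) + single (expo 0 1 0) (coef L (expo 0 1 0)) +
    single (expo 0 0 1) (coef L (expo 0 0 1))"
proof (rule poly_mapping_eqI)
  fix m :: "3 \<Rightarrow>\<^sub>0 nat"
  obtain a b c where m: "m = expo a b c" by (rule expo_cases)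
  have "(a = 1 \<and> b = 0 \<and> c = 0) \<or> (a = 0 \<and> b = 1 \<and> c = 0) \<or> (a = 0 \<and> b = 0 \<and> c = 1) \<or> a + b + c \<noteq> 1"
    by arith
  then show "coef L m = coef (single (expo 1 0 0) (coef L (expo 1 0 0)) +
      single (expo 0 1 0) (coef L (expo 0 1 0)) + single (expo 0 0 1) (coef L (expo 0 0 1))) m"
    using hom_part_coef_eq_0[OF assms, of m]
    by (auto simp: m lookup_add lookup_single when_def)
qed

text \<open>The multinomial theorem with denominators cleared. Scaled by \<open>fact_expo\<close>,
  the coefficients of a power are multiplicative in the exponent, which factors the catalecticant.
  The induction splits off one factor \<open>L\<close>; the three resulting terms have weights
  \<open>a\<close>, \<open>b\<close>, \<open>c\<close> with sum \<open>Suc n\<close>.\<close>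

lemma coef_linear_power:
  assumes L: "L \<in> hom_part 1"
  shows "fact_expo m * coef (L ^ n) m = (if mdegree m = n then fact n * lin_eval L m else 0)"
proof (induction n arbitrary: m)
  case 0
  show ?case
    by (cases m rule: expo_cases)
      (auto simp: fact_expo_def lin_eval_def lookup_one when_def simp flip: expo_zero)
next
  case (Suc n)
  obtain a b c where m: "m = expo a b c" by (rule expo_cases)
  let ?x = "coef L (expo 1 0 0)" and ?y = "coef L (expo 0 1 0)" and ?z = "coef L (expo 0 0 1)"
  let ?T = "if a + b + c = Suc n then fact n * lin_eval L m else 0"
  have split: "coef (L ^ Suc n) m = ?x * (if 1 \<le> a then coef (L ^ n) (expo (a - 1) b c) else 0) +
      ?y * (if 1 \<le> b then coef (L ^ n) (expo a (b - 1) c) else 0) +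
      ?z * (if 1 \<le> c then coef (L ^ n) (expo a b (c - 1)) else 0)"
    by (simp only: power_Suc, subst linear_form_eq[OF L],
        simp only: distrib_right lookup_add m coef_single_expo_times) simp
  have 0: "fact_expo m * (?x * (if 1 \<le> a then coef (L ^ n) (expo (a - 1) b c) else 0)) = of_nat a * ?T"
    using Suc[of "expo (a - 1) b c"]
    by (cases a) (auto simp: m fact_expo_def lin_eval_def algebra_simps)
  have 1: "fact_expo m * (?y * (if 1 \<le> b then coef (L ^ n) (expo a (b - 1) c) else 0)) = of_nat b * ?T"
    using Suc[of "expo a (b - 1) c"]
    by (cases b) (auto simp: m fact_expo_def lin_eval_def algebra_simps)
  have 2: "fact_expo m * (?z * (if 1 \<le> c then coef (L ^ n) (expo a b (c - 1)) else 0)) = of_nat c * ?T"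
    using Suc[of "expo a b (c - 1)"]
    by (cases c) (auto simp: m fact_expo_def lin_eval_def algebra_simps)
  have "fact_expo m * coef (L ^ Suc n) m = (of_nat a + of_nat b + of_nat c) * ?T"
    unfolding split distrib_left 0 1 2 by (simp only: distrib_right)
  also have "\<dots> = (if mdegree m = Suc n then fact (Suc n) * lin_eval L m else 0)"
  proof (cases "a + b + c = Suc n")
    case True
    then have "(of_nat a + of_nat b + of_nat c :: complex) = of_nat (Suc n)"
      by (simp only: of_nat_add[symmetric])
    then show ?thesis using True by (simp only: m mdegree_expo simp_thms if_True fact_Suc mult.assoc)
  qed (simp add: m)
  finally show ?case .
qed

section \<open>The border rank\<close>

text \<open>Row \<open>i\<close> here and column \<open>i\<close> of \<open>cat_col\<close> multiply
  to a monomial of \<open>F_form\<close>, and no other pair does; this makes the chosen minor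
  diagonal.\<close>

definition cat_row :: "nat \<Rightarrow> (3 \<Rightarrow>\<^sub>0 nat)" where
  "cat_row i = (case i of 0 \<Rightarrow> expo 5 0 0 | Suc a \<Rightarrow> expo 0 a (5 - a))"

definition cat_col :: "nat \<Rightarrow> (3 \<Rightarrow>\<^sub>0 nat)" where
  "cat_col j = (case j of 0 \<Rightarrow> expo 6 0 0 | Suc b \<Rightarrow> expo 0 (5 - b) (Suc b))"

lemma mdegree_cat: "i < 7 \<Longrightarrow> j < 7 \<Longrightarrow> mdegree (cat_row i + cat_col j) = 11"
  by (cases i; cases j; simp add: cat_row_def cat_col_def; linarith)

lemma coef_F_cat:
  "i < 7 \<Longrightarrow> j < 7 \<Longrightarrow> coef F_form (cat_row i + cat_col j) = (if i = j then 1 else 0)"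
proof -
  assume "i < 7" "j < 7"
  then have "(b \<le> 5 \<and> a + (5 - b) = 5 \<and> (5 - a) + Suc b = 6) = (a = b)" if "i = Suc a" "j = Suc b" for a b
    using that by linarith
  then show ?thesis
    using \<open>j < 7\<close>
    by (cases i; cases j) (auto simp: cat_row_def cat_col_def F_form_def lookup_add lookup_single when_def)
qed

text \<open>Up to the factors \<open>fact_expo\<close> the catalecticant matrix of a sum of \<open>r\<close> powers is a product through
  an \<open>r\<close>-dimensional space.\<close>

lemma not_in_secant_variety:
  assumes "r < 7"
  shows "F_form \<notin> secant_variety 11 r"
proof
  assume F: "F_form \<in> secant_variety 11 r"
  \<comment> \<open>Determinants are indexed by finite types, so the naturals below 7 are
    transported to the type \<open>7\<close>.\<close>
  obtain \<rho> :: "7 \<Rightarrow> nat" where \<rho>: "bij_betw \<rho> UNIV {..<7}"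
    using finite_same_card_bij[of "UNIV :: 7 set" "{..<7::nat}"] by auto
  have \<rho>_less: "\<rho> i < 7" for i using bij_betwE[OF \<rho>] by auto
  define e where "e i j = cat_row (\<rho> i) + cat_col (\<rho> j)" for i j
  define p where "p = det (\<chi> i j. cscale (fact_expo (e i j)) (Var (e i j)))"
  have "p \<in> hom_part CARD(7)"
    unfolding p_def
    by (rule det_in_hom_part)
      (simp only: vec_lambda_beta cvs.subspace_scale[OF subspace_hom_part Var_in_hom_part])
  then have p: "p \<in> hom_part 7" by simp
  have p_eval: "peval (coef G) p = det (\<chi> i j. fact_expo (e i j) * coef G (e i j))" for G :: poly3
    by (simp add: p_def peval_det)
  have "peval (coef H) p = 0" if Hspan: "H \<in> veronese_spans 11 r" for H
  proof -
    obtain c :: "nat \<Rightarrow> complex" and L :: "nat \<Rightarrow> poly3"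
      where L: "\<And>q. q < r \<Longrightarrow> L q \<in> hom_part 1" and H: "H = (\<Sum>q<r. cscale (c q) (L q ^ 11))"
      using Hspan unfolding veronese_spans_def by blast
    \<comment> \<open>The sum over \<open>r\<close> powers is padded to seven columns; since
      \<open>r < 7\<close>, the column with \<open>\<rho> k = 6\<close> is zero.\<close>
    define X where "X = (\<chi> i k :: 7. if \<rho> k < r then c (\<rho> k) * fact 11 * lin_eval (L (\<rho> k)) (cat_row (\<rho> i)) else 0)"
    define Y where "Y = (\<chi> k j :: 7. lin_eval (L (\<rho> k)) (cat_col (\<rho> j)))"
    have "(\<chi> i j. fact_expo (e i j) * coef H (e i j)) = X ** Y"
    proof (simp only: vec_eq_iff, intro allI)
      fix i j :: 7
      have deg: "mdegree (e i j) = 11" by (simp add: e_def mdegree_cat \<rho>_less)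
      have "fact_expo (e i j) * coef H (e i j) =
          (\<Sum>q<r. c q * (fact_expo (e i j) * coef (L q ^ 11) (e i j)))"
        by (simp add: H lookup_sum sum_distrib_left mult_ac)
      also have "\<dots> = (\<Sum>q<r. c q * fact 11 * lin_eval (L q) (cat_row (\<rho> i)) * lin_eval (L q) (cat_col (\<rho> j)))"
        using L deg by (intro sum.cong) (auto simp: coef_linear_power, simp add: e_def lin_eval_add)
      also have "\<dots> = (\<Sum>q<7. if q < r then c q * fact 11 * lin_eval (L q) (cat_row (\<rho> i)) * lin_eval (L q) (cat_col (\<rho> j)) else 0)"
        using assms by (intro sum.mono_neutral_cong_left) auto
      also have "\<dots> = (\<Sum>k\<in>UNIV. if \<rho> k < r then c (\<rho> k) * fact 11 * lin_eval (L (\<rho> k)) (cat_row (\<rho> i)) * lin_eval (L (\<rho> k)) (cat_col (\<rho> j)) else 0)"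
        by (rule sum.reindex_bij_betw[OF \<rho>, symmetric])
      also have "\<dots> = (X ** Y) $ i $ j"
        by (simp add: matrix_matrix_mult_def X_def Y_def if_distrib[of "\<lambda>x. x * _"] cong: if_cong)
      finally show "(\<chi> i j. fact_expo (e i j) * coef H (e i j)) $ i $ j = (X ** Y) $ i $ j" by simp
    qed
    moreover have "det X = 0"
    proof -
      have "6 \<in> \<rho> ` UNIV" using \<rho> by (simp add: bij_betw_def)
      then obtain k0 where k0: "\<rho> k0 = 6" by auto
      have "column k0 X = 0"
        using assms by (simp add: column_def X_def vec_eq_iff k0)
      then show ?thesis by (rule det_zero_column)
    qed
    ultimately show ?thesis by (simp add: p_eval det_mul)
  qed
  then have "peval (coef F_form) p = 0"
    using F p unfolding secant_variety_def by blast
  moreover have "peval (coef F_form) p = (\<Prod>i\<in>UNIV. fact_expo (e i i))"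
  proof -
    have *: "coef F_form (e i j) = (if i = j then 1 else 0)" for i j
      using \<rho> by (simp add: e_def coef_F_cat \<rho>_less) (metis UNIV_I bij_betw_def inj_on_def)
    show ?thesis
      unfolding p_eval by (subst det_diagonal) (auto simp: *)
  qed
  ultimately show False by simp
qed

section \<open>Upper bound for the border rank by sixth roots of unity\<close>

lemma sum_sixth_roots:
  "(\<Sum>j<6. cis (pi / 3) ^ (j * n)) = (if 6 dvd n then 6 else 0 :: complex)"
proof -
  let ?\<omega> = "cis (pi / 3) ^ n"
  have six: "cis (pi / 3) ^ 6 = 1" by (simp add: Complex.DeMoivre)
  have "(\<Sum>j<6. cis (pi / 3) ^ (j * n)) = (\<Sum>j<6. ?\<omega> ^ j)"
    by (simp only: mult.commute[of _ n] power_mult)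
  also have "\<dots> = (if 6 dvd n then 6 else 0)"
  proof (cases "6 dvd n")
    case True
    then have "?\<omega> = 1" using six by (auto simp: power_mult)
    then show ?thesis using True by simp
  next
    case False
    have "?\<omega> \<noteq> 1"
    proof
      assume w: "?\<omega> = 1"
      have "cis (pi / 3) ^ n = cis (pi / 3) ^ (6 * (n div 6) + n mod 6)" by simp
      also have "\<dots> = cis (pi / 3) ^ (n mod 6)"
        by (simp only: power_add power_mult six power_one mult_1)
      \<comment> \<open>In this form the injective listing of the sixth roots of unity applies and
        forces \<open>n mod 6 = 0\<close>.\<close>
      also have "\<dots> = cis (2 * pi * real (n mod 6) / real 6)"
        by (simp add: Complex.DeMoivre mult_ac)
      finally have "cis (2 * pi * real (n mod 6) / real 6) = cis (2 * pi * real 0 / real 6)"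
        using w by simp
      then have "n mod 6 = 0"
        using Complex.bij_betw_roots_unity[of 6] by (auto simp: bij_betw_def inj_on_def)
      then show False using False by auto
    qed
    moreover have "?\<omega> ^ 6 = 1"
      by (simp only: power_mult[symmetric] mult.commute[of n]) (simp only: power_mult six power_one)
    ultimately show ?thesis using False by (simp add: sum_gp_strict)
  qed
  finally show ?thesis .
qed

text \<open>Weighting by \<open>?z ^ j\<close> makes the sum over \<open>j\<close> keep only the
  exponents \<open>b\<close> of \<open>x1\<close> with \<open>6 dvd Suc b\<close>, namely 5 and 11.
  As 11 choose 5 is 462, the constant \<open>2772 = 6 * 462\<close> normalises the term
  \<open>b = 5\<close>, and the term \<open>b = 11\<close> is left with
  \<open>t ^ 6 / 462\<close>.\<close>

lemma perturbed_in_veronese_spans: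
  assumes t: "t \<noteq> 0"
  shows "F_form + single (expo 0 11 0) (t ^ 6 / 462) \<in> veronese_spans 11 7"
proof -
  let ?z = "cis (pi / 3)"
  define L :: "nat \<Rightarrow> poly3" where "L q = (case q of 0 \<Rightarrow> single (expo 1 0 0) 1
     | Suc j \<Rightarrow> single (expo 0 1 0) (t * ?z ^ j) + single (expo 0 0 1) 1)" for q
  define c where "c q = (case q of 0 \<Rightarrow> 1 | Suc j \<Rightarrow> ?z ^ j / (2772 * t ^ 5))" for q
  have L1: "L q \<in> hom_part 1" for q
    by (auto simp: L_def split: nat.split intro!: cvs.subspace_add[OF subspace_hom_part])
  have "L q \<noteq> 0" for q
  proof
    assume "L q = 0"
    then have "coef (L q) (expo 1 0 0) = 0 \<and> coef (L q) (expo 0 0 1) = 0" by simp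
    then show False by (auto simp: L_def lookup_add lookup_single when_def split: nat.splits)
  qed
  moreover have "F_form + single (expo 0 11 0) (t ^ 6 / 462) = (\<Sum>q<7. cscale (c q) (L q ^ 11))"
  proof (rule poly_mapping_eqI)
    fix m :: "3 \<Rightarrow>\<^sub>0 nat"
    obtain a b d where m: "m = expo a b d" by (rule expo_cases)
    have "fact_expo m * coef (\<Sum>q<7. cscale (c q) (L q ^ 11)) m =
        (\<Sum>q<Suc 6. c q * (fact_expo m * coef (L q ^ 11) m))"
      by (simp add: lookup_sum sum_distrib_left mult_ac)
    also have "\<dots> = (\<Sum>q<Suc 6. c q * (if a + b + d = 11 then fact 11 * lin_eval (L q) m else 0))"
      using L1 by (simp only: coef_linear_power) (simp add: m)
    also have "\<dots> = c 0 * (if a + b + d = 11 then fact 11 * lin_eval (L 0) m else 0) +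
        (\<Sum>j<6. c (Suc j) * (if a + b + d = 11 then fact 11 * lin_eval (L (Suc j)) m else 0))"
      by (rule sum.lessThan_Suc_shift)
    also have "c 0 * (if a + b + d = 11 then fact 11 * lin_eval (L 0) m else 0) =
        (if a = 11 \<and> b = 0 \<and> d = 0 then fact 11 else 0)"
      by (auto simp: c_def L_def lin_eval_def m lookup_single when_def)
    also have "(\<Sum>j<6. c (Suc j) * (if a + b + d = 11 then fact 11 * lin_eval (L (Suc j)) m else 0)) =
        (if a = 0 \<and> b + d = 11 then fact 11 * t ^ b / (2772 * t ^ 5) * (\<Sum>j<6. ?z ^ (j * Suc b)) else 0)"
    proof (cases "a = 0 \<and> b + d = 11")
      case True
      have "c (Suc j) * (fact 11 * lin_eval (L (Suc j)) m) =
          fact 11 * t ^ b / (2772 * t ^ 5) * ?z ^ (j * Suc b)" for j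
        using True
        by (simp add: c_def L_def lin_eval_def m lookup_single lookup_add when_def
            power_mult_distrib power_add power_mult[symmetric])
      then show ?thesis using True by (simp add: sum_distrib_left)
    next
      case False
      then have "(if a + b + d = 11 then fact 11 * lin_eval (L (Suc j)) m else 0) = 0" for j
        by (auto simp: L_def lin_eval_def m lookup_single lookup_add when_def)
      then show ?thesis
        using False by (simp only: mult_zero_right sum.neutral_const if_False)
    qed
    also have "(if a = 11 \<and> b = 0 \<and> d = 0 then fact 11 else 0) + \<dots> =
        fact_expo m * coef (F_form + single (expo 0 11 0) (t ^ 6 / 462)) m"
    proof -
      have "b = 5 \<or> b = 11" if "b \<le> 11" "6 dvd Suc b"
        using that by presburger
      moreover have "x * t ^ 11 / t ^ 5 = x * t ^ 6" for x
        using t by (simp add: divide_simps flip: power_add)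
      ultimately show ?thesis
        using t unfolding sum_sixth_roots
        by (auto simp: m fact_expo_def F_form_def lookup_add lookup_single when_def fact_numeral)
    qed
    finally show "coef (F_form + single (expo 0 11 0) (t ^ 6 / 462)) m =
        coef (\<Sum>q<7. cscale (c q) (L q ^ 11)) m"
      by simp
  qed
  ultimately show ?thesis
    using L1 unfolding veronese_spans_def by blast
qed

text \<open>An equation that vanishes on the perturbed forms for \<open>t \<noteq> 0\<close>
  vanishes at \<open>t = 0\<close> by continuity.\<close>

lemma in_secant_variety: "F_form \<in> secant_variety 11 7"
proof -
  have "F_form \<in> hom_part 11"
    unfolding F_form_def by (intro cvs.subspace_add[OF subspace_hom_part]) auto
  moreover have "coef F_form (expo 11 0 0) \<noteq> 0"
    by (simp add: F_form_def lookup_add lookup_single when_def)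
  then have "F_form \<noteq> 0" by auto
  moreover have "peval (coef F_form) p = 0" if p: "\<forall>H\<in>veronese_spans 11 7. peval (coef H) p = 0" for p
  proof -
    define H where "H t = F_form + single (expo 0 11 0) (t ^ 6 / 462)" for t
    have "((\<lambda>t. peval (coef (H t)) p) \<longlongrightarrow> peval (coef (H 0)) p) (at 0)"
      unfolding H_def lookup_add lookup_single when_def
      by (intro tendsto_peval) (auto intro!: tendsto_eq_intros)
    moreover have "eventually (\<lambda>t. peval (coef (H t)) p = 0) (at 0)"
      using p perturbed_in_veronese_spans by (auto simp: H_def eventually_at_filter)
    ultimately have "((\<lambda>t. 0) \<longlongrightarrow> peval (coef (H 0)) p) (at (0 :: complex))"
      by (rule Lim_transform_eventually)
    then show ?thesis
      using LIM_const_eq[of 0] by (simp add: H_def)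
  qed
  ultimately show ?thesis by (auto simp: secant_variety_def)
qed

theorem border_rank_F: "border_rank 11 F_form = 7"
  unfolding border_rank_def
  using in_secant_variety not_in_secant_variety by (intro Least_equality) (auto simp: not_less[symmetric])

section \<open>Minors of frames\<close>

type_synonym frame = "nat \<Rightarrow> nat \<Rightarrow> poly3"

definition poly_fun :: "(frame \<Rightarrow> complex) \<Rightarrow> bool" where
  "poly_fun \<phi> \<longleftrightarrow> (\<exists>p. \<forall>b. peval (frame_coords b) p = \<phi> b)"

lemma poly_fun_add: "poly_fun \<phi> \<Longrightarrow> poly_fun \<psi> \<Longrightarrow> poly_fun (\<lambda>b. \<phi> b + \<psi> b)"
  unfolding poly_fun_def by (metis peval_add)

lemma poly_fun_diff: "poly_fun \<phi> \<Longrightarrow> poly_fun \<psi> \<Longrightarrow> poly_fun (\<lambda>b. \<phi> b - \<psi> b)"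
  unfolding poly_fun_def by (metis peval_diff)

lemma poly_fun_mult: "poly_fun \<phi> \<Longrightarrow> poly_fun \<psi> \<Longrightarrow> poly_fun (\<lambda>b. \<phi> b * \<psi> b)"
  unfolding poly_fun_def by (metis peval_mult)

definition minor :: "('n::finite \<Rightarrow> nat) \<Rightarrow> nat \<Rightarrow> ('n \<Rightarrow> (3 \<Rightarrow>\<^sub>0 nat)) \<Rightarrow> frame \<Rightarrow> complex" where
  "minor r k c b = det (\<chi> i j. coef (b k (r i)) (c j))"

lemma peval_minor:
  "peval (frame_coords b) (det (\<chi> i j. Var (k, r i, c j))) = minor r k c b"
  unfolding minor_def
  by (subst peval_det, rule arg_cong[of _ _ det]) (simp add: vec_eq_iff frame_coords_def)

lemma poly_fun_minor: "poly_fun (minor r k c)"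
  unfolding poly_fun_def using peval_minor by blast

lemma is_frameD:
  assumes "is_frame I b" "cvs.dim (I \<inter> hom_part k) = n"
  shows "inj_on (b k) {..<n}" "cvs.span (b k ` {..<n}) = I \<inter> hom_part k"
  using assms unfolding is_frame_def Let_def by auto

lemma frame_in: "is_frame I b \<Longrightarrow> cvs.dim (I \<inter> hom_part k) = n \<Longrightarrow> j < n \<Longrightarrow> b k j \<in> I \<inter> hom_part k"
  by (subst is_frameD(2)[symmetric]) (auto intro: cvs.span_base)

lemma frame_expansion:
  assumes "is_frame I b" "cvs.dim (I \<inter> hom_part k) = CARD('n)"
    and r: "bij_betw r (UNIV :: 'n::finite set) {..<CARD('n)}" and f: "f \<in> I \<inter> hom_part k"
  obtains u where "f = (\<Sum>l\<in>UNIV. cscale (u l) (b k (r l)))"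
proof -
  have "f \<in> cvs.span (b k ` {..<CARD('n)})" using is_frameD(2)[OF assms(1,2)] f by simp
  then obtain u where u: "f = (\<Sum>v\<in>b k ` {..<CARD('n)}. cscale (u v) v)"
    by (auto simp: cvs.span_finite)
  also have "\<dots> = (\<Sum>q<CARD('n). cscale (u (b k q)) (b k q))"
    using is_frameD(1)[OF assms(1,2)] by (simp add: sum.reindex)
  also have "\<dots> = (\<Sum>l\<in>UNIV. cscale (u (b k (r l))) (b k (r l)))"
    by (rule sum.reindex_bij_betw[OF r, symmetric])
  finally show thesis by (rule that)
qed

text \<open>Two frames differ by a matrix, whose determinant \<open>s\<close> scales all maximal
  minors of this degree at once. So a form in these minors vanishes on every frame once it vanishes
  on one.\<close>

lemma minor_frame_change:
  assumes b: "is_frame I b" and b': "is_frame I b'"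
    and dim: "cvs.dim (I \<inter> hom_part k) = CARD('n)"
    and r: "bij_betw r (UNIV :: 'n::finite set) {..<CARD('n)}"
  obtains s where "\<And>c. minor r k c b' = s * minor r k c b"
proof -
  have "\<exists>u. b' k (r i) = (\<Sum>l\<in>UNIV. cscale (u l) (b k (r l)))" for i
  proof -
    have "r i < CARD('n)" using bij_betwE[OF r] by auto
    then show ?thesis using frame_expansion[OF b dim r frame_in[OF b' dim]] by metis
  qed
  then obtain M where M: "b' k (r i) = (\<Sum>l\<in>UNIV. cscale (M i l) (b k (r l)))" for i
    by metis
  have "minor r k c b' = det (\<chi> i j. M i j) * minor r k c b" for c
  proof -
    have "(\<chi> i j. coef (b' k (r i)) (c j)) = (\<chi> i j. M i j) ** (\<chi> i j. coef (b k (r i)) (c j))"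
      unfolding vec_eq_iff by (simp add: M matrix_matrix_mult_def lookup_sum)
    then show ?thesis unfolding minor_def by (simp only: det_mul)
  qed
  then show thesis by (rule that)
qed

text \<open>\<open>hilb_closed\<close> reads membership from each single frame, hence the assumption
  that vanishing does not depend on the frame.\<close>

lemma hilb_closed_poly_fun:
  assumes "poly_fun \<phi>"
    and "\<And>I b b'. I \<in> hilb h \<Longrightarrow> is_frame I b \<Longrightarrow> is_frame I b' \<Longrightarrow> \<phi> b = 0 \<Longrightarrow> \<phi> b' = 0"
  shows "hilb_closed h {I \<in> hilb h. \<forall>b. is_frame I b \<longrightarrow> \<phi> b = 0}"
proof -
  obtain p where p: "\<And>b. peval (frame_coords b) p = \<phi> b"
    using assms(1) unfolding poly_fun_def by blast
  let ?Z = "{I \<in> hilb h. \<forall>b. is_frame I b \<longrightarrow> \<phi> b = 0}"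
  have "I \<in> ?Z \<longleftrightarrow> (\<forall>q\<in>{p}. peval (frame_coords b) q = 0)" if "I \<in> hilb h" "is_frame I b" for I b
    using that assms(2)[OF that] by (simp only: p mem_Collect_eq ball_simps) blast
  then show ?thesis
    unfolding hilb_closed_def by (intro conjI exI[of _ "{p}"] ballI allI impI) blast+
qed

section \<open>Two closed sets covering the fibre\<close>

definition row3 :: "3 \<Rightarrow> nat" where
  "row3 i = (if i = 0 then 0 else if i = 1 then 1 else 2)"

definition minor3 :: "(3 \<Rightarrow>\<^sub>0 nat) \<Rightarrow> (3 \<Rightarrow>\<^sub>0 nat) \<Rightarrow> (3 \<Rightarrow>\<^sub>0 nat) \<Rightarrow> frame \<Rightarrow> complex" where
  "minor3 u v w = minor row3 3 (\<lambda>j. if j = 0 then u else if j = 1 then v else w)"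

lemma minor3_eq:
  "minor3 u v w b = coef (b 3 0) u * (coef (b 3 1) v * coef (b 3 2) w - coef (b 3 1) w * coef (b 3 2) v)
    - coef (b 3 0) v * (coef (b 3 1) u * coef (b 3 2) w - coef (b 3 1) w * coef (b 3 2) u)
    + coef (b 3 0) w * (coef (b 3 1) u * coef (b 3 2) v - coef (b 3 1) v * coef (b 3 2) u)"
proof -
  \<comment> \<open>\<open>det_3\<close> uses the indices 1, 2, 3, and 3 is 0 in the type
    \<open>3\<close>.\<close>
  have "(3 :: 3) = 0" by simp
  then show ?thesis
    by (simp add: minor3_def minor_def det_3 row3_def algebra_simps)
qed

lemma bij_row3: "bij_betw row3 UNIV {..<CARD(3)}"
proof -
  have "row3 ` {0, 1, 2} = {0, 1, 2}" by (auto simp: row3_def)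
  moreover have "{..<CARD(3)} = {0, 1, 2}" by auto
  moreover have "inj row3" by (auto simp: inj_def row3_def all3)
  ultimately show ?thesis unfolding bij_betw_def UNIV3 by simp
qed

text \<open>In degree 3 the fibre consists of nets of quadrics through \<open>[1:0:0]\<close>, multiplied by \<open>y\<^sub>0\<close>.
  This form vanishes on the nets \<open>\<langle>\<eta>y\<^sub>1, \<eta>y\<^sub>2, q\<rangle>\<close> with \<open>\<eta>\<close> linear and \<open>q\<close> binary, i.e. on the nets
  of quadrics through three points.\<close>

definition net_form :: "frame \<Rightarrow> complex" where
  "net_form b = minor3 (expo 2 0 1) (expo 2 1 0) (expo 1 0 2) b *
      (minor3 (expo 2 1 0) (expo 1 0 2) (expo 1 1 1) b + minor3 (expo 2 0 1) (expo 1 0 2) (expo 1 2 0) b)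
    - minor3 (expo 2 0 1) (expo 1 0 2) (expo 1 1 1) b * minor3 (expo 2 0 1) (expo 2 1 0) (expo 1 1 1) b"

definition row8 :: "8 \<Rightarrow> nat" where
  "row8 = (SOME r. bij_betw r UNIV {..<8})"

lemma bij_row8: "bij_betw row8 UNIV {..<CARD(8)}"
proof -
  have "\<exists>r :: 8 \<Rightarrow> nat. bij_betw r UNIV {..<8}"
    using finite_same_card_bij[of "UNIV :: 8 set" "{..<8::nat}"] by auto
  then have "bij_betw row8 UNIV {..<8}" unfolding row8_def by (rule someI_ex)
  then show ?thesis by simp
qed

lemma row8_less: "row8 i < 8"
  using bij_betwE[OF bij_row8] by auto

text \<open>Multiplied by \<open>y0\<close>, the cubic monomials through [1:0:0] are these eight and
  \<open>y0 y1^3\<close>, which serves as the dependent coordinate.\<close>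

definition cubics :: "(3 \<Rightarrow>\<^sub>0 nat) list" where
  "cubics = [expo 3 1 0, expo 3 0 1, expo 2 2 0, expo 2 1 1, expo 2 0 2, expo 1 2 1, expo 1 1 2, expo 1 0 3]"

definition col8 :: "8 \<Rightarrow> (3 \<Rightarrow>\<^sub>0 nat)" where
  "col8 j = cubics ! row8 j"

definition minor8 :: "frame \<Rightarrow> complex" where
  "minor8 = minor row8 4 col8"

text \<open>The numerator in Cramer's rule: the column of \<open>e\<close> is replaced by that of
  \<open>y0 y1^3\<close>.\<close>

definition minor8_upd :: "(3 \<Rightarrow>\<^sub>0 nat) \<Rightarrow> frame \<Rightarrow> complex" where
  "minor8_upd e = minor row8 4 (\<lambda>j. if col8 j = e then expo 1 3 0 else col8 j)"

text \<open>In degree 4 the fibre consists of hyperplanes in \<open>y\<^sub>0 \<cdot> (y\<^sub>1, y\<^sub>2)\<^sub>3\<close>, i.e. of kernels of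
  functionals on \<open>(y\<^sub>1, y\<^sub>2)\<^sub>3\<close>, whose coordinates are the 8-minors.  Up to sign the second factor is the minor
  \<open>G(y\<^sub>1\<^sup>3) G(y\<^sub>2\<^sup>3) - G(y\<^sub>1\<^sup>2y\<^sub>2) G(y\<^sub>1y\<^sub>2\<^sup>2)\<close> of the catalecticant of such a functional \<open>G\<close>, so it
  vanishes when \<open>G\<close> is a cube.\<close>

definition cube_form :: "frame \<Rightarrow> complex" where
  "cube_form b = minor8 b * (minor8 b * minor8_upd (expo 1 0 3) b
     + minor8_upd (expo 1 2 1) b * minor8_upd (expo 1 1 2) b)"

lemma dim_hilb_3: "I \<in> hilb (generic_hf 7) \<Longrightarrow> cvs.dim (I \<inter> hom_part 3) = CARD(3)"
  by (subst dim_hilb) (auto simp: card_mons numeral_eq_Suc)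

lemma dim_hilb_4: "I \<in> hilb (generic_hf 7) \<Longrightarrow> cvs.dim (I \<inter> hom_part 4) = CARD(8)"
  by (subst dim_hilb) (auto simp: card_mons numeral_eq_Suc)

definition net_locus :: "poly3 set set" where
  "net_locus = {I \<in> hilb (generic_hf 7). \<forall>b. is_frame I b \<longrightarrow> net_form b = 0}"

definition cube_locus :: "poly3 set set" where
  "cube_locus = {I \<in> hilb (generic_hf 7). \<forall>b. is_frame I b \<longrightarrow> cube_form b = 0}"

lemma net_locus_frame_indep:
  assumes "I \<in> hilb (generic_hf 7)" "is_frame I b" "is_frame I b'" "net_form b = 0"
  shows "net_form b' = 0"
proof -
  obtain s where "\<And>c. minor row3 3 c b' = s * minor row3 3 c b"
    using minor_frame_change[OF assms(2,3) dim_hilb_3[OF assms(1)] bij_row3] by blast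
  then have "net_form b' = s ^ 2 * net_form b"
    by (simp add: net_form_def minor3_def power2_eq_square algebra_simps)
  then show ?thesis using assms(4) by simp
qed

lemma cube_locus_frame_indep:
  assumes "I \<in> hilb (generic_hf 7)" "is_frame I b" "is_frame I b'" "cube_form b = 0"
  shows "cube_form b' = 0"
proof -
  obtain s where "\<And>c. minor row8 4 c b' = s * minor row8 4 c b"
    using minor_frame_change[OF assms(2,3) dim_hilb_4[OF assms(1)] bij_row8] by blast
  then have "cube_form b' = s ^ 3 * cube_form b"
    by (simp add: cube_form_def minor8_def minor8_upd_def power3_eq_cube algebra_simps)
  then show ?thesis using assms(4) by simp
qed

lemma hilb_closed_net_locus: "hilb_closed (generic_hf 7) net_locus"
  unfolding net_locus_def
proof (rule hilb_closed_poly_fun)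
  show "poly_fun net_form"
    unfolding net_form_def minor3_def
    by (intro poly_fun_diff poly_fun_add poly_fun_mult poly_fun_minor)
qed (rule net_locus_frame_indep)

lemma hilb_closed_cube_locus: "hilb_closed (generic_hf 7) cube_locus"
  unfolding cube_locus_def
proof (rule hilb_closed_poly_fun)
  show "poly_fun cube_form"
    unfolding cube_form_def minor8_def minor8_upd_def
    by (intro poly_fun_add poly_fun_mult poly_fun_minor)
qed (rule cube_locus_frame_indep)

section \<open>The functional in degree 4 and the nets compatible with it\<close>

lemma distinct_cubics: "distinct cubics"
  by (simp add: cubics_def)

lemma length_cubics: "length cubics = 8"
  by (simp add: cubics_def)

lemma inj_col8: "col8 i = col8 j \<longleftrightarrow> i = j"
proof
  assume "col8 i = col8 j"
  then have "row8 i = row8 j"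
    using distinct_cubics row8_less unfolding col8_def
    by (subst (asm) nth_eq_iff_index_eq) (auto simp: length_cubics)
  then show "i = j" using bij_row8 by (auto simp: bij_betw_def inj_def)
qed simp

text \<open>Cramer's rule writes the column of \<open>y0 y1^3\<close> through the other columns. The
  relation holds on the frame, hence on its span. It describes the hyperplane as the kernel of a
  functional normalised to -1 at \<open>y0 y1^3\<close>.\<close>

lemma functional_of_frame:
  assumes I: "I \<in> hilb (generic_hf 7)" "is_frame I b" and nz: "minor8 b \<noteq> 0"
    and f: "f \<in> I \<inter> hom_part 4"
  shows "coef f (expo 1 3 0) = (\<Sum>e\<leftarrow>cubics. minor8_upd e b / minor8 b * coef f e)"
proof -
  let ?G = "\<lambda>e. minor8_upd e b / minor8 b"
  let ?A = "\<chi> i j. coef (b 4 (row8 i)) (col8 j)" and ?y = "\<chi> k. ?G (col8 k)"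
  have "(\<chi> i j. if j = k then (\<chi> i. coef (b 4 (row8 i)) (expo 1 3 0)) $ i else ?A $ i $ j) =
      (\<chi> i j. coef (b 4 (row8 i)) (if col8 j = col8 k then expo 1 3 0 else col8 j))" for k
    by (simp add: vec_eq_iff inj_col8)
  then have "?A *v ?y = (\<chi> i. coef (b 4 (row8 i)) (expo 1 3 0))"
    using nz by (subst cramer) (simp_all add: minor8_def minor8_upd_def minor_def)
  then have basis: "(\<Sum>k\<in>UNIV. ?G (col8 k) * coef (b 4 (row8 i)) (col8 k)) = coef (b 4 (row8 i)) (expo 1 3 0)" for i
    by (simp add: matrix_vector_mult_def vec_eq_iff mult.commute)
  obtain u where u: "f = (\<Sum>l\<in>UNIV. cscale (u l) (b 4 (row8 l)))"
    using frame_expansion[OF I(2) dim_hilb_4[OF I(1)] bij_row8 f] .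
  have "coef f (expo 1 3 0) = (\<Sum>l\<in>UNIV. u l * (\<Sum>k\<in>UNIV. ?G (col8 k) * coef (b 4 (row8 l)) (col8 k)))"
    unfolding basis by (simp add: u lookup_sum)
  also have "\<dots> = (\<Sum>l\<in>UNIV. \<Sum>k\<in>UNIV. ?G (col8 k) * (u l * coef (b 4 (row8 l)) (col8 k)))"
    by (simp add: sum_distrib_left mult_ac)
  also have "\<dots> = (\<Sum>k\<in>UNIV. ?G (col8 k) * coef f (col8 k))"
    by (subst sum.swap) (simp add: u lookup_sum sum_distrib_left)
  also have "\<dots> = (\<Sum>q<8. ?G (cubics ! q) * coef f (cubics ! q))"
    using sum.reindex_bij_betw[OF bij_row8, of "\<lambda>q. ?G (cubics ! q) * coef f (cubics ! q)"]
    by (simp add: col8_def)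
  also have "\<dots> = (\<Sum>e\<leftarrow>cubics. ?G e * coef f e)"
    by (simp add: sum_list_sum_nth atLeast0LessThan length_cubics)
  finally show ?thesis .
qed

text \<open>The index \<open>i\<close> runs over three quadrics
  \<open>l1 y0y1 + l0 y0y2 + q2 y1^2 + q1 y1y2 + q0 y2^2\<close>, and the equations say that
  \<open>G\<close> kills their products with \<open>y0\<close>, \<open>y1\<close>,
  \<open>y2\<close>. As the catalecticant minor \<open>\<Delta>\<close> is nonzero, the products
  with \<open>y1\<close> and \<open>y2\<close> determine \<open>q0\<close> and \<open>q2\<close>
  from \<open>l1\<close>, \<open>l0\<close>, \<open>q1\<close>, so all minors involved are multiples
  of one minor \<open>D\<close>. If \<open>D\<close> is nonzero, the product with \<open>y0\<close>
  yields a linear form \<open>\<eta>\<close> such that \<open>\<eta> y1\<close> and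
  \<open>\<eta> y2\<close> solve the same equations, and these two solutions give the
  relation.\<close>

lemma net_algebra:
  fixes l0 l1 q0 q1 q2 :: "nat \<Rightarrow> complex"
  assumes eq0: "\<And>i. i < 3 \<Longrightarrow> 0 = G310 * l1 i + G301 * l0 i + G220 * q2 i + G211 * q1 i + G202 * q0 i"
    and eq1: "\<And>i. i < 3 \<Longrightarrow> q2 i = G220 * l1 i + G211 * l0 i + G121 * q1 i + G112 * q0 i"
    and eq2: "\<And>i. i < 3 \<Longrightarrow> 0 = G211 * l1 i + G202 * l0 i + G121 * q2 i + G112 * q1 i + G103 * q0 i"
    and \<Delta>: "G103 + G121 * G112 \<noteq> 0"
  defines "p u v w \<equiv> u 0 * (v 1 * w 2 - w 1 * v 2) - v 0 * (u 1 * w 2 - w 1 * u 2) + w 0 * (u 1 * v 2 - v 1 * u 2)"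
  shows "p l0 l1 q0 * (p l1 q0 q1 + p l0 q0 q2) - p l0 q0 q1 * p l0 l1 q1 = 0"
proof -
  define \<Delta> where "\<Delta> = G103 + G121 * G112"
  define c1 where "c1 = - (G211 + G121 * G220) / \<Delta>"
  define c2 where "c2 = - (G202 + G121 * G211) / \<Delta>"
  define c3 where "c3 = - (G112 + G121 * G121) / \<Delta>"
  define a1 where "a1 = G220 + G112 * c1"
  define a2 where "a2 = G211 + G112 * c2"
  define a3 where "a3 = G121 + G112 * c3"
  have \<Delta>0: "\<Delta> \<noteq> 0" using \<Delta> by (simp add: \<Delta>_def)
  have q0_solve: "y = c1 * u + c2 * v + c3 * w"
    if "z = G220 * u + G211 * v + G121 * w + G112 * y"
      "0 = G211 * u + G202 * v + G121 * z + G112 * w + G103 * y" for u v w y z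
  proof -
    have "\<Delta> * y = - (G211 + G121 * G220) * u - (G202 + G121 * G211) * v - (G112 + G121 * G121) * w"
      using that(2) unfolding that(1) \<Delta>_def by (simp add: algebra_simps) algebra
    moreover have "\<Delta> * c1 = - (G211 + G121 * G220)" "\<Delta> * c2 = - (G202 + G121 * G211)"
      "\<Delta> * c3 = - (G112 + G121 * G121)"
      using \<Delta>0 by (simp_all add: c1_def c2_def c3_def)
    ultimately have "\<Delta> * y = \<Delta> * (c1 * u + c2 * v + c3 * w)" by algebra
    then show ?thesis using \<Delta>0 by simp
  qed
  have q2_solve: "z = a1 * u + a2 * v + a3 * w"
    if "z = G220 * u + G211 * v + G121 * w + G112 * y" "y = c1 * u + c2 * v + c3 * w" for u v w y z
    unfolding that a1_def a2_def a3_def by (simp add: algebra_simps)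
  have q0: "q0 i = c1 * l1 i + c2 * l0 i + c3 * q1 i" if "i < 3" for i
    using q0_solve[OF eq1 eq2] that by blast
  have q2: "q2 i = a1 * l1 i + a2 * l0 i + a3 * q1 i" if "i < 3" for i
    using q2_solve[OF eq1 q0] that by blast
  define D where "D = p l0 l1 q1"
  have P: "p l0 l1 q0 = c3 * D" "p l1 q0 q1 = - c2 * D" "p l0 q0 q2 = - (a1 * c3 - c1 * a3) * D"
    "p l0 q0 q1 = c1 * D"
    unfolding D_def p_def by (simp_all add: q0 q2) algebra+
  have "D * (c1 + c3 * (c2 + a1 * c3 - c1 * a3)) = 0"
  proof (cases "D = 0")
    case False
    \<comment> \<open>The coefficients of the \<open>y0\<close> equation after substitution;
      \<open>\<theta>\<close> is the value of \<open>G\<close> on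
      \<open>y0 (a3 y1^2 + y1 y2 + c3 y2^2)\<close>.\<close>
    define \<theta> where "\<theta> = G211 + G220 * a3 + G202 * c3"
    define \<theta>1 where "\<theta>1 = G310 + G220 * a1 + G202 * c1"
    define \<theta>0 where "\<theta>0 = G301 + G220 * a2 + G202 * c2"
    have lin: "\<theta>1 * l1 i + \<theta>0 * l0 i + \<theta> * q1 i = 0" if "i < 3" for i
      using eq0[OF that] unfolding q0[OF that] q2[OF that] \<theta>_def \<theta>0_def \<theta>1_def
      by (simp add: algebra_simps)
    \<comment> \<open>The cofactors of the column \<open>q1\<close> cancel the other two
      columns.\<close>
    have "\<theta> * D = 0"
    proof -
      have "\<theta> * D = (\<theta>1 * l1 0 + \<theta>0 * l0 0 + \<theta> * q1 0) * (l0 1 * l1 2 - l1 1 * l0 2)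
          - (\<theta>1 * l1 1 + \<theta>0 * l0 1 + \<theta> * q1 1) * (l0 0 * l1 2 - l1 0 * l0 2)
          + (\<theta>1 * l1 2 + \<theta>0 * l0 2 + \<theta> * q1 2) * (l0 0 * l1 1 - l1 0 * l0 1)"
        unfolding D_def p_def by (simp add: algebra_simps)
      then show ?thesis using lin by simp
    qed
    then have \<theta>: "\<theta> = 0" using False by simp
    \<comment> \<open>With \<open>\<eta> = y0 + x y1 - y y2\<close>, the numbers \<open>x\<close>
      and \<open>y\<close> are chosen so that \<open>G\<close> vanishes on
      \<open>\<eta> y1^2\<close> and \<open>\<eta> y2^2\<close>. The fact \<open>xy\<close> says the
      same of \<open>\<eta> y1 y2\<close> and comes from \<open>\<theta> = 0\<close>.\<close>
    define y where "y = (G202 + G112 * G220) / \<Delta>"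
    define x where "x = G220 - y * G121"
    have "y * \<Delta> = G202 + G112 * G220" using \<Delta>0 by (simp add: y_def)
    then have y: "G202 = y * G103 - x * G112"
      unfolding x_def \<Delta>_def by (simp add: algebra_simps)
    have x: "G220 = x + y * G121" by (simp add: x_def)
    have "0 = G121 * a3 + G112 + G103 * c3"
    proof -
      have "c3 * \<Delta> = - (G112 + G121 * G121)" using \<Delta>0 by (simp add: c3_def)
      then show ?thesis unfolding a3_def \<Delta>_def by (simp add: algebra_simps)
    qed
    moreover have "a3 = G121 + G112 * c3" by (simp add: a3_def)
    ultimately have xy: "G211 + x * G121 - y * G112 = 0"
      using \<theta> x y unfolding \<theta>_def by algebra
    \<comment> \<open>The facts \<open>1\<close> and \<open>2\<close> are the solution formulas read
      on the quadrics \<open>\<eta> y1\<close> and \<open>\<eta> y2\<close>.\<close>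
    have 1: "0 = c1 * 1 + c2 * 0 + c3 * (- y)" "x = a1 * 1 + a2 * 0 + a3 * (- y)"
    proof -
      show *: "0 = c1 * 1 + c2 * 0 + c3 * (- y)"
        by (rule q0_solve[of x]) (use x xy in \<open>simp_all add: algebra_simps\<close>)
      show "x = a1 * 1 + a2 * 0 + a3 * (- y)"
        by (rule q2_solve[OF _ *]) (use x in simp)
    qed
    have 2: "- y = c1 * 0 + c2 * 1 + c3 * x"
      by (rule q0_solve[of 0]) (use y xy in \<open>simp_all add: algebra_simps\<close>)
    have "c1 + c3 * (c2 + a1 * c3 - c1 * a3) = 0" using 1 2 by algebra
    then show ?thesis by simp
  qed simp
  then show ?thesis unfolding P D_def[symmetric] by algebra
qed

lemma coef_Var_times:
  fixes f :: poly3
  shows "coef (Var 0 * f) (expo a b c) = (if a = 0 then 0 else coef f (expo (a - 1) b c))"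
    "coef (Var 1 * f) (expo a b c) = (if b = 0 then 0 else coef f (expo a (b - 1) c))"
    "coef (Var 2 * f) (expo a b c) = (if c = 0 then 0 else coef f (expo a b (c - 1)))"
  by (auto simp: Var_eq_expo coef_single_expo_times)

text \<open>Outside \<open>cube_locus\<close> the factor \<open>minor8\<close> is nonzero, which
  permits Cramer's rule, and the other factor is the nonzero minor demanded by
  \<open>net_algebra\<close>. The degree 3 part of the frame then has vanishing
  \<open>net_form\<close>.\<close>

theorem fibre_covered:
  assumes I: "I \<in> hilb (generic_hf 7)" "I \<subseteq> Ann F_form"
  shows "I \<in> net_locus \<union> cube_locus"
proof (rule ccontr)
  assume "I \<notin> net_locus \<union> cube_locus"
  then obtain b b' where b: "is_frame I b" "net_form b \<noteq> 0" and "is_frame I b'" "cube_form b' \<noteq> 0"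
    using I by (auto simp: net_locus_def cube_locus_def)
  \<comment> \<open>From here both forms are read on the same frame.\<close>
  then have cube: "cube_form b \<noteq> 0" using cube_locus_frame_indep[OF I(1)] by blast
  then have nz: "minor8 b \<noteq> 0" by (auto simp: cube_form_def)
  define G where "G e = minor8_upd e b / minor8 b" for e
  have "cube_form b = minor8 b ^ 3 * (G (expo 1 0 3) + G (expo 1 2 1) * G (expo 1 1 2))"
    using nz by (simp add: cube_form_def G_def field_simps power3_eq_cube)
  then have \<Delta>: "G (expo 1 0 3) + G (expo 1 2 1) * G (expo 1 1 2) \<noteq> 0" using cube by auto
  have in3: "b 3 i \<in> I \<inter> hom_part 3" if "i < 3" for i
    using frame_in[OF b(1) dim_hilb_3[OF I(1)]] that by simp
  have "net_form b = 0"
    unfolding net_form_def minor3_eq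
  proof (rule net_algebra[where ?G310.0 = "G (expo 3 1 0)" and ?G301.0 = "G (expo 3 0 1)" and ?G220.0 = "G (expo 2 2 0)"
        and ?G211.0 = "G (expo 2 1 1)" and ?G202.0 = "G (expo 2 0 2)" and ?G121.0 = "G (expo 1 2 1)"
        and ?G112.0 = "G (expo 1 1 2)" and ?G103.0 = "G (expo 1 0 3)"])
    fix i :: nat assume i: "i < 3"
    let ?f = "b 3 i"
    have "supp ?f \<subseteq> J_mons" using in3[OF i] I(2) Ann_imp_J_mons[of ?f 3] by auto
    then have zero: "coef ?f m = 0" if "m \<notin> J_mons" for m using that by (auto simp: in_keys_iff subset_iff)
    have z: "coef ?f (expo 3 0 0) = 0" "coef ?f (expo 0 3 0) = 0" "coef ?f (expo 0 2 1) = 0"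
      "coef ?f (expo 0 1 2) = 0" "coef ?f (expo 0 0 3) = 0"
      by (rule zero, simp add: expo_in_J_mons)+
    have in4: "Var j * ?f \<in> I \<inter> hom_part 4" for j
    proof -
      have "Var j * ?f \<in> I \<inter> hom_part (Suc 3)"
        using hilb_graded[OF I(1)] in3[OF i] unfolding graded_family_def by blast
      then show ?thesis by simp
    qed
    note eq = functional_of_frame[OF I(1) b(1) nz in4, folded G_def, unfolded cubics_def]
    show "0 = G (expo 3 1 0) * coef ?f (expo 2 1 0) + G (expo 3 0 1) * coef ?f (expo 2 0 1) +
        G (expo 2 2 0) * coef ?f (expo 1 2 0) + G (expo 2 1 1) * coef ?f (expo 1 1 1) +
        G (expo 2 0 2) * coef ?f (expo 1 0 2)"
      using eq[of 0] by (simp add: coef_Var_times z[simplified] add.assoc)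
    show "coef ?f (expo 1 2 0) = G (expo 2 2 0) * coef ?f (expo 2 1 0) + G (expo 2 1 1) * coef ?f (expo 2 0 1) +
        G (expo 1 2 1) * coef ?f (expo 1 1 1) + G (expo 1 1 2) * coef ?f (expo 1 0 2)"
      using eq[of 1] by (simp add: coef_Var_times z[simplified] add.assoc)
    show "0 = G (expo 2 1 1) * coef ?f (expo 2 1 0) + G (expo 2 0 2) * coef ?f (expo 2 0 1) +
        G (expo 1 2 1) * coef ?f (expo 1 2 0) + G (expo 1 1 2) * coef ?f (expo 1 1 1) +
        G (expo 1 0 3) * coef ?f (expo 1 0 2)"
      using eq[of 2] by (simp add: coef_Var_times z[simplified] add.assoc)
  qed (rule \<Delta>)
  then show False using b(2) by simp
qed

section \<open>Limits of ideals of points\<close>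

text \<open>The complement of a neighbourhood of \<open>I0\<close> is given by equations on frames.
  If it contained the whole family, these equations would pass to the limit frame by
  continuity.\<close>

lemma slip_limit:
  assumes I0: "I0 \<in> hilb (generic_hf r)" "is_frame I0 b0"
    and points: "\<And>t :: complex. t \<noteq> 0 \<Longrightarrow> I t \<in> point_ideals r"
    and frame: "\<And>t. t \<noteq> 0 \<Longrightarrow> is_frame (I t) (b t)"
    and lim: "\<And>k j m. ((\<lambda>t. coef (b t k j) m) \<longlongrightarrow> coef (b0 k j) m) (at 0)"
  shows "I0 \<in> slip r"
  unfolding slip_def in_closure_of topspace_hilb_topology
proof (intro conjI allI impI I0)
  let ?H = "hilb (generic_hf r)"
  fix T assume T: "I0 \<in> T \<and> openin (hilb_topology (generic_hf r)) T"
  show "\<exists>y. y \<in> point_ideals r \<and> y \<in> T"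
  proof (rule ccontr)
    assume no: "\<nexists>y. y \<in> point_ideals r \<and> y \<in> T"
    have "hilb_closed (generic_hf r) (?H - T)" using T by (simp add: openin_hilb_topology)
    then obtain P where P: "\<And>J c. J \<in> ?H \<Longrightarrow> is_frame J c \<Longrightarrow>
        J \<in> ?H - T \<longleftrightarrow> (\<forall>p\<in>P. peval (frame_coords c) p = 0)"
      unfolding hilb_closed_def by blast
    have "peval (frame_coords b0) p = 0" if "p \<in> P" for p
    proof -
      have zero: "peval (frame_coords (b t)) p = 0" if "t \<noteq> 0" for t
      proof -
        have "I t \<in> ?H" using points[OF that] by (simp add: point_ideals_def)
        moreover have "I t \<notin> T" using points[OF that] no by blast
        ultimately show ?thesis using P frame[OF that] \<open>p \<in> P\<close> by blast
      qed
      have "((\<lambda>t. peval (frame_coords (b t)) p) \<longlongrightarrow> peval (frame_coords b0) p) (at 0)"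
        by (rule tendsto_peval) (auto simp: frame_coords_def lim split: prod.split)
      moreover have "eventually (\<lambda>t. peval (frame_coords (b t)) p = 0) (at 0)"
        using zero by (auto simp: eventually_at_filter)
      ultimately have "((\<lambda>t. 0) \<longlongrightarrow> peval (frame_coords b0) p) (at (0 :: complex))"
        by (rule Lim_transform_eventually)
      then show ?thesis using LIM_const_eq[of 0] by simp
    qed
    then have "I0 \<in> ?H - T" using P I0 by blast
    then show False using T by blast
  qed
qed

text \<open>The enumeration \<open>en\<close> depends only on the standard monomials, so the frames
  of a family sharing these monomials can be compared entry by entry.\<close>

lemma is_frame_reduced:
  assumes red: "\<And>k. reduced_basis (I \<inter> hom_part k) k (N k) (g k)"
    and en: "\<And>k. bij_betw (en k) {..<card (mons k - N k)} (mons k - N k)"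
  shows "is_frame I (\<lambda>k j. if j < card (mons k - N k) then g k (en k j) else 0)"
  unfolding is_frame_def Let_def
proof
  fix k
  interpret reduced_basis "I \<inter> hom_part k" k "N k" "g k" by (rule red)
  let ?n = "card (mons k - N k)"
  let ?b = "\<lambda>j. if j < ?n then g k (en k j) else 0"
  have img: "?b ` {..<?n} = g k ` (mons k - N k)"
  proof -
    have "?b ` {..<?n} = g k ` (en k ` {..<?n})" by (simp add: image_image)
    then show ?thesis using en[of k] by (simp add: bij_betw_def)
  qed
  have "inj_on (g k \<circ> en k) {..<?n}"
    using en[of k] inj by (intro comp_inj_on) (auto simp: bij_betw_def)
  then have "inj_on ?b {..<?n}" by (auto simp: inj_on_def)
  then show "inj_on ?b {..<cvs.dim (I \<inter> hom_part k)} \<and> cvs.independent (?b ` {..<cvs.dim (I \<inter> hom_part k)}) \<and>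
      cvs.span (?b ` {..<cvs.dim (I \<inter> hom_part k)}) = I \<inter> hom_part k \<and>
      (\<forall>j\<ge>cvs.dim (I \<inter> hom_part k). ?b j = 0)"
    unfolding dim img using independent span by simp
qed

lemma graded_family_vanishing:
  "graded_family (\<lambda>k. {f \<in> hom_part k. \<forall>v\<in>V. peval (\<lambda>i. v $ i) f = 0} :: poly3 set)"
  unfolding graded_family_def
proof (intro allI conjI ballI)
  fix k
  show "cvs.subspace {f \<in> hom_part k. \<forall>v\<in>V. peval (\<lambda>i. v $ i) f = 0}"
    using subspace_hom_part[of k] by (auto simp: cvs.subspace_def peval_add)
  show "{f \<in> hom_part k. \<forall>v\<in>V. peval (\<lambda>i. v $ i) f = 0} \<subseteq> hom_part k" by blast
next
  fix k and f :: poly3 and i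
  assume f: "f \<in> {f \<in> hom_part k. \<forall>v\<in>V. peval (\<lambda>i. v $ i) f = 0}"
  then have "Var i * f \<in> hom_part (1 + k)" by (intro mult_in_hom_part Var_in_hom_part) auto
  then show "Var i * f \<in> {f \<in> hom_part (Suc k). \<forall>v\<in>V. peval (\<lambda>i. v $ i) f = 0}"
    using f by (simp add: peval_mult)
qed

lemma points_ideal_eq:
  "points_ideal V = ideal.span (\<Union>k. {f \<in> hom_part k. \<forall>v\<in>V. peval (\<lambda>i. v $ i) f = 0})"
  unfolding points_ideal_def by (rule arg_cong[of _ _ ideal.span]) blast

lemma points_ideal_part:
  "points_ideal V \<inter> hom_part k = {f \<in> hom_part k. \<forall>v\<in>V. peval (\<lambda>i. v $ i) f = 0}"
  unfolding points_ideal_eq by (rule graded_family_Int[OF graded_family_vanishing])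

lemma homogeneous_points_ideal: "homogeneous_ideal (points_ideal V)"
  unfolding points_ideal_eq by (rule homogeneous_ideal_span[OF graded_family_vanishing])

section \<open>Six points on a curve through \<open>[0:0:1]\<close>\<close>

definition curve_val :: "nat \<Rightarrow> complex \<Rightarrow> complex \<Rightarrow> complex" where
  "curve_val d t \<tau> = t * \<tau> ^ 2 + t ^ d * \<tau> ^ 5"

text \<open>\<open>arc_coef d t i a b\<close> is the coefficient of \<open>\<tau>\<^sup>i\<close> in \<open>s(\<tau>)\<^sup>a \<tau>\<^sup>b\<close> modulo \<open>\<tau>\<^sup>6 - t\<close>,
  where \<open>s = curve_val d t\<close>.\<close>

definition arc_coef :: "nat \<Rightarrow> complex \<Rightarrow> nat \<Rightarrow> nat \<Rightarrow> nat \<Rightarrow> complex" where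
  "arc_coef d t i a b = (\<Sum>j\<le>a. if (2 * a + 3 * j + b) mod 6 = i
     then of_nat (a choose j) * t ^ (a - j) * (t ^ d) ^ j * t ^ ((2 * a + 3 * j + b) div 6) else 0)"

text \<open>The binomial theorem produces the exponents \<open>2 * a + 3 * j + b\<close>, and
  \<open>\<tau> ^ 6 = t\<close> reduces them modulo 6.\<close>

lemma arc_coef_eval:
  assumes "\<tau> ^ 6 = t"
  shows "curve_val d t \<tau> ^ a * \<tau> ^ b = (\<Sum>i<6. arc_coef d t i a b * \<tau> ^ i)"
proof -
  let ?c = "\<lambda>j. of_nat (a choose j) * t ^ (a - j) * (t ^ d) ^ j :: complex"
  have red: "\<tau> ^ n = t ^ (n div 6) * \<tau> ^ (n mod 6)" for n
  proof -
    have "\<tau> ^ n = \<tau> ^ (6 * (n div 6) + n mod 6)" by simp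
    then show ?thesis by (simp only: power_add power_mult assms)
  qed
  have "curve_val d t \<tau> ^ a * \<tau> ^ b = (\<Sum>j\<le>a. of_nat (a choose j) * (t ^ d * \<tau> ^ 5) ^ j * (t * \<tau> ^ 2) ^ (a - j)) * \<tau> ^ b"
    unfolding curve_val_def by (subst add.commute) (simp only: binomial_ring)
  also have "\<dots> = (\<Sum>j\<le>a. ?c j * \<tau> ^ (2 * a + 3 * j + b))"
    unfolding sum_distrib_right
  proof (rule sum.cong[OF refl])
    fix j assume "j \<in> {..a}"
    then have "5 * j + 2 * (a - j) + b = 2 * a + 3 * j + b" by simp
    then have "\<tau> ^ (2 * a + 3 * j + b) = (\<tau> ^ 5) ^ j * (\<tau> ^ 2) ^ (a - j) * \<tau> ^ b"
      by (metis power_add power_mult)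
    then show "of_nat (a choose j) * (t ^ d * \<tau> ^ 5) ^ j * (t * \<tau> ^ 2) ^ (a - j) * \<tau> ^ b =
        ?c j * \<tau> ^ (2 * a + 3 * j + b)"
      by (simp add: power_mult_distrib mult_ac)
  qed
  also have "\<dots> = (\<Sum>j\<le>a. \<Sum>i<6. if (2 * a + 3 * j + b) mod 6 = i
      then ?c j * t ^ ((2 * a + 3 * j + b) div 6) * \<tau> ^ i else 0)"
  proof (rule sum.cong[OF refl])
    fix j
    let ?n = "2 * a + 3 * j + b"
    have "?c j * \<tau> ^ ?n = ?c j * t ^ (?n div 6) * \<tau> ^ (?n mod 6)"
      by (subst red) (simp only: mult.assoc)
    then show "?c j * \<tau> ^ ?n = (\<Sum>i<6. if ?n mod 6 = i then ?c j * t ^ (?n div 6) * \<tau> ^ i else 0)"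
      by (simp only: sum.delta finite_lessThan) simp
  qed
  also have "\<dots> = (\<Sum>i<6. arc_coef d t i a b * \<tau> ^ i)"
    unfolding arc_coef_def sum_distrib_right
    by (subst sum.swap, intro sum.cong refl) simp
  finally show ?thesis .
qed

lemma arc_coef_0: "arc_coef d t i 0 b = (if b mod 6 = i then t ^ (b div 6) else 0)"
  by (simp add: arc_coef_def)

lemma arc_coef_1:
  "arc_coef d t i 1 b = (if (2 + b) mod 6 = i then t * t ^ ((2 + b) div 6) else 0) +
     (if (5 + b) mod 6 = i then t ^ d * t ^ ((5 + b) div 6) else 0)"
proof -
  have "{..1::nat} = {0, 1}" by auto
  then show ?thesis unfolding arc_coef_def by (simp del: One_nat_def)
qed

lemma arc_coef_2:
  "arc_coef d t i 2 b = (if (4 + b) mod 6 = i then t ^ 2 * t ^ ((4 + b) div 6) else 0) +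
     (if (7 + b) mod 6 = i then 2 * t * t ^ d * t ^ ((7 + b) div 6) else 0) +
     (if (10 + b) mod 6 = i then (t ^ d) ^ 2 * t ^ ((10 + b) div 6) else 0)"
proof -
  have "{..2::nat} = {0, 1, 2}" by auto
  then show ?thesis by (simp add: arc_coef_def)
qed

text \<open>Modulo 3 the exponents in \<open>s(\<tau>)\<^sup>a \<tau>\<^sup>b\<close> are constant.\<close>

lemma arc_coef_eq_0:
  assumes "(2 * a + b) mod 3 \<noteq> i mod 3"
  shows "arc_coef d t i a b = 0"
proof -
  have "(2 * a + 3 * j + b) mod 6 \<noteq> i" for j
  proof
    assume "(2 * a + 3 * j + b) mod 6 = i"
    then have "(2 * a + 3 * j + b) mod 3 = i mod 3"
      using mod_mod_cancel[of 3 6 "2 * a + 3 * j + b"] by simp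
    moreover have "(2 * a + 3 * j + b) mod 3 = (2 * a + b + 3 * j) mod 3"
      by (simp only: ac_simps)
    ultimately show False using assms by (simp only: mod_mult_self2)
  qed
  then show ?thesis by (simp add: arc_coef_def)
qed

text \<open>Every term carries a positive power of \<open>t\<close>: from \<open>t ^ d\<close> if
  \<open>j > 0\<close>, from \<open>t ^ (a - j)\<close> if \<open>j = 0 < a\<close>, and from the
  reduction modulo 6 if \<open>a = 0\<close>.\<close>

lemma arc_coef_tendsto_0:
  assumes "a > 0 \<or> b \<ge> 6" "d > 0"
  shows "((\<lambda>t. arc_coef d t i a b) \<longlongrightarrow> 0) (at 0)"
  unfolding arc_coef_def
proof (rule tendsto_null_sum)
  fix j assume j: "j \<in> {..a}"
  let ?e = "(a - j) + d * j + (2 * a + 3 * j + b) div 6"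
  have "?e > 0"
  proof (cases "j = 0")
    case False
    then have "d * j > 0" using assms(2) by simp
    then show ?thesis by linarith
  qed (use assms(1) in auto)
  then have "((\<lambda>t :: complex. of_nat (a choose j) * t ^ ?e) \<longlongrightarrow> 0) (at 0)"
    by (auto intro!: tendsto_eq_intros simp: power_0_left)
  moreover have "of_nat (a choose j) * t ^ (a - j) * (t ^ d) ^ j * t ^ ((2 * a + 3 * j + b) div 6) =
      of_nat (a choose j) * t ^ ?e" for t :: complex
    by (simp only: power_add power_mult mult.assoc)
  ultimately show "((\<lambda>t :: complex. if (2 * a + 3 * j + b) mod 6 = i
      then of_nat (a choose j) * t ^ (a - j) * (t ^ d) ^ j * t ^ ((2 * a + 3 * j + b) div 6) else 0) \<longlongrightarrow> 0) (at 0)"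
    by (cases "(2 * a + 3 * j + b) mod 6 = i") (simp_all only: simp_thms if_True if_False tendsto_const)
qed

text \<open>The coefficient of \<open>\<tau> ^ i\<close> in the remainder of
  \<open>f(s(\<tau>), \<tau>, 1)\<close> modulo \<open>\<tau> ^ 6 - t\<close>.\<close>

definition arc_fun :: "nat \<Rightarrow> complex \<Rightarrow> nat \<Rightarrow> poly3 \<Rightarrow> complex" where
  "arc_fun d t i f = (\<Sum>m\<in>supp f. coef f m * arc_coef d t i (coef m 0) (coef m 1))"

lemma arc_fun_superset:
  assumes "finite A" "supp f \<subseteq> A"
  shows "arc_fun d t i f = (\<Sum>m\<in>A. coef f m * arc_coef d t i (coef m 0) (coef m 1))"
  unfolding arc_fun_def using assms by (intro sum.mono_neutral_left) (auto simp: in_keys_iff)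

lemma arc_fun_add: "arc_fun d t i (f + g) = arc_fun d t i f + arc_fun d t i g"
proof -
  let ?A = "supp f \<union> supp g"
  have "arc_fun d t i (f + g) = (\<Sum>m\<in>?A. coef (f + g) m * arc_coef d t i (coef m 0) (coef m 1))"
    by (rule arc_fun_superset) (auto dest: Poly_Mapping.keys_add[THEN subsetD])
  moreover have "arc_fun d t i f = (\<Sum>m\<in>?A. coef f m * arc_coef d t i (coef m 0) (coef m 1))"
    "arc_fun d t i g = (\<Sum>m\<in>?A. coef g m * arc_coef d t i (coef m 0) (coef m 1))"
    by (rule arc_fun_superset; auto)+
  ultimately show ?thesis by (simp add: lookup_add distrib_right sum.distrib)
qed

lemma arc_fun_diff: "arc_fun d t i (f - g) = arc_fun d t i f - arc_fun d t i g"
  using arc_fun_add[of d t i "f - g" g] by simp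

lemma arc_fun_zero [simp]: "arc_fun d t i 0 = 0"
  by (simp add: arc_fun_def)

lemma arc_fun_sum: "arc_fun d t i (sum f A) = (\<Sum>a\<in>A. arc_fun d t i (f a))"
  by (induction A rule: infinite_finite_induct) (auto simp: arc_fun_add)

lemma arc_fun_single: "arc_fun d t i (single m c) = c * arc_coef d t i (coef m 0) (coef m 1)"
  by (subst arc_fun_superset[of "{m}"]) auto

definition pt :: "complex \<Rightarrow> complex \<Rightarrow> complex \<Rightarrow> complex ^ 3" where
  "pt x y z = (\<chi> i. if i = 0 then x else if i = 1 then y else z)"

lemma pt_nth [simp]: "pt x y z $ 0 = x" "pt x y z $ 1 = y" "pt x y z $ 2 = z"
  by (simp_all add: pt_def)

definition arc_points :: "nat \<Rightarrow> complex \<Rightarrow> (complex ^ 3) set" where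
  "arc_points d t = insert (pt 1 0 0) ((\<lambda>\<tau>. pt (curve_val d t \<tau>) \<tau> 1) ` {\<tau>. \<tau> ^ 6 = t})"

lemma peval_eq_sum:
  fixes f :: poly3
  shows "peval v f = (\<Sum>m\<in>supp f. coef f m * (v 0 ^ coef m 0 * v 1 ^ coef m 1 * v 2 ^ coef m 2))"
proof -
  have "peval v f = (\<Sum>m\<in>supp f. peval v (single m (coef f m)))"
    by (subst cpoly_eq_sum_single[of f]) (simp only: peval_sum)
  also have "\<dots> = (\<Sum>m\<in>supp f. coef f m * (v 0 ^ coef m 0 * v 1 ^ coef m 1 * v 2 ^ coef m 2))"
    by (intro sum.cong refl) (metis expo_coef peval_single_expo)
  finally show ?thesis .
qed

text \<open>A nonzero polynomial of degree at most 5 cannot have six roots.\<close>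

lemma six_roots_coef_0:
  fixes c :: "nat \<Rightarrow> complex"
  assumes "t \<noteq> 0" "\<And>\<tau>. \<tau> ^ 6 = t \<Longrightarrow> (\<Sum>i<6. c i * \<tau> ^ i) = 0" "i < 6"
  shows "c i = 0"
proof (rule ccontr)
  assume "c i \<noteq> 0"
  then have "finite {z. (\<Sum>i\<le>5. c i * z ^ i) = 0} \<and> card {z. (\<Sum>i\<le>5. c i * z ^ i) = 0} \<le> 5"
    using \<open>i < 6\<close> by (intro polyfun_rootbound exI[of _ i]) auto
  moreover have "{..<6} = {..5::nat}" by auto
  then have "{\<tau>. \<tau> ^ 6 = t} \<subseteq> {z. (\<Sum>i\<le>5. c i * z ^ i) = 0}" using assms(2) by auto
  ultimately have "card {\<tau>. \<tau> ^ 6 = t} \<le> 5" by (meson card_mono le_trans)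
  moreover have "card {\<tau>. \<tau> ^ 6 = t} = 6" using card_nth_roots[of t 6] assms(1) by simp
  ultimately show False by simp
qed

text \<open>Membership in the ideal of the seven points becomes seven linear conditions with
  coefficients polynomial in \<open>t\<close>: six remainder coefficients, and the coefficient of
  \<open>y0^k\<close> for the point [1:0:0].\<close>

lemma vanish_arc_points_iff:
  assumes t: "t \<noteq> 0" and f: "f \<in> hom_part k"
  shows "(\<forall>v\<in>arc_points d t. peval (\<lambda>i. v $ i) f = 0) \<longleftrightarrow>
    coef f (expo k 0 0) = 0 \<and> (\<forall>i<6. arc_fun d t i f = 0)"
proof -
  have 1: "peval (\<lambda>i. pt 1 0 0 $ i) f = coef f (expo k 0 0)"
  proof -
    have "coef f m * (1 ^ coef m 0 * 0 ^ coef m 1 * 0 ^ coef m 2) =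
        (if m = expo k 0 0 then coef f (expo k 0 0) else 0)" if "m \<in> supp f" for m
    proof -
      have "mdegree m = k" using that f by (auto simp: hom_part_def)
      then show ?thesis by (cases m rule: expo_cases) (auto simp: power_0_left)
    qed
    then have "peval (\<lambda>i. pt 1 0 0 $ i) f = (\<Sum>m\<in>supp f. if m = expo k 0 0 then coef f (expo k 0 0) else 0)"
      unfolding peval_eq_sum pt_nth by (intro sum.cong) auto
    then show ?thesis by (auto simp: in_keys_iff)
  qed
  have 2: "peval (\<lambda>i. pt (curve_val d t \<tau>) \<tau> 1 $ i) f = (\<Sum>i<6. arc_fun d t i f * \<tau> ^ i)" if "\<tau> ^ 6 = t" for \<tau>
  proof -
    have "peval (\<lambda>i. pt (curve_val d t \<tau>) \<tau> 1 $ i) f =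
        (\<Sum>m\<in>supp f. coef f m * (\<Sum>i<6. arc_coef d t i (coef m 0) (coef m 1) * \<tau> ^ i))"
      unfolding peval_eq_sum pt_nth by (simp add: arc_coef_eval[OF that])
    also have "\<dots> = (\<Sum>i<6. arc_fun d t i f * \<tau> ^ i)"
      unfolding arc_fun_def sum_distrib_left sum_distrib_right
      by (subst sum.swap) (simp add: mult.assoc)
    finally show ?thesis .
  qed
  have "(\<forall>\<tau>. \<tau> ^ 6 = t \<longrightarrow> peval (\<lambda>i. pt (curve_val d t \<tau>) \<tau> 1 $ i) f = 0) \<longleftrightarrow> (\<forall>i<6. arc_fun d t i f = 0)"
  proof
    assume "\<forall>\<tau>. \<tau> ^ 6 = t \<longrightarrow> peval (\<lambda>i. pt (curve_val d t \<tau>) \<tau> 1 $ i) f = 0"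
    then have "(\<Sum>i<6. arc_fun d t i f * \<tau> ^ i) = 0" if "\<tau> ^ 6 = t" for \<tau>
      using 2[OF that] that by metis
    then show "\<forall>i<6. arc_fun d t i f = 0"
      using six_roots_coef_0[OF t, of "\<lambda>i. arc_fun d t i f"] by blast
  next
    assume "\<forall>i<6. arc_fun d t i f = 0"
    then show "\<forall>\<tau>. \<tau> ^ 6 = t \<longrightarrow> peval (\<lambda>i. pt (curve_val d t \<tau>) \<tau> 1 $ i) f = 0"
      using 2 by simp
  qed
  then show ?thesis unfolding arc_points_def using 1 by auto
qed

lemma arc_points_distinct:
  assumes "t \<noteq> 0"
  shows "finite (arc_points d t)" "card (arc_points d t) = 7" "0 \<notin> arc_points d t"
    "\<And>v w c. v \<in> arc_points d t \<Longrightarrow> w \<in> arc_points d t \<Longrightarrow> v \<noteq> w \<Longrightarrow> v \<noteq> c *s w"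
proof -
  have card6: "card {\<tau>. \<tau> ^ 6 = t} = 6" using card_nth_roots[of t 6] assms by simp
  then have fin: "finite {\<tau>. \<tau> ^ 6 = t}" by (metis card.infinite zero_neq_numeral)
  have inj: "inj (\<lambda>\<tau>. pt (curve_val d t \<tau>) \<tau> 1)" by (rule injI) (metis pt_nth(2))
  have ne: "pt 1 0 0 \<noteq> pt (curve_val d t \<tau>) \<tau> 1" for \<tau> by (metis pt_nth(3) zero_neq_one)
  show "finite (arc_points d t)" using fin by (simp add: arc_points_def)
  show "card (arc_points d t) = 7"
    unfolding arc_points_def using fin ne card6
    by (subst card_insert_disjoint) (auto simp: card_image inj_on_subset[OF inj])
  have "pt 1 0 0 \<noteq> 0" "pt (curve_val d t \<tau>) \<tau> 1 \<noteq> 0" for \<tau>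
    by (metis pt_nth(1) zero_index zero_neq_one) (metis pt_nth(3) zero_index zero_neq_one)
  then show "0 \<notin> arc_points d t" by (auto simp: arc_points_def)
  show "v \<noteq> c *s w" if vw: "v \<in> arc_points d t" "w \<in> arc_points d t" "v \<noteq> w" for v w c
  proof
    assume eq: "v = c *s w"
    have nth: "v $ i = c * w $ i" for i by (simp add: eq)
    have form: "x = pt 1 0 0 \<or> x $ 2 = 1 \<and> x = pt (curve_val d t (x $ 1)) (x $ 1) 1" if "x \<in> arc_points d t" for x
      using that unfolding arc_points_def by (elim insertE imageE) simp_all
    from form[OF vw(2)] show False
    proof (elim disjE conjE)
      assume w: "w = pt 1 0 0"
      then have "v $ 2 \<noteq> 1" using nth[of 2] by simp
      then show False using form[OF vw(1)] vw(3) w by blast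
    next
      assume w: "w $ 2 = 1" "w = pt (curve_val d t (w $ 1)) (w $ 1) 1"
      from form[OF vw(1)] show False
      proof (elim disjE conjE)
        assume v: "v = pt 1 0 0"
        then have "c = 0" using nth[of 2] w(1) by simp
        then show False using nth[of 0] v by simp
      next
        assume v: "v $ 2 = 1" "v = pt (curve_val d t (v $ 1)) (v $ 1) 1"
        then have "c = 1" using nth[of 2] w(1) by simp
        then have "v $ 1 = w $ 1" using nth[of 1] by simp
        then show False using v(2) w(2) vw(3) by simp
      qed
    qed
  qed
qed

subsection \<open>Reduced bases along the family\<close>

text \<open>The monomials \<open>y1^i y2^(k-i)\<close> reach only remainder coefficients with
  \<open>i <= k\<close>. The missing ones are reached by \<open>y0 y1^2\<close>, with coefficient
  \<open>t\<close> at \<open>\<tau> ^ 4\<close>, and by \<open>y0 y2^2\<close> and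
  \<open>y0 y1^3\<close>, with coefficients \<open>t ^ d\<close> and \<open>t\<close> at
  \<open>\<tau> ^ 5\<close>.\<close>

definition extra_mons :: "nat \<Rightarrow> (3 \<Rightarrow>\<^sub>0 nat) set" where
  "extra_mons k = (if k = 3 then {expo 1 2 0, expo 1 0 2} else if k = 4 then {expo 1 3 0} else {})"

definition std_mons :: "nat \<Rightarrow> (3 \<Rightarrow>\<^sub>0 nat) set" where
  "std_mons k = (if k \<le> 2 then mons k else J_std k \<union> extra_mons k)"

lemma std_mons_subset: "std_mons k \<subseteq> mons k"
  using J_std_subset by (auto simp: std_mons_def extra_mons_def)

lemma finite_extra_mons [simp]: "finite (extra_mons k)"
  by (simp add: extra_mons_def)

lemma card_std_mons: "card (std_mons k) = generic_hf 7 k"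
proof (cases "k \<le> 2")
  case True
  then have "k = 0 \<or> k = 1 \<or> k = 2" by auto
  then show ?thesis
    by (auto simp: std_mons_def generic_hf_def dim_hom_part card_mons numeral_eq_Suc)
next
  case False
  then have "J_std k \<inter> extra_mons k = {}" by (auto simp: J_std_def extra_mons_def)
  then have "card (std_mons k) = card (J_std k) + card (extra_mons k)"
    using False by (simp add: std_mons_def card_Un_disjoint)
  also have "\<dots> = 7" using False by (auto simp: card_J_std extra_mons_def)
  finally show ?thesis using card_mons_ge[of k] False by (simp add: generic_hf_def dim_hom_part)
qed

definition extra_coef :: "nat \<Rightarrow> complex \<Rightarrow> (3 \<Rightarrow>\<^sub>0 nat) \<Rightarrow> (3 \<Rightarrow>\<^sub>0 nat) \<Rightarrow> complex" where
  "extra_coef d t n m = (if n = expo 1 2 0 then arc_coef d t 4 (coef m 0) (coef m 1) / t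
     else if n = expo 1 0 2 then arc_coef d t 5 (coef m 0) (coef m 1) / t ^ d
     else arc_coef d t 5 (coef m 0) (coef m 1) / t)"

definition tail_coef :: "nat \<Rightarrow> complex \<Rightarrow> nat \<Rightarrow> nat \<Rightarrow> (3 \<Rightarrow>\<^sub>0 nat) \<Rightarrow> complex" where
  "tail_coef d t k i m = arc_coef d t i (coef m 0) (coef m 1) -
     (\<Sum>n\<in>extra_mons k. extra_coef d t n m * arc_coef d t i (coef n 0) (coef n 1))"

text \<open>The extra monomials cancel the remainder coefficients of \<open>m\<close> above
  \<open>k\<close>; then the binary monomials, with remainder \<open>\<tau> ^ i\<close>, cancel
  those up to \<open>k\<close>.\<close>

definition arc_basis :: "nat \<Rightarrow> complex \<Rightarrow> nat \<Rightarrow> (3 \<Rightarrow>\<^sub>0 nat) \<Rightarrow> poly3" where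
  "arc_basis d t k m = single m 1 - (\<Sum>n\<in>extra_mons k. single n (extra_coef d t n m)) -
     (\<Sum>i\<le>min 5 k. single (expo 0 i (k - i)) (tail_coef d t k i m))"

text \<open>Above \<open>k\<close> each remainder coefficient is met by exactly one extra monomial,
  and the divisors in \<open>extra_coef\<close> are its coefficients there.\<close>

lemma tail_coef_eq_0:
  assumes "t \<noteq> 0" "3 \<le> k" "k < i" "i < 6"
  shows "tail_coef d t k i m = 0"
proof -
  have "(k = 3 \<and> i = 4) \<or> (k = 3 \<and> i = 5) \<or> (k = 4 \<and> i = 5)" using assms by auto
  then show ?thesis
    using assms(1)
    by (auto simp: tail_coef_def extra_mons_def extra_coef_def arc_coef_1[simplified])
qed

lemma arc_fun_basis_part:
  assumes "i < 6"
  shows "arc_fun d t i (\<Sum>j\<le>min 5 k. single (expo 0 j (k - j)) (c j)) = (if i \<le> k then c i else 0)"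
proof -
  have "arc_fun d t i (\<Sum>j\<le>min 5 k. single (expo 0 j (k - j)) (c j)) = (\<Sum>j\<le>min 5 k. if j = i then c j else 0)"
    unfolding arc_fun_sum arc_fun_single by (intro sum.cong) (auto simp: arc_coef_0)
  then show ?thesis using assms by auto
qed

lemma arc_fun_arc_basis:
  assumes "t \<noteq> 0" "3 \<le> k" "i < 6"
  shows "arc_fun d t i (arc_basis d t k m) = 0"
proof -
  have "arc_fun d t i (arc_basis d t k m) = tail_coef d t k i m - (if i \<le> k then tail_coef d t k i m else 0)"
    unfolding arc_basis_def arc_fun_diff arc_fun_basis_part[OF assms(3)]
    by (simp add: arc_fun_sum arc_fun_single tail_coef_def)
  then show ?thesis using tail_coef_eq_0[OF assms(1,2) _ assms(3)] by simp
qed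

lemma coef_arc_basis_off:
  assumes "3 \<le> k" "m' \<notin> std_mons k"
  shows "coef (arc_basis d t k m) m' = (if m = m' then 1 else 0)"
proof -
  have "expo 0 i (k - i) \<noteq> m'" if "i \<le> min 5 k" for i
    using assms that by (auto simp: std_mons_def J_std_def)
  then have "coef (\<Sum>i\<le>min 5 k. single (expo 0 i (k - i)) (tail_coef d t k i m)) m' = 0"
    unfolding lookup_sum lookup_single when_def by (intro sum.neutral ballI) (simp only: atMost_iff if_False)
  moreover have "m' \<notin> extra_mons k" using assms by (auto simp: std_mons_def)
  then have "coef (\<Sum>n\<in>extra_mons k. single n (extra_coef d t n m)) m' = 0"
    unfolding lookup_sum lookup_single when_def by (intro sum.neutral) auto
  ultimately show ?thesis
    by (simp add: arc_basis_def lookup_minus lookup_single when_def)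
qed

lemma arc_basis_in_hom_part:
  assumes "m \<in> mons k"
  shows "arc_basis d t k m \<in> hom_part k"
  unfolding arc_basis_def using assms
  by (intro cvs.subspace_diff[OF subspace_hom_part] cvs.subspace_sum[OF subspace_hom_part] single_in_hom_part)
    (auto simp: mons_def extra_mons_def split: if_splits)

lemma sum_mons: "(\<Sum>m\<in>mons k. h m) = (\<Sum>a\<le>k. \<Sum>b\<le>k - a. h (expo a b (k - a - b)))"
proof -
  have "inj_on (\<lambda>(a, b). expo a b (k - a - b)) (SIGMA a:{..k}. {..k - a})" by (auto simp: inj_on_def)
  then show ?thesis
    unfolding mons_eq_image by (simp add: sum.reindex sum.Sigma split_def)
qed

text \<open>Apart from \<open>y0^k\<close>, which the point [1:0:0] controls, the standard monomials
  have linearly independent remainders for \<open>t \<noteq> 0\<close>.\<close>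

lemma arc_points_std_zero:
  assumes t: "t \<noteq> 0" and f: "f \<in> hom_part k" "supp f \<subseteq> std_mons k"
    and 0: "coef f (expo k 0 0) = 0" and 1: "\<And>i. i < 6 \<Longrightarrow> arc_fun d t i f = 0"
  shows "f = 0"
proof (cases "k \<le> 2")
  case True
  have fin: "arc_fun d t i f = (\<Sum>a\<le>k. \<Sum>b\<le>k - a. coef f (expo a b (k - a - b)) * arc_coef d t i a b)" for i
    using f(1) by (subst arc_fun_superset[of "mons k"]) (auto simp: in_hom_part_mons sum_mons)
  note eqs = 1[of 0] 1[of 1] 1[of 2] 1[of 3] 1[of 4] 1[of 5]
  have "k = 0 \<or> k = 1 \<or> k = 2" using True by auto
  then have *: "coef f (expo a b (k - a - b)) = 0" if "a \<le> k" "b \<le> k - a" for a b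
  proof (elim disjE)
    assume "k = 0"
    then show ?thesis using 0 that by simp
  next
    assume k: "k = 1"
    then have "(a = 0 \<and> b = 0) \<or> (a = 0 \<and> b = 1) \<or> (a = 1 \<and> b = 0)" using that by auto
    then show ?thesis
      using 0 eqs t unfolding fin k by (auto simp: arc_coef_0 arc_coef_1[simplified])
  next
    assume k: "k = 2"
    have sets: "{..2::nat} = {0, 1, 2}" "{..Suc 0} = {0, 1}" by auto
    have expand: "arc_fun d t i f = coef f (expo 0 0 2) * arc_coef d t i 0 0 +
        coef f (expo 0 1 1) * arc_coef d t i 0 1 + coef f (expo 0 2 0) * arc_coef d t i 0 2 +
        coef f (expo 1 0 1) * arc_coef d t i 1 0 + coef f (expo 1 1 0) * arc_coef d t i 1 1" for i
      using 0 unfolding fin k by (simp add: sets numeral_2_eq_2)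
    \<comment> \<open>Among the remaining monomials only \<open>y0 y1\<close> contributes to
      \<open>\<tau> ^ 3\<close> and only \<open>y0 y2\<close> to \<open>\<tau> ^ 5\<close>.\<close>
    have 110: "coef f (expo 1 1 0) = 0"
      using 1[of 3] t unfolding expand arc_coef_0 arc_coef_1 by simp
    have 101: "coef f (expo 1 0 1) = 0"
      using 1[of 5] t unfolding expand arc_coef_0 arc_coef_1 by simp
    have 00: "coef f (expo 0 0 2) = 0" "coef f (expo 0 1 1) = 0" "coef f (expo 0 2 0) = 0"
      using 1[of 0] 1[of 1] 1[of 2] unfolding expand arc_coef_0 110 101 by simp_all
    have "(a = 0 \<and> b = 0) \<or> (a = 0 \<and> b = 1) \<or> (a = 0 \<and> b = 2) \<or> (a = 1 \<and> b = 0) \<or> (a = 1 \<and> b = 1) \<or> (a = 2 \<and> b = 0)"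
      using that k by auto
    then show ?thesis
      using 0 110 101 00 unfolding k by auto
  qed
  have "coef f m = 0" if "m \<in> mons k" for m
  proof -
    obtain a b c where m: "m = expo a b c" by (rule expo_cases)
    then have "a \<le> k" "b \<le> k - a" "c = k - a - b" using that by auto
    then show ?thesis using * m by simp
  qed
  then have "coef f m = 0" for m
    using hom_part_coef_eq_0[OF f(1)] by blast
  then show ?thesis by (intro poly_mapping_eqI) simp
next
  case False
  define c where "c i = coef f (expo 0 i (k - i))" for i
  have f_eq: "f = (\<Sum>n\<in>extra_mons k. single n (coef f n)) + (\<Sum>i\<le>min 5 k. single (expo 0 i (k - i)) (c i))"
  proof (rule poly_mapping_eqI)
    fix m
    have tail: "coef (\<Sum>i\<le>min 5 k. single (expo 0 i (k - i)) (c i)) m =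
        (if \<exists>i\<le>min 5 k. m = expo 0 i (k - i) then coef f m else 0)"
    proof (cases "\<exists>i\<le>min 5 k. m = expo 0 i (k - i)")
      case True
      then obtain i where i: "i \<le> min 5 k" "m = expo 0 i (k - i)" by blast
      have "coef (\<Sum>i\<le>min 5 k. single (expo 0 i (k - i)) (c i)) m = (\<Sum>j\<le>min 5 k. if j = i then c j else 0)"
        unfolding lookup_sum by (intro sum.cong) (auto simp: i(2) lookup_single when_def)
      then show ?thesis using i True by (simp add: c_def)
    next
      case no: False
      then have "coef (\<Sum>i\<le>min 5 k. single (expo 0 i (k - i)) (c i)) m = 0"
        unfolding lookup_sum by (intro sum.neutral) (auto simp: lookup_single when_def)
      then show ?thesis by (simp only: no if_False)
    qed
    have extra: "coef (\<Sum>n\<in>extra_mons k. single n (coef f n)) m = (if m \<in> extra_mons k then coef f m else 0)"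
      by (simp add: lookup_sum lookup_single when_def)
    have "m \<in> extra_mons k \<Longrightarrow> \<not> (\<exists>i\<le>min 5 k. m = expo 0 i (k - i))"
      by (auto simp: extra_mons_def split: if_splits)
    moreover have "coef f m = 0" if "m \<notin> extra_mons k" "\<not> (\<exists>i\<le>min 5 k. m = expo 0 i (k - i))"
    proof (cases "m \<in> std_mons k")
      case True
      then have "m = expo k 0 0" using that False by (auto simp: std_mons_def J_std_def)
      then show ?thesis using 0 by simp
    next
      case False
      then show ?thesis using f(2) by (auto simp: in_keys_iff subset_iff)
    qed
    ultimately show "coef f m = coef ((\<Sum>n\<in>extra_mons k. single n (coef f n)) +
        (\<Sum>i\<le>min 5 k. single (expo 0 i (k - i)) (c i))) m"
      unfolding lookup_add tail extra
      by (cases "m \<in> extra_mons k"; cases "\<exists>i\<le>min 5 k. m = expo 0 i (k - i)") (simp_all only: if_True if_False simp_thms add_0 add_0_right True_implies_equals)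
  qed
  have eq: "0 = (\<Sum>n\<in>extra_mons k. coef f n * arc_coef d t i (coef n 0) (coef n 1)) + (if i \<le> k then c i else 0)"
    if "i < 6" for i
    using 1[OF that] by (subst (asm) f_eq)
      (simp only: arc_fun_add arc_fun_basis_part[OF that], simp only: arc_fun_sum arc_fun_single)
  \<comment> \<open>The equations with \<open>i > k\<close> involve the extra monomials
    alone.\<close>
  have extra: "coef f n = 0" if "n \<in> extra_mons k" for n
    using that eq[of 4] eq[of 5] t
    by (auto simp: extra_mons_def arc_coef_1[simplified] split: if_splits)
  have "c i = 0" if "i \<le> min 5 k" for i
    using eq[of i] that extra by simp
  then show ?thesis using extra by (subst f_eq) simp
qed

text \<open>The standard monomials do not depend on \<open>t\<close>; this gives the Hilbert
  function and frames indexed alike for all \<open>t\<close>.\<close>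

lemma reduced_arc_points:
  assumes t: "t \<noteq> 0"
  shows "reduced_basis (points_ideal (arc_points d t) \<inter> hom_part k) k (std_mons k) (arc_basis d t k)"
proof
  have mem: "f \<in> points_ideal (arc_points d t) \<inter> hom_part k \<longleftrightarrow>
      f \<in> hom_part k \<and> coef f (expo k 0 0) = 0 \<and> (\<forall>i<6. arc_fun d t i f = 0)" for f
    unfolding points_ideal_part using vanish_arc_points_iff[OF t] by blast
  show "cvs.subspace (points_ideal (arc_points d t) \<inter> hom_part k)"
    using homogeneous_ideal_graded[OF homogeneous_points_ideal] by (auto simp: graded_family_def)
  show "arc_basis d t k m \<in> points_ideal (arc_points d t) \<inter> hom_part k" if m: "m \<in> mons k - std_mons k" for m
  proof -
    have k: "3 \<le> k" using m by (auto simp: std_mons_def split: if_splits)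
    have "m \<noteq> expo k 0 0" using m k by (auto simp: std_mons_def J_std_def)
    then have "coef (arc_basis d t k m) (expo k 0 0) = 0"
      using k by (auto simp: arc_basis_def lookup_minus lookup_sum lookup_single when_def extra_mons_def)
    then show ?thesis
      unfolding mem using m arc_basis_in_hom_part arc_fun_arc_basis[OF t k] by blast
  qed
  show "coef (arc_basis d t k m) m' = (if m = m' then 1 else 0)"
    if "m \<in> mons k - std_mons k" "m' \<in> mons k - std_mons k" for m m'
    using that coef_arc_basis_off[of k m'] by (auto simp: std_mons_def split: if_splits)
  show "f = 0" if "f \<in> points_ideal (arc_points d t) \<inter> hom_part k" "supp f \<subseteq> std_mons k" for f
    using arc_points_std_zero[OF t _ that(2)] that(1) unfolding mem by blast
qed (use std_mons_subset in auto)

lemma arc_point_ideal: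
  assumes t: "t \<noteq> 0"
  shows "points_ideal (arc_points d t) \<in> point_ideals 7"
  unfolding point_ideals_def
  using hilbert_function_reduced[OF reduced_arc_points[OF t]] arc_points_distinct[OF t, where d = d]
    homogeneous_points_ideal
  by (simp add: hilb_def card_std_mons) blast

section \<open>Limits of the family\<close>

text \<open>In degree 3 this is \<open>y0\<close> times the net spanned by \<open>y0y2\<close>,
  \<open>y1y2\<close> and \<open>y0y1 - B y2^2\<close>. In degree 4 it is \<open>y0\<close> times
  the kernel of the functional with values 1 at \<open>y1^3\<close>, \<open>A\<close> at
  \<open>y2^3\<close> and 0 at the other cubic monomials through [1:0:0].\<close>

definition lim_part :: "complex \<Rightarrow> complex \<Rightarrow> nat \<Rightarrow> poly3 set" where
  "lim_part A B k = {f \<in> hom_part k. (k \<le> 2 \<longrightarrow> f = 0) \<and> (\<forall>m\<in>J_std k. coef f m = 0) \<and>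
     (k = 3 \<longrightarrow> coef f (expo 1 2 0) = 0 \<and> coef f (expo 1 0 2) + B * coef f (expo 2 1 0) = 0) \<and>
     (k = 4 \<longrightarrow> coef f (expo 1 3 0) + A * coef f (expo 1 0 3) = 0)}"

definition lim_ideal :: "complex \<Rightarrow> complex \<Rightarrow> poly3 set" where
  "lim_ideal A B = ideal.span (\<Union>k. lim_part A B k)"

definition lim_coef :: "complex \<Rightarrow> complex \<Rightarrow> (3 \<Rightarrow>\<^sub>0 nat) \<Rightarrow> (3 \<Rightarrow>\<^sub>0 nat) \<Rightarrow> complex" where
  "lim_coef A B n m = (if n = expo 1 0 2 \<and> m = expo 2 1 0 then B
     else if n = expo 1 3 0 \<and> m = expo 1 0 3 then A else 0)"

definition lim_basis :: "complex \<Rightarrow> complex \<Rightarrow> nat \<Rightarrow> (3 \<Rightarrow>\<^sub>0 nat) \<Rightarrow> poly3" where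
  "lim_basis A B k m = single m 1 - (\<Sum>n\<in>extra_mons k. single n (lim_coef A B n m))"

lemma lim_part_subset_J_part: "lim_part A B k \<subseteq> J_part k"
  by (auto simp: lim_part_def J_part_eq)

lemma subspace_lim_part: "cvs.subspace (lim_part A B k)"
proof -
  have "c * x + A * (c * y) = 0" if "x + A * y = 0" for c x y A :: complex
    using that by algebra
  moreover have "(x + x') + A * (y + y') = 0" if "x + A * y = 0" "x' + A * y' = 0" for x y x' y' A :: complex
    using that by algebra
  ultimately show ?thesis
    using subspace_hom_part[of k]
    unfolding cvs.subspace_def lim_part_def by (auto simp: lookup_add)
qed

text \<open>The critical product is \<open>y2\<close> times \<open>y0 (y0y1 - B y2^2)\<close>, on
  which the functional of degree 4 takes the value \<open>- A * B\<close>.\<close>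

lemma graded_family_lim_part:
  assumes AB: "A * B = 0"
  shows "graded_family (lim_part A B)"
  unfolding graded_family_def
proof (intro allI conjI ballI subspace_lim_part)
  show "lim_part A B k \<subseteq> hom_part k" for k by (auto simp: lim_part_def)
  fix k f i assume f: "f \<in> lim_part A B k"
  show "Var i * f \<in> lim_part A B (Suc k)"
  proof (cases "k \<le> 2")
    case True
    then have "f = 0" using f by (simp add: lim_part_def)
    then show ?thesis using subspace_lim_part[of A B] by (simp add: cvs.subspace_def)
  next
    case False
    have J: "f \<in> J_part k" using f lim_part_subset_J_part by blast
    then have "Var i * f \<in> J_part (Suc k)"
      using graded_family_J_part by (simp add: graded_family_def)
    moreover have "coef (Var i * f) (expo 1 3 0) + A * coef (Var i * f) (expo 1 0 3) = 0" if "k = 3"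
    proof -
      have supp: "coef f m = 0" if "m \<notin> J_mons" for m
        using J that by (auto simp: J_part_def in_keys_iff subset_iff)
      have "coef f (expo 0 3 0) = 0" "coef f (expo 0 0 3) = 0"
        by (rule supp, simp add: expo_in_J_mons)+
      moreover have "coef f (expo 1 2 0) = 0" "coef f (expo 1 0 2) + B * coef f (expo 2 1 0) = 0"
        using f that by (simp_all add: lim_part_def)
      moreover from this have "A * coef f (expo 1 0 2) = 0" using AB by algebra
      ultimately show ?thesis
        using all3[of "\<lambda>i. coef (Var i * f) (expo 1 3 0) + A * coef (Var i * f) (expo 1 0 3) = 0"]
        by (simp add: coef_Var_times)
    qed
    ultimately show ?thesis using False by (simp add: lim_part_def J_part_eq)
  qed
qed

lemma lim_ideal_part: "A * B = 0 \<Longrightarrow> lim_ideal A B \<inter> hom_part k = lim_part A B k"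
  unfolding lim_ideal_def by (rule graded_family_Int[OF graded_family_lim_part])

lemma homogeneous_lim_ideal: "A * B = 0 \<Longrightarrow> homogeneous_ideal (lim_ideal A B)"
  unfolding lim_ideal_def by (rule homogeneous_ideal_span[OF graded_family_lim_part])

lemma lim_ideal_subset_Ann: "lim_ideal A B \<subseteq> Ann F_form"
proof -
  have "(\<Union>k. lim_part A B k) \<subseteq> J_ideal"
    using lim_part_subset_J_part J_ideal_part by blast
  then have "lim_ideal A B \<subseteq> J_ideal"
    unfolding lim_ideal_def using homogeneous_J_ideal
    by (intro ideal.span_minimal) (auto simp: homogeneous_ideal_def)
  then show ?thesis using J_ideal_subset_Ann by blast
qed

lemma coef_lim_basis:
  "coef (lim_basis A B k m) m' = (if m = m' then 1 else 0) - (if m' \<in> extra_mons k then lim_coef A B m' m else 0)"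
  by (simp add: lim_basis_def lookup_minus lookup_sum lookup_single when_def)

text \<open>The standard monomials are those of the family, so \<open>slip_limit\<close> can compare
  the frames entry by entry.\<close>

lemma reduced_lim_ideal:
  assumes AB: "A * B = 0"
  shows "reduced_basis (lim_ideal A B \<inter> hom_part k) k (std_mons k) (lim_basis A B k)"
  unfolding lim_ideal_part[OF AB]
proof
  show "cvs.subspace (lim_part A B k)" by (rule subspace_lim_part)
  show "lim_part A B k \<subseteq> hom_part k" by (auto simp: lim_part_def)
  show "std_mons k \<subseteq> mons k" by (rule std_mons_subset)
  have k3: "3 \<le> k" if "m \<in> mons k - std_mons k" for m
    using that by (auto simp: std_mons_def split: if_splits)
  show "lim_basis A B k m \<in> lim_part A B k" if m: "m \<in> mons k - std_mons k" for m
  proof -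
    have m': "m \<notin> J_std k" "m \<notin> extra_mons k"
      using m k3[OF m] by (auto simp: std_mons_def)
    have "lim_basis A B k m \<in> hom_part k"
      unfolding lim_basis_def using m
      by (intro cvs.subspace_diff[OF subspace_hom_part] cvs.subspace_sum[OF subspace_hom_part] single_in_hom_part)
        (auto simp: mons_def extra_mons_def split: if_splits)
    moreover have "coef (lim_basis A B k m) n = 0" if "n \<in> J_std k" for n
    proof -
      have "n \<notin> extra_mons k" using that by (auto simp: J_std_def extra_mons_def split: if_splits)
      then show ?thesis using m'(1) that by (auto simp: coef_lim_basis)
    qed
    ultimately show ?thesis
      using k3[OF m] m'(2) by (auto simp: lim_part_def coef_lim_basis extra_mons_def lim_coef_def)
  qed
  show "coef (lim_basis A B k m) m' = (if m = m' then 1 else 0)"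
    if "m \<in> mons k - std_mons k" "m' \<in> mons k - std_mons k" for m m'
  proof -
    have "m' \<notin> extra_mons k" using that k3[OF that(2)] by (auto simp: std_mons_def)
    then show ?thesis by (simp add: coef_lim_basis)
  qed
  show "f = 0" if f: "f \<in> lim_part A B k" "supp f \<subseteq> std_mons k" for f
  proof (cases "k \<le> 2")
    case True
    then show ?thesis using f by (simp add: lim_part_def)
  next
    case False
    have off: "coef f m = 0" if "m \<notin> std_mons k" for m using f(2) that by (auto simp: in_keys_iff)
    have "coef f m = 0" if "m \<in> extra_mons k" for m
    proof -
      have "expo 2 1 0 \<notin> std_mons 3" "expo 1 0 3 \<notin> std_mons 4"
        by (auto simp: std_mons_def J_std_def extra_mons_def)
      then show ?thesis
        using that f(1) off by (auto simp: extra_mons_def lim_part_def split: if_splits)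
    qed
    moreover have "coef f m = 0" if "m \<in> J_std k" for m
      using that f(1) by (simp add: lim_part_def)
    ultimately show ?thesis
      using off False by (intro poly_mapping_eqI) (auto simp: std_mons_def)
  qed
qed

lemma lim_ideal_in_hilb: "A * B = 0 \<Longrightarrow> lim_ideal A B \<in> hilb (generic_hf 7)"
  using hilbert_function_reduced[OF reduced_lim_ideal] homogeneous_lim_ideal
  by (simp add: hilb_def card_std_mons)

section \<open>Enumerated frames of the limit ideals\<close>

definition nets :: "(3 \<Rightarrow>\<^sub>0 nat) list" where
  "nets = [expo 2 0 1, expo 1 1 1, expo 2 1 0]"

lemma expo_0_in_J_std: "b + c = k \<Longrightarrow> b \<le> 5 \<Longrightarrow> expo 0 b c \<in> J_std k"
  by (auto simp: J_std_def intro!: image_eqI[of _ _ b])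

lemma mons_3_diff_std: "mons 3 - std_mons 3 = set nets"
proof (intro set_eqI iffI)
  fix m assume m: "m \<in> mons 3 - std_mons 3"
  obtain a b c where m_def: "m = expo a b c" by (rule expo_cases)
  have c: "c = 3 - a - b" "a + b \<le> 3" using m by (auto simp: m_def)
  have "a \<noteq> 0"
  proof
    assume "a = 0"
    then show False using m expo_0_in_J_std[of b c 3] by (simp add: m_def std_mons_def)
  qed
  then have "a = 1 \<or> a = 2 \<or> a = 3" "b = 0 \<or> b = 1 \<or> b = 2"
    using c(2) by arith+
  then show "m \<in> set nets"
    using m c(2) unfolding c(1) m_def
    by (elim disjE) (simp_all add: std_mons_def J_std_def extra_mons_def nets_def)
qed (auto simp: nets_def std_mons_def J_std_def extra_mons_def)

lemma mons_4_diff_std: "mons 4 - std_mons 4 = set cubics"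
proof (intro set_eqI iffI)
  fix m assume m: "m \<in> mons 4 - std_mons 4"
  obtain a b c where m_def: "m = expo a b c" by (rule expo_cases)
  have c: "c = 4 - a - b" "a + b \<le> 4" using m by (auto simp: m_def)
  have "a \<noteq> 0"
  proof
    assume "a = 0"
    then show False using m expo_0_in_J_std[of b c 4] by (simp add: m_def std_mons_def)
  qed
  then have "a = 1 \<or> a = 2 \<or> a = 3 \<or> a = 4" "b = 0 \<or> b = 1 \<or> b = 2 \<or> b = 3"
    using c(2) by arith+
  then show "m \<in> set cubics"
    using m c(2) unfolding c(1) m_def
    by (elim disjE) (simp_all add: std_mons_def J_std_def extra_mons_def cubics_def)
qed (auto simp: cubics_def std_mons_def J_std_def extra_mons_def)

text \<open>Degrees 3 and 4 are listed explicitly because \<open>net_form\<close> and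
  \<open>cube_form\<close> are evaluated there; elsewhere any enumeration serves.\<close>

definition enum :: "nat \<Rightarrow> nat \<Rightarrow> (3 \<Rightarrow>\<^sub>0 nat)" where
  "enum k = (if k = 3 then (!) nets else if k = 4 then (!) cubics
     else (SOME h. bij_betw h {..<card (mons k - std_mons k)} (mons k - std_mons k)))"

lemma bij_enum: "bij_betw (enum k) {..<card (mons k - std_mons k)} (mons k - std_mons k)"
proof -
  consider "k = 3" | "k = 4" | "k \<noteq> 3" "k \<noteq> 4" by blast
  then show ?thesis
  proof cases
    case 1
    have "distinct nets" by (simp add: nets_def)
    then show ?thesis
      using bij_betw_nth[of nets "{..<length nets}" "set nets"]
      by (simp add: 1 enum_def mons_3_diff_std distinct_card)
  next
    case 2
    then show ?thesis
      using bij_betw_nth[OF distinct_cubics, of "{..<length cubics}" "set cubics"]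
      by (simp add: enum_def mons_4_diff_std distinct_card[OF distinct_cubics])
  next
    case 3
    have "\<exists>h. bij_betw h {..<card (mons k - std_mons k)} (mons k - std_mons k)"
      using ex_bij_betw_nat_finite[of "mons k - std_mons k"] by (simp add: atLeast0LessThan)
    then have "bij_betw (SOME h. bij_betw h {..<card (mons k - std_mons k)} (mons k - std_mons k))
        {..<card (mons k - std_mons k)} (mons k - std_mons k)"
      by (rule someI_ex)
    then show ?thesis using 3 by (simp add: enum_def)
  qed
qed

definition lim_frame :: "complex \<Rightarrow> complex \<Rightarrow> frame" where
  "lim_frame A B = (\<lambda>k j. if j < card (mons k - std_mons k) then lim_basis A B k (enum k j) else 0)"

lemma is_frame_lim: "A * B = 0 \<Longrightarrow> is_frame (lim_ideal A B) (lim_frame A B)"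
  unfolding lim_frame_def by (rule is_frame_reduced[OF reduced_lim_ideal bij_enum])

section \<open>Convergence of the frames along the curves\<close>

lemma tendsto_at_0_cong:
  fixes f g :: "complex \<Rightarrow> complex"
  assumes "(g \<longlongrightarrow> l) (at 0)" "\<And>t. t \<noteq> 0 \<Longrightarrow> f t = g t"
  shows "(f \<longlongrightarrow> l) (at 0)"
proof -
  have "eventually (\<lambda>t. g t = f t) (at 0)" using assms(2) by (auto simp: eventually_at_filter)
  then show ?thesis using assms(1) by (rule Lim_transform_eventually[rotated])
qed

text \<open>Only two limits can be nonzero: \<open>t ^ 2 / t ^ d\<close>, from
  \<open>y0^2 y1\<close> in degree 3, equals 1 for \<open>d = 2\<close>, and
  \<open>t ^ d / t\<close>, from \<open>y0 y2^3\<close> in degree 4, equals 1 for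
  \<open>d = 1\<close>.\<close>

lemma extra_coef_tendsto:
  fixes d :: nat
  assumes d: "d = 1 \<or> d = 2" and n: "n \<in> extra_mons k" and m: "m \<in> mons k - std_mons k"
  shows "((\<lambda>t. extra_coef d t n m) \<longlongrightarrow> lim_coef (if d = 1 then 1 else 0) (if d = 2 then 1 else 0) n m) (at 0)"
proof -
  have k: "k = 3 \<or> k = 4" using n by (auto simp: extra_mons_def split: if_splits)
  have z1: "((\<lambda>t :: complex. t + (t ^ d) ^ 2) \<longlongrightarrow> 0) (at 0)"
    using d by (auto intro!: tendsto_eq_intros)
  have z2: "((\<lambda>t :: complex. t ^ 2 / t ^ d + t ^ d * t) \<longlongrightarrow> (if d = 2 then 1 else 0)) (at 0)"
    using d
  proof
    assume d1: "d = 1"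
    have "((\<lambda>t :: complex. t + t * t) \<longlongrightarrow> 0 + 0 * 0) (at 0)" by (intro tendsto_intros)
    then have "((\<lambda>t :: complex. t + t * t) \<longlongrightarrow> (if d = 2 then 1 else 0)) (at 0)" by (simp add: d1)
    then show ?thesis by (rule tendsto_at_0_cong) (simp add: d1 power2_eq_square)
  next
    assume d2: "d = 2"
    have "((\<lambda>t :: complex. 1 + t ^ 2 * t) \<longlongrightarrow> 1 + 0 ^ 2 * 0) (at 0)" by (intro tendsto_intros)
    then have "((\<lambda>t :: complex. 1 + t ^ 2 * t) \<longlongrightarrow> (if d = 2 then 1 else 0)) (at 0)" by (simp add: d2)
    then show ?thesis by (rule tendsto_at_0_cong) (simp add: d2)
  qed
  have z3: "((\<lambda>t :: complex. t ^ d / t) \<longlongrightarrow> (if d = 1 then 1 else 0)) (at 0)"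
    using d
  proof
    assume d1: "d = 1"
    have "((\<lambda>t :: complex. 1) \<longlongrightarrow> (if d = 1 then 1 else 0)) (at 0)" by (simp add: d1)
    then show ?thesis by (rule tendsto_at_0_cong) (simp add: d1)
  next
    assume d2: "d = 2"
    have "((\<lambda>t :: complex. t) \<longlongrightarrow> (if d = 1 then 1 else 0)) (at 0)" by (simp add: d2)
    then show ?thesis by (rule tendsto_at_0_cong) (simp add: d2 power2_eq_square)
  qed
  from k show ?thesis
  proof
    assume k: "k = 3"
    have m3: "m = expo 2 0 1 \<or> m = expo 1 1 1 \<or> m = expo 2 1 0"
      using m unfolding k mons_3_diff_std by (simp add: nets_def)
    from n have "n = expo 1 2 0 \<or> n = expo 1 0 2" by (simp add: k extra_mons_def)
    then show ?thesis
    proof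
      assume n: "n = expo 1 2 0"
      have eq: "extra_coef d t n m = (if m = expo 2 0 1 then t + (t ^ d) ^ 2 else 0)" if "t \<noteq> 0" for t
        using m3 that by (auto simp: n extra_coef_def arc_coef_2 arc_coef_1[simplified] field_simps power2_eq_square)
      have "((\<lambda>t. if m = expo 2 0 1 then t + (t ^ d) ^ 2 else 0) \<longlongrightarrow> lim_coef (if d = 1 then 1 else 0) (if d = 2 then 1 else 0) n m) (at 0)"
        using z1 by (cases "m = expo 2 0 1") (simp_all add: n lim_coef_def)
      then show ?thesis by (rule tendsto_at_0_cong) (rule eq)
    next
      assume n: "n = expo 1 0 2"
      have eq: "extra_coef d t n m = (if m = expo 2 1 0 then t ^ 2 / t ^ d + t ^ d * t else 0)" if "t \<noteq> 0" for t
        using m3 that by (auto simp: n extra_coef_def arc_coef_2 arc_coef_1[simplified] field_simps power2_eq_square)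
      have "((\<lambda>t. if m = expo 2 1 0 then t ^ 2 / t ^ d + t ^ d * t else 0) \<longlongrightarrow> lim_coef (if d = 1 then 1 else 0) (if d = 2 then 1 else 0) n m) (at 0)"
        using z2 by (cases "m = expo 2 1 0") (simp_all add: n lim_coef_def)
      then show ?thesis by (rule tendsto_at_0_cong) (rule eq)
    qed
  next
    assume k: "k = 4"
    have m4: "m \<in> set cubics" using m unfolding k mons_4_diff_std .
    have n: "n = expo 1 3 0" using n by (simp add: k extra_mons_def)
    \<comment> \<open>For \<open>y0^3 y1\<close> and \<open>y0^3 y2\<close> the coefficient vanishes
      by the exponents modulo 3.\<close>
    have eq: "extra_coef d t n m = (if m = expo 2 1 1 then t + (t ^ d) ^ 2 else if m = expo 1 0 3 then t ^ d / t else 0)"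
      if "t \<noteq> 0" for t
      using m4 that by (auto simp: n cubics_def extra_coef_def arc_coef_eq_0 arc_coef_2 arc_coef_1[simplified] field_simps power2_eq_square)
    have "((\<lambda>t. if m = expo 2 1 1 then t + (t ^ d) ^ 2 else if m = expo 1 0 3 then t ^ d / t else 0) \<longlongrightarrow>
        lim_coef (if d = 1 then 1 else 0) (if d = 2 then 1 else 0) n m) (at 0)"
      using z1 z3 by (cases "m = expo 2 1 1"; cases "m = expo 1 0 3") (simp_all add: n lim_coef_def)
    then show ?thesis by (rule tendsto_at_0_cong) (rule eq)
  qed
qed

text \<open>Since \<open>m\<close> lies outside \<open>J_std k\<close>, its own remainder tends to
  0; each correction is a convergent factor times the null remainder of an extra monomial.\<close>

lemma tail_coef_tendsto:
  fixes d :: nat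
  assumes d: "d = 1 \<or> d = 2" and m: "m \<in> mons k - std_mons k"
  shows "((\<lambda>t. tail_coef d t k i m) \<longlongrightarrow> 0) (at 0)"
proof -
  have d0: "d > 0" using d by auto
  obtain a b c where m_def: "m = expo a b c" by (rule expo_cases)
  have "3 \<le> k" using m by (auto simp: std_mons_def split: if_splits)
  then have "m \<notin> J_std k" using m by (auto simp: std_mons_def)
  then have "a > 0 \<or> b \<ge> 6" using m by (auto simp: m_def J_std_def image_iff)
  then have "((\<lambda>t. arc_coef d t i (coef m 0) (coef m 1)) \<longlongrightarrow> 0) (at 0)"
    using d0 by (auto simp: m_def intro: arc_coef_tendsto_0)
  moreover have "((\<lambda>t. \<Sum>n\<in>extra_mons k. extra_coef d t n m * arc_coef d t i (coef n 0) (coef n 1)) \<longlongrightarrow> 0) (at 0)"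
  proof (rule tendsto_null_sum)
    fix n assume n: "n \<in> extra_mons k"
    then have "coef n 0 > 0" by (auto simp: extra_mons_def split: if_splits)
    then show "((\<lambda>t. extra_coef d t n m * arc_coef d t i (coef n 0) (coef n 1)) \<longlongrightarrow> 0) (at 0)"
      using tendsto_mult[OF extra_coef_tendsto[OF d n m] arc_coef_tendsto_0[of "coef n 0" "coef n 1" d i]] d0 by simp
  qed
  ultimately show ?thesis unfolding tail_coef_def using tendsto_diff by fastforce
qed

lemma arc_basis_tendsto:
  fixes d :: nat
  assumes d: "d = 1 \<or> d = 2" and m: "m \<in> mons k - std_mons k"
  shows "((\<lambda>t. coef (arc_basis d t k m) m') \<longlongrightarrow>
    coef (lim_basis (if d = 1 then 1 else 0) (if d = 2 then 1 else 0) k m) m') (at 0)"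
proof -
  let ?A = "if d = 1 then 1 else 0" and ?B = "if d = 2 then 1 else 0"
  have "((\<lambda>t. coef (single m 1) m' - (\<Sum>n\<in>extra_mons k. coef (single n (extra_coef d t n m)) m') -
      (\<Sum>i\<le>min 5 k. coef (single (expo 0 i (k - i)) (tail_coef d t k i m)) m')) \<longlongrightarrow>
      coef (single m (1 :: complex)) m' - (\<Sum>n\<in>extra_mons k. coef (single n (lim_coef ?A ?B n m)) m') - 0) (at 0)"
  proof (intro tendsto_diff tendsto_sum tendsto_null_sum tendsto_const)
    fix n assume "n \<in> extra_mons k"
    then show "((\<lambda>t. coef (single n (extra_coef d t n m)) m') \<longlongrightarrow> coef (single n (lim_coef ?A ?B n m)) m') (at 0)"
      using extra_coef_tendsto[OF d _ m] by (cases "n = m'") (simp_all add: lookup_single when_def)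
  next
    fix i
    show "((\<lambda>t. coef (single (expo 0 i (k - i)) (tail_coef d t k i m)) m') \<longlongrightarrow> 0) (at 0)"
      using tail_coef_tendsto[OF d m, of i] by (cases "expo 0 i (k - i) = m'") (simp_all add: lookup_single when_def)
  qed
  then show ?thesis
    by (simp only: arc_basis_def lim_basis_def lookup_minus lookup_sum diff_zero)
qed

lemma lim_ideal_in_slip:
  fixes d :: nat
  assumes d: "d = 1 \<or> d = 2"
  shows "lim_ideal (if d = 1 then 1 else 0) (if d = 2 then 1 else 0) \<in> slip 7"
proof -
  let ?A = "if d = 1 then 1 else 0 :: complex" and ?B = "if d = 2 then 1 else 0 :: complex"
  let ?b = "\<lambda>t k j. if j < card (mons k - std_mons k) then arc_basis d t k (enum k j) else 0"
  have AB: "?A * ?B = 0" by simp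
  show ?thesis
  proof (rule slip_limit[OF lim_ideal_in_hilb[OF AB] is_frame_lim[OF AB]])
    show "points_ideal (arc_points d t) \<in> point_ideals 7" if "t \<noteq> 0" for t
      by (rule arc_point_ideal[OF that])
    show "is_frame (points_ideal (arc_points d t)) (?b t)" if "t \<noteq> 0" for t
      by (rule is_frame_reduced[OF reduced_arc_points[OF that] bij_enum])
    fix k j m
    show "((\<lambda>t. coef (?b t k j) m) \<longlongrightarrow> coef (lim_frame ?A ?B k j) m) (at 0)"
    proof (cases "j < card (mons k - std_mons k)")
      case True
      then have "enum k j \<in> mons k - std_mons k" using bij_betwE[OF bij_enum[of k]] by auto
      then show ?thesis
        using arc_basis_tendsto[OF d, of "enum k j" k m] True by (simp add: lim_frame_def)
    qed (simp add: lim_frame_def)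
  qed
qed

section \<open>Separation of the two limits, and reducibility\<close>

lemma cube_form_lim: "cube_form (lim_frame 1 0) \<noteq> 0"
proof -
  let ?b = "lim_frame 1 0"
  have b: "coef (?b 4 (row8 i)) n = (if col8 i = n then 1 else 0) -
      (if n = expo 1 3 0 \<and> col8 i = expo 1 0 3 then 1 else 0)" for i n
  proof -
    have "?b 4 (row8 i) = lim_basis 1 0 4 (col8 i)"
      using row8_less[of i]
      by (simp add: lim_frame_def mons_4_diff_std distinct_card[OF distinct_cubics] length_cubics enum_def col8_def)
    then show ?thesis by (simp add: coef_lim_basis extra_mons_def lim_coef_def)
  qed
  have in_cubics: "col8 i \<in> set cubics" for i
    using row8_less[of i] by (simp add: col8_def length_cubics)
  have ne: "col8 i \<noteq> expo 1 3 0" for i using in_cubics[of i] by (auto simp: cubics_def)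
  have ex: "\<exists>i. col8 i = e" if e: "e \<in> set cubics" for e
  proof -
    obtain q where "q < 8" "e = cubics ! q" using e by (auto simp: in_set_conv_nth length_cubics)
    moreover have "q \<in> row8 ` UNIV" using bij_row8 \<open>q < 8\<close> by (simp add: bij_betw_def)
    ultimately show ?thesis by (auto simp: col8_def)
  qed
  \<comment> \<open>On the columns \<open>cubics\<close> the frame is the identity matrix.\<close>
  have "minor8 ?b = 1"
    unfolding minor8_def minor_def by (subst det_diagonal) (auto simp: b ne[simplified] inj_col8)
  \<comment> \<open>Replacing the column of \<open>y0 y2^3\<close> by that of \<open>y0 y1^3\<close>
    leaves a diagonal matrix with one entry -1.\<close>
  moreover have "minor8_upd (expo 1 0 3) ?b \<noteq> 0"
    unfolding minor8_upd_def minor_def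
    by (subst det_diagonal) (auto simp: b ne[simplified] inj_col8, metis inj_col8)
  moreover have "minor8_upd (expo 1 2 1) ?b = 0"
  proof -
    obtain i where i: "col8 i = expo 1 2 1" using ex[of "expo 1 2 1"] by (auto simp: cubics_def)
    \<comment> \<open>The only nonzero entry of this row was in the replaced column.\<close>
    have "row i (\<chi> i j. coef (?b 4 (row8 i)) (if col8 j = expo 1 2 1 then expo 1 3 0 else col8 j)) = 0"
      by (simp add: row_def vec_eq_iff b i)
    then show ?thesis unfolding minor8_upd_def minor_def by (rule det_zero_row)
  qed
  ultimately show ?thesis by (simp add: cube_form_def)
qed

text \<open>The frame is \<open>y0^2y2\<close>, \<open>y0y1y2\<close>,
  \<open>y0^2y1 - y0y2^2\<close>. The second row is zero in the first minor of
  \<open>net_form\<close>, so only the last product remains, with factors 1 and -1.\<close>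

lemma net_form_lim: "net_form (lim_frame 0 1) \<noteq> 0"
proof -
  have "lim_frame 0 1 3 j = lim_basis 0 1 3 (nets ! j)" if "j < 3" for j
    using that by (simp add: lim_frame_def mons_3_diff_std enum_def nets_def)
  then have "lim_frame 0 1 3 0 = lim_basis 0 1 3 (expo 2 0 1)" "lim_frame 0 1 3 1 = lim_basis 0 1 3 (expo 1 1 1)"
    "lim_frame 0 1 3 2 = lim_basis 0 1 3 (expo 2 1 0)"
    by (simp_all add: nets_def)
  then show ?thesis
    by (simp add: net_form_def minor3_eq coef_lim_basis extra_mons_def lim_coef_def)
qed

text \<open>The ideal \<open>lim_ideal 1 0\<close> lies off \<open>cube_locus\<close> and
  \<open>lim_ideal 0 1\<close> off \<open>net_locus\<close>, so the two closed traces covering the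
  fibre are both proper.\<close>

theorem reducible_border_vsp:
  "reducible_space (subtopology (hilb_topology (generic_hf 7)) (border_vsp F_form 7))"
proof -
  let ?S = "border_vsp F_form 7" and ?X = "hilb_topology (generic_hf 7)"
  have S: "?S \<subseteq> hilb (generic_hf 7)"
    using slip_subset_hilb by (auto simp: border_vsp_def)
  then have top: "topspace (subtopology ?X ?S) = ?S"
    by (auto simp: topspace_hilb_topology)
  have closed: "closedin (subtopology ?X ?S) (Z \<inter> ?S)" if "hilb_closed (generic_hf 7) Z" for Z
    using that closedin_hilb_topology closedin_subtopology by blast
  have cover: "?S \<subseteq> net_locus \<union> cube_locus"
    using S fibre_covered by (auto simp: border_vsp_def)
  have "lim_ideal 1 0 \<in> ?S" "lim_ideal 0 1 \<in> ?S"
    using lim_ideal_in_slip[of 1] lim_ideal_in_slip[of 2] lim_ideal_subset_Ann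
    by (simp_all add: border_vsp_def)
  moreover have "lim_ideal 1 0 \<notin> cube_locus" "lim_ideal 0 1 \<notin> net_locus"
    using is_frame_lim[of 1 0] is_frame_lim[of 0 1] cube_form_lim net_form_lim
    by (auto simp: cube_locus_def net_locus_def)
  ultimately have "net_locus \<inter> ?S \<noteq> ?S" "cube_locus \<inter> ?S \<noteq> ?S" by blast+
  moreover have "(net_locus \<inter> ?S) \<union> (cube_locus \<inter> ?S) = ?S" using cover by blast
  ultimately show ?thesis
    unfolding reducible_space_def top
    using closed[OF hilb_closed_net_locus] closed[OF hilb_closed_cube_locus] by blast
qed

theorem proposition8p25:
  fixes F :: poly3 and J :: "poly3 set"
  assumes "F = Var 0 ^ 11 + Var 1 ^ 5 * Var 2 ^ 6"
    and "J = ideal.span {Var 0 * Var 1, Var 0 * Var 2, Var 1 ^ 6}"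
  shows "border_rank 11 F = 7
    \<and> J \<subseteq> Ann F
    \<and> border_vsp F 7 = {I \<in> slip 7. phi 7 I = proj_subscheme J}
    \<and> reducible_space (subtopology (hilb_topology (generic_hf 7)) (border_vsp F 7))"
proof -
  have "F = F_form" using assms(1) F_form_eq by simp
  moreover have "J = J_ideal" using assms(2) by (simp add: J_ideal_def)
  ultimately show ?thesis
    using border_rank_F J_ideal_subset_Ann border_vsp_eq_fibre reducible_border_vsp by simp
qed

end
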